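(* Let $X$ be an infinite-dimensional complex Banach space and $A\in L(X)$. The following conditions are equivalent: (i) $A$ is right generalized Drazin-Riesz invertible, i.e. there is $B\in L(X)$ such that $ABA=A^2B$, $AB^2=B$ and $A-ABA$ is Riesz; (ii) there exists $C\in L(X)$ such that $ACA=A^2C$, $AC^2=C=CAC$ and $A-ACA$ is Riesz; (iii) there exists $(M,N)\in Red(A)$ such that $A_M$ is right invertible and $A_N$ is Riesz; (iv) there exists a projector $P\in L(X)$ commuting with $A$ such that $A+P$ is right Browder and $AP$ is Riesz; (v) there exists a projector $P\in L(X)$ commuting with $A$ such that $A(I-P)+P$ is right Browder and $AP$ is Riesz; (vi) there exist $C,D,P\in L(X)$ such that $C$ is right Browder, $D$ is Riesz, $P$ is a projector commuting with $C$ and $D$, and $A=C(I-P)+DP$; (vii) $A$ is right Riesz-quasipolar; (viii) $A$ admits a GSRD and $0\notin \mathrm{int}\,\sigma_r(A)$; (ix) $A$ admits a GSRD and the dual operator $A'$ has the SVEP at $0$; (x) $A$ admits a GSRD and $0\notin \mathrm{acc}\,\sigma_{\mathcal B}^r(A)$; (xi) $A$ admits a GSRD and $0\notin \mathrm{int}\,\sigma_{\mathcal B}^r(A)$; (xii) $A$ admits a GSRD and $0\notin \mathrm{acc}\,\sigma_{dsc}(A)$; (xiii) $A$ admits a GSRD and $0\notin \mathrm{int}\,\sigma_{dsc}(A)$; (xiv) $A$ admits a GSRD and $0\notin \mathrm{int}\,\sigma_{cp}(A)$.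
   Context: $L(X)$ is the algebra of bounded linear operators on $X$; $\mathcal N(A)$, $\mathcal R(A)$ denote null-space and range; $A'$ is the dual operator on the dual space $X'$; a projector is an idempotent in $L(X)$. For $K\subset\mathbb C$, $\mathrm{int}\,K$ is its interior and $\mathrm{acc}\,K$ its set of accumulation points. The notions below are used for operators on any complex Banach space, in particular on closed invariant subspaces (possibly $\{0\}$). $(M,N)\in Red(A)$ means: $M,N$ are closed $A$-invariant subspaces with $X=M\oplus N$; $A_M:M\to M$, $A_N:N\to N$ are the restrictions of $A$. A subspace is complemented if it is closed and has a closed algebraic complement. The descent is $d(A)=\inf\{n\ge 0: \mathcal R(A)+ \mathcal N(A^n)=X\}$ ($\inf\emptyset=\infty$). $A$ is right Browder if $\mathrm{codim}\,\mathcal R(A)<\infty$, $d(A)<\infty$ and $\mathcal N(A)$ is complemented. $A$ is Riesz if $\dim\mathcal N(A-\lambda I)<\infty$ and $\mathrm{codim}\,\mathcal R(A-\lambda I)<\infty$ for every nonzero $\lambda\in\mathbb C$. $A$ is Kato if $\mathcal R(A)$ is closed and $\mathcal N(A)\subset\mathcal R(A^n)$ for every $n\in\mathbb N$; $A$ is Saphar if it is Kato and $\mathcal N(A)$, $\mathcal R(A)$ are complemented. $A$ admits a GSRD (generalized Saphar-Riesz decomposition) if there is $(M,N)\in Red(A)$ such that $A_M$ is Saphar and $A_N$ is Riesz. $A$ is right Riesz-quasipolar if there is a projector $Q\in L(X)$ with $AQ=QA$, $A(I-Q)$ Riesz, and $Q\in AL(X)=\{AT:T\in L(X)\}$. An operator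 $T$ on a Banach space $Y$ has the SVEP at $\lambda_0$ if for every open disc $D_{\lambda_0}$ centered at $\lambda_0$ the only analytic $f:D_{\lambda_0}\to Y$ with $(T-\lambda I)f(\lambda)=0$ for all $\lambda\in D_{\lambda_0}$ is $f\equiv0$. Spectra: $\sigma_r(A)$ (right spectrum) and $\sigma_{\mathcal B}^r(A)$ are the sets of $\lambda\in\mathbb C$ such that $A-\lambda I$ is not right invertible, not right Browder, respectively; $\sigma_{dsc}(A)=\{\lambda\in\mathbb C: d(A-\lambda I)=\infty\}$; $\sigma_{cp}(A)$ (compression spectrum) is the set of $\lambda\in\mathbb C$ such that $A-\lambda I$ does not have dense range. *)

theory Defs
  imports "HOL-Analysis.Analysis"
begin

section \<open>Complex normed spaces\<close>

class scaleC = scaleR +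
  fixes scaleC :: "complex \<Rightarrow> 'a \<Rightarrow> 'a" (infixr \<open>*\<^sub>C\<close> 75)

class complex_normed_vector = scaleC + real_normed_vector +
  assumes scaleC_add_right: "a *\<^sub>C (x + y) = a *\<^sub>C x + a *\<^sub>C y"
    and scaleC_add_left: "(a + b) *\<^sub>C x = a *\<^sub>C x + b *\<^sub>C x"
    and scaleC_scaleC: "a *\<^sub>C (b *\<^sub>C x) = (a * b) *\<^sub>C x"
    and scaleC_one: "1 *\<^sub>C x = x"
    and scaleR_scaleC: "r *\<^sub>R x = complex_of_real r *\<^sub>C x"
    and norm_scaleC: "norm (a *\<^sub>C x) = cmod a * norm x"

class complex_banach = complex_normed_vector + banach

global_interpretation complex_vector:
  vector_space "scaleC :: complex \<Rightarrow> 'a \<Rightarrow> 'a::complex_normed_vector"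
  by unfold_locales (simp_all add: scaleC_add_right scaleC_add_left scaleC_scaleC scaleC_one)

instantiation complex :: complex_banach
begin
definition scaleC_complex :: "complex \<Rightarrow> complex \<Rightarrow> complex"
  where "scaleC_complex = (*)"
instance
  by standard (simp_all add: scaleC_complex_def algebra_simps norm_mult scaleR_conv_of_real)
end

lemma bounded_linear_scaleC: "bounded_linear (\<lambda>x::'a::complex_normed_vector. c *\<^sub>C x)"
  by (rule bounded_linear_intro[where K = "cmod c"])
    (simp_all add: scaleC_add_right scaleR_scaleC scaleC_scaleC mult.commute norm_scaleC)

instantiation blinfun :: (real_normed_vector, complex_normed_vector) complex_normed_vector
begin
definition scaleC_blinfun :: "complex \<Rightarrow> 'a \<Rightarrow>\<^sub>L 'b \<Rightarrow> 'a \<Rightarrow>\<^sub>L 'b"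
  where "scaleC_blinfun c f = Blinfun (\<lambda>x. c *\<^sub>C blinfun_apply f x)"

lemma scaleC_blinfun_apply [simp]: "blinfun_apply (c *\<^sub>C f) x = c *\<^sub>C blinfun_apply f x"
  unfolding scaleC_blinfun_def
  by (subst bounded_linear_Blinfun_apply)
    (auto intro: bounded_linear_compose[OF bounded_linear_scaleC] blinfun.bounded_linear_right)

instance
proof
  fix a b :: complex and r :: real and x y :: "'a \<Rightarrow>\<^sub>L 'b"
  show "a *\<^sub>C (x + y) = a *\<^sub>C x + a *\<^sub>C y"
    by (rule blinfun_eqI) (simp add: blinfun.add_left scaleC_add_right)
  show "(a + b) *\<^sub>C x = a *\<^sub>C x + b *\<^sub>C x"
    by (rule blinfun_eqI) (simp add: blinfun.add_left scaleC_add_left)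
  show "a *\<^sub>C (b *\<^sub>C x) = (a * b) *\<^sub>C x"
    by (rule blinfun_eqI) (simp add: scaleC_scaleC)
  show "1 *\<^sub>C x = x"
    by (rule blinfun_eqI) (simp add: scaleC_one)
  show "r *\<^sub>R x = complex_of_real r *\<^sub>C x"
    by (rule blinfun_eqI) (simp add: blinfun.scaleR_left scaleR_scaleC)
  have le: "norm (c *\<^sub>C z) \<le> cmod c * norm z" for c and z :: "'a \<Rightarrow>\<^sub>L 'b"
    by (rule norm_blinfun_bound)
      (auto simp: norm_scaleC mult.assoc intro!: mult_left_mono norm_blinfun)
  show "norm (a *\<^sub>C x) = cmod a * norm x"
  proof (cases "a = 0")
    case True
    then show ?thesis using le[of 0 x] by simp
  next
    case False
    have "x = inverse a *\<^sub>C (a *\<^sub>C x)"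
      using False by (intro blinfun_eqI) (simp add: scaleC_scaleC scaleC_one)
    then have "norm x \<le> inverse (cmod a) * norm (a *\<^sub>C x)"
      using le[of "inverse a" "a *\<^sub>C x"] by (simp add: norm_inverse)
    then have "cmod a * norm x \<le> norm (a *\<^sub>C x)"
      using False by (simp add: field_simps)
    with le[of a x] show ?thesis by simp
  qed
qed
end

instance blinfun :: (real_normed_vector, complex_banach) complex_banach ..

text \<open>
  The dimension of the subspace \<open>V\<close>, and the codimension of the subspace \<open>V\<close> of \<open>X\<close>
  (the dimension of \<open>X / V\<close>): the least size of a finite set spanning \<open>V\<close>, respectively
  spanning \<open>X\<close> modulo \<open>V\<close>.  The value is infinite if there is no such set.
\<close>

definition cdim :: "'a::complex_normed_vector set \<Rightarrow> enat"
  where "cdim V = (INF F\<in>{F. finite F \<and> complex_vector.span F = V}. enat (card F))"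

definition codim :: "'a::complex_normed_vector set \<Rightarrow> 'a set \<Rightarrow> enat"
  where "codim X V =
    (INF F\<in>{F. finite F \<and> F \<subseteq> X \<and> V + complex_vector.span F = X}. enat (card F))"

definition closed_csubspace :: "'a::complex_normed_vector set \<Rightarrow> bool"
  where "closed_csubspace V \<longleftrightarrow> complex_vector.subspace V \<and> closed V"

definition direct_sum :: "'a::complex_normed_vector set \<Rightarrow> 'a set \<Rightarrow> 'a set \<Rightarrow> bool"
  where "direct_sum X V W \<longleftrightarrow> V + W = X \<and> V \<inter> W = {0}"

definition complemented :: "'a::complex_normed_vector set \<Rightarrow> 'a set \<Rightarrow> bool"
  where "complemented X V \<longleftrightarrow>
    closed_csubspace V \<and> (\<exists>W. closed_csubspace W \<and> direct_sum X V W)"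


section \<open>Operators on a closed subspace\<close>

text \<open>
  The notions below take as first argument a set \<open>X\<close>, the Banach space on which the operator
  acts: the whole type, a closed subspace of it, or the dual space.  Operators are represented by
  total functions, of which only the values on \<open>X\<close> matter; the restriction of an operator \<open>A\<close> to
  an invariant subspace \<open>M\<close> is thus represented by \<open>A\<close> itself, considered on \<open>M\<close>.
\<close>

definition bounded_ops :: "'a::complex_normed_vector set \<Rightarrow> ('a \<Rightarrow> 'a) set"
  where "bounded_ops X = {T. T ` X \<subseteq> X
    \<and> (\<forall>x\<in>X. \<forall>y\<in>X. T (x + y) = T x + T y)
    \<and> (\<forall>c. \<forall>x\<in>X. T (c *\<^sub>C x) = c *\<^sub>C T x)
    \<and> (\<exists>K. \<forall>x\<in>X. norm (T x) \<le> norm x * K)}"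

lemma bounded_ops_UNIV_iff:
  "T \<in> bounded_ops UNIV \<longleftrightarrow> bounded_linear T \<and> (\<forall>c x. T (c *\<^sub>C x) = c *\<^sub>C T x)"
proof
  assume T: "T \<in> bounded_ops UNIV"
  then obtain K where "\<And>x. norm (T x) \<le> norm x * K"
    by (auto simp: bounded_ops_def)
  with T show "bounded_linear T \<and> (\<forall>c x. T (c *\<^sub>C x) = c *\<^sub>C T x)"
    by (auto simp: bounded_ops_def scaleR_scaleC intro!: bounded_linear_intro)
next
  assume "bounded_linear T \<and> (\<forall>c x. T (c *\<^sub>C x) = c *\<^sub>C T x)"
  then show "T \<in> bounded_ops UNIV"
    by (auto simp: bounded_ops_def linear_simps dest: bounded_linear.bounded)
qed

definition null_space :: "'a::complex_normed_vector set \<Rightarrow> ('a \<Rightarrow> 'a) \<Rightarrow> 'a set"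
  where "null_space X T = {x \<in> X. T x = 0}"

text \<open>The operator \<open>T - \<lambda>I\<close>.\<close>

definition shift :: "('a::complex_normed_vector \<Rightarrow> 'a) \<Rightarrow> complex \<Rightarrow> 'a \<Rightarrow> 'a"
  where "shift T z = (\<lambda>x. T x - z *\<^sub>C x)"

definition right_invertible :: "'a::complex_normed_vector set \<Rightarrow> ('a \<Rightarrow> 'a) \<Rightarrow> bool"
  where "right_invertible X T \<longleftrightarrow> (\<exists>S\<in>bounded_ops X. \<forall>x\<in>X. T (S x) = x)"

definition descent :: "'a::complex_normed_vector set \<Rightarrow> ('a \<Rightarrow> 'a) \<Rightarrow> enat"
  where "descent X T = (INF n\<in>{n. T ` X + null_space X (T ^^ n) = X}. enat n)"

definition right_Browder :: "'a::complex_normed_vector set \<Rightarrow> ('a \<Rightarrow> 'a) \<Rightarrow> bool"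
  where "right_Browder X T \<longleftrightarrow>
    codim X (T ` X) < \<infinity> \<and> descent X T < \<infinity> \<and> complemented X (null_space X T)"

definition Riesz :: "'a::complex_normed_vector set \<Rightarrow> ('a \<Rightarrow> 'a) \<Rightarrow> bool"
  where "Riesz X T \<longleftrightarrow>
    (\<forall>z. z \<noteq> 0 \<longrightarrow> cdim (null_space X (shift T z)) < \<infinity> \<and> codim X (shift T z ` X) < \<infinity>)"

definition Kato :: "'a::complex_normed_vector set \<Rightarrow> ('a \<Rightarrow> 'a) \<Rightarrow> bool"
  where "Kato X T \<longleftrightarrow> closed (T ` X) \<and> (\<forall>n. null_space X T \<subseteq> (T ^^ n) ` X)"

definition Saphar :: "'a::complex_normed_vector set \<Rightarrow> ('a \<Rightarrow> 'a) \<Rightarrow> bool"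
  where "Saphar X T \<longleftrightarrow>
    Kato X T \<and> complemented X (null_space X T) \<and> complemented X (T ` X)"

definition Red :: "'a::complex_normed_vector set \<Rightarrow> ('a \<Rightarrow> 'a) \<Rightarrow> ('a set \<times> 'a set) set"
  where "Red X T = {(M, N). closed_csubspace M \<and> closed_csubspace N
    \<and> T ` M \<subseteq> M \<and> T ` N \<subseteq> N \<and> direct_sum X M N}"

definition admits_GSRD :: "'a::complex_normed_vector set \<Rightarrow> ('a \<Rightarrow> 'a) \<Rightarrow> bool"
  where "admits_GSRD X T \<longleftrightarrow> (\<exists>(M, N)\<in>Red X T. Saphar M T \<and> Riesz N T)"

definition projector :: "('a::complex_normed_vector \<Rightarrow> 'a) \<Rightarrow> bool"
  where "projector P \<longleftrightarrow> P \<in> bounded_ops UNIV \<and> P \<circ> P = P"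

definition right_Riesz_quasipolar :: "('a::complex_normed_vector \<Rightarrow> 'a) \<Rightarrow> bool"
  where "right_Riesz_quasipolar A \<longleftrightarrow>
    (\<exists>Q. projector Q \<and> A \<circ> Q = Q \<circ> A \<and> Riesz UNIV (A \<circ> (\<lambda>x. x - Q x))
      \<and> (\<exists>T\<in>bounded_ops UNIV. Q = A \<circ> T))"


section \<open>Spectra\<close>

definition right_spectrum :: "'a::complex_normed_vector set \<Rightarrow> ('a \<Rightarrow> 'a) \<Rightarrow> complex set"
  where "right_spectrum X T = {z. \<not> right_invertible X (shift T z)}"

definition right_Browder_spectrum :: "'a::complex_normed_vector set \<Rightarrow> ('a \<Rightarrow> 'a) \<Rightarrow> complex set"
  where "right_Browder_spectrum X T = {z. \<not> right_Browder X (shift T z)}"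

definition descent_spectrum :: "'a::complex_normed_vector set \<Rightarrow> ('a \<Rightarrow> 'a) \<Rightarrow> complex set"
  where "descent_spectrum X T = {z. descent X (shift T z) = \<infinity>}"

definition compression_spectrum :: "'a::complex_normed_vector set \<Rightarrow> ('a \<Rightarrow> 'a) \<Rightarrow> complex set"
  where "compression_spectrum X T = {z. \<not> X \<subseteq> closure (shift T z ` X)}"


section \<open>The single-valued extension property and the dual operator\<close>

definition vector_holomorphic_on ::
    "(complex \<Rightarrow> 'a::complex_normed_vector) \<Rightarrow> complex set \<Rightarrow> bool"
  where "vector_holomorphic_on f S \<longleftrightarrow>
    (\<forall>z\<in>S. \<exists>f'. (f has_derivative (\<lambda>h. h *\<^sub>C f')) (at z within S))"

definition SVEP :: "'a::complex_normed_vector set \<Rightarrow> ('a \<Rightarrow> 'a) \<Rightarrow> complex \<Rightarrow> bool"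
  where "SVEP Y T z0 \<longleftrightarrow>
    (\<forall>r>0. \<forall>f. f ` ball z0 r \<subseteq> Y \<and> vector_holomorphic_on f (ball z0 r)
        \<and> (\<forall>z\<in>ball z0 r. shift T z (f z) = 0)
      \<longrightarrow> (\<forall>z\<in>ball z0 r. f z = 0))"

text \<open>
  The type of bounded real-linear maps into the complex numbers is a complex Banach space, and the
  dual space is its closed subspace of complex-linear maps.
\<close>

definition dual_space :: "('a::complex_normed_vector \<Rightarrow>\<^sub>L complex) set"
  where "dual_space = {f. \<forall>c x. blinfun_apply f (c *\<^sub>C x) = c * blinfun_apply f x}"

definition dual_op ::
    "('a::complex_normed_vector \<Rightarrow> 'a) \<Rightarrow> ('a \<Rightarrow>\<^sub>L complex) \<Rightarrow> ('a \<Rightarrow>\<^sub>L complex)"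
  where "dual_op A f = Blinfun (blinfun_apply f \<circ> A)"

lemma dual_op_apply:
  assumes "A \<in> bounded_ops UNIV"
  shows "blinfun_apply (dual_op A f) x = blinfun_apply f (A x)"
proof -
  have "bounded_linear A" using assms by (simp add: bounded_ops_UNIV_iff)
  then have "bounded_linear (blinfun_apply f \<circ> A)"
    unfolding comp_def by (rule bounded_linear_compose[OF blinfun.bounded_linear_right])
  then show ?thesis by (simp add: dual_op_def bounded_linear_Blinfun_apply)
qed

lemma closed_csubspace_dual_space: "closed_csubspace dual_space"
proof -
  have "closed {f::'a \<Rightarrow>\<^sub>L complex. blinfun_apply f (c *\<^sub>C x) = c * blinfun_apply f x}" for c x
    by (intro closed_Collect_eq continuous_intros)
  then have "closed (dual_space :: ('a \<Rightarrow>\<^sub>L complex) set)"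
    unfolding dual_space_def by (intro closed_Collect_all)
  then show ?thesis
    by (auto simp: closed_csubspace_def complex_vector.subspace_def dual_space_def
        blinfun.add_left blinfun.zero_left scaleC_complex_def algebra_simps)
qed

lemma dual_op_bounded_ops:
  assumes A: "A \<in> bounded_ops UNIV"
  shows "dual_op A \<in> bounded_ops dual_space"
proof -
  have bl: "bounded_linear A" and hom: "\<And>c x. A (c *\<^sub>C x) = c *\<^sub>C A x"
    using A by (simp_all add: bounded_ops_UNIV_iff)
  obtain K where K: "K \<ge> 0" "\<And>x. norm (A x) \<le> norm x * K"
    using bounded_linear.nonneg_bounded[OF bl] by blast
  have "norm (dual_op A f) \<le> norm f * K" for f
  proof (rule norm_blinfun_bound)
    fix x
    have "norm (blinfun_apply f (A x)) \<le> norm f * norm (A x)" by (rule norm_blinfun)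
    also have "\<dots> \<le> norm f * (norm x * K)" by (intro mult_left_mono K) simp
    finally show "norm (blinfun_apply (dual_op A f) x) \<le> norm f * K * norm x"
      by (simp add: dual_op_apply[OF A] mult_ac)
  qed (use K in simp)
  then show ?thesis
    by (auto simp: bounded_ops_def dual_space_def dual_op_apply[OF A] hom
        blinfun.add_left intro!: blinfun_eqI)
qed


section \<open>Equivalence of a list of conditions\<close>

definition all_equivalent :: "bool list \<Rightarrow> bool"
  where "all_equivalent cs \<longleftrightarrow> (\<forall>p\<in>set cs. \<forall>q\<in>set cs. p \<longleftrightarrow> q)"

end

theory Submission
  imports Defs "HOL-Complex_Analysis.Conformal_Mappings"
begin

text \<open>
  All conditions are compared with one of them: \<open>X\<close> is the direct sum of closed invariant subspaces
  \<open>M\<close> and \<open>N\<close> such that \<open>A\<close> is right invertible on \<open>M\<close> and Riesz on \<open>N\<close>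
  (\<open>right_Riesz_decomposable\<close>).

  The conditions with auxiliary operators are translations of this.  A commuting projector is the same
  as an invariant decomposition; if \<open>S\<close> is a right inverse of \<open>A\<close> on \<open>M\<close> and \<open>Q\<close> projects onto \<open>M\<close> along
  \<open>N\<close>, then \<open>B = S Q\<close> is the required generalized inverse, and conversely \<open>Q = A B\<close>.  For the Browder
  conditions two facts are needed.  A right Browder operator \<open>C\<close> is the direct sum of a right invertible
  operator, on the range of a power \<open>C\<^sup>n\<close>, and of a nilpotent operator on a finite-dimensional space
  (\<open>right_Browder_decomposition\<close>); since operators on finite-dimensional spaces are Riesz, the second
  summand may be added to the Riesz part.  And if \<open>T\<close> is Riesz, then \<open>T - z I\<close> is right Browder for
  every \<open>z \<noteq> 0\<close> (\<open>Riesz_imp_right_Browder\<close>).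

  The spectral conditions start from a decomposition with a Saphar part on \<open>M\<close>, and the question is
  whether this part is onto.  If it is, then \<open>A - z I\<close> is right Browder for all small \<open>z \<noteq> 0\<close> and
  right invertible for some \<open>z \<noteq> 0\<close> arbitrarily close to \<open>0\<close>, which gives all these conditions; for the
  dual operator one adds the identity theorem for analytic functions.  If it is not, let \<open>S\<close> be a
  generalized inverse of the Saphar operator \<open>T\<close> on \<open>M\<close>, and put \<open>F = I - T S \<noteq> 0\<close> and
  \<open>R\<^sub>z = (I - z S)\<^sup>-\<^sup>1\<close>.  Then \<open>F R\<^sub>z (T - z I) = 0\<close> and the null spaces of all powers of \<open>T - z I\<close> lie in
  its range (\<open>Saphar_resolvent\<close>).  Hence for all small \<open>z\<close> the range of \<open>T - z I\<close> is not dense and its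
  descent is infinite, and composing \<open>F R\<^sub>z\<close> with a functional gives a nonzero analytic family of
  eigenvectors of the dual operator (\<open>not_dual_SVEP\<close>).

  The same lemma drives the theory of Riesz operators.  If \<open>T\<close> has a finite-dimensional null space and a
  range of finite codimension, then it is Saphar on the range of a high power.  If, moreover, shifts
  \<open>T - z I\<close> with arbitrarily small \<open>z\<close> are onto, then \<open>T\<close> must be onto on that range, so its descent is
  finite.  Thus for a Riesz operator the set of all \<open>z \<noteq> 0\<close> for which \<open>T - z I\<close> is right Browder is
  closed in the punctured plane; it is also open and nonempty, and the punctured plane is connected.

  From functional analysis this uses the open mapping theorem, for bounded projections, generalized
  inverses and the closedness of ranges of finite codimension, and the Hahn--Banach theorem, for
  complements of finite-dimensional subspaces and for the functional in the argument on the dual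
  operator.
\<close>

section \<open>Closed complex subspaces\<close>

abbreviation csubspace :: "'a::complex_normed_vector set \<Rightarrow> bool"
  where "csubspace \<equiv> complex_vector.subspace"

abbreviation cspan :: "'a::complex_normed_vector set \<Rightarrow> 'a set"
  where "cspan \<equiv> complex_vector.span"

lemma csubspace_imp_subspace: "csubspace V \<Longrightarrow> subspace V"
  by (auto simp: subspace_def complex_vector.subspace_def scaleR_scaleC)

lemma closed_csubspace_UNIV [simp]: "closed_csubspace UNIV"
  by (simp add: closed_csubspace_def)

lemma closed_csubspaceD: "closed_csubspace V \<Longrightarrow> csubspace V" "closed_csubspace V \<Longrightarrow> closed V"
  by (simp_all add: closed_csubspace_def)

lemma continuous_scaleC_left:
  fixes x :: "'a::complex_normed_vector"
  shows "continuous_on S (\<lambda>c. c *\<^sub>C x)"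
proof -
  have "bounded_linear (\<lambda>c. c *\<^sub>C x)"
    by (rule bounded_linear_intro[where K = "norm x"])
      (simp_all add: scaleC_add_left scaleR_scaleC norm_scaleC scaleR_conv_of_real scaleC_complex_def)
  then show ?thesis by (rule linear_continuous_on)
qed

text \<open>
  If \<open>d\<close> is the distance from \<open>x\<close> to \<open>V\<close>, then \<open>|k| d \<le> \<parallel>v + k x\<parallel>\<close> for \<open>v\<close> in \<open>V\<close>. Hence the
  coefficients of \<open>x\<close> along a convergent sequence form a Cauchy sequence in the complex plane.
\<close>

lemma closed_span_insert:
  assumes V: "closed_csubspace V"
  shows "closed_csubspace (cspan (insert x V))"
proof (cases "x \<in> V")
  case True
  then show ?thesis using V
    by (simp add: insert_absorb closed_csubspace_def complex_vector.span_eq_iff[THEN iffD2])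
next
  case False
  have sV: "csubspace V" and cV: "closed V" using V by (auto simp: closed_csubspace_def)
  have spV: "cspan V = V" using sV by simp
  obtain d where d: "d > 0" "ball x d \<inter> V = {}"
    using False cV by (meson closed_def ComplI disjoint_eq_subset_Compl openE)
  have key: "cmod k * d \<le> norm (v + k *\<^sub>C x)" if "v \<in> V" for v k
  proof (cases "k = 0")
    case False
    have "(- inverse k) *\<^sub>C v \<in> V" using sV that by (rule complex_vector.subspace_scale)
    then have "d \<le> dist x ((- inverse k) *\<^sub>C v)" using d by (meson disjoint_iff mem_ball not_le)
    also have "\<dots> = norm (inverse k *\<^sub>C (v + k *\<^sub>C x))"
      using False by (simp add: dist_norm
          algebra_simps)
    also have "\<dots> = norm (v + k *\<^sub>C x) / cmod k"
      by (simp add: norm_scaleC norm_inverse divide_inverse mult.commute)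
    finally show ?thesis using False by (simp add: pos_le_divide_eq mult.commute)
  qed simp
  have "closed (cspan (insert x V))"
    unfolding closed_sequential_limits
  proof (intro allI impI, elim conjE)
    fix y l assume "\<forall>n. y n \<in> cspan (insert x V)" and lim: "y \<longlonglongrightarrow> l"
    then have "\<forall>n. \<exists>k. y n - k *\<^sub>C x \<in> V"
      by (simp add: complex_vector.span_breakdown_eq spV)
    then obtain k where k: "\<And>n. y n - k n *\<^sub>C x \<in> V" by metis
    have "Cauchy k"
    proof (rule metric_CauchyI)
      fix e :: real assume "e > 0"
      have "Cauchy y" using lim by (rule LIMSEQ_imp_Cauchy)
      then obtain M where M: "\<And>m n. m \<ge> M \<Longrightarrow> n \<ge> M \<Longrightarrow> dist (y m) (y n) < e * d"
        using \<open>e > 0\<close> d by (meson metric_CauchyD mult_pos_pos)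
      have "dist (k m) (k n) < e" if "m \<ge> M" "n \<ge> M" for m n
      proof -
        have "cmod (k m - k n) * d \<le> norm ((y m - k m *\<^sub>C x) - (y n - k n *\<^sub>C x) + (k m - k n) *\<^sub>C x)"
          by (intro key complex_vector.subspace_diff[OF sV] k)
        also have "\<dots> = dist (y m) (y n)"
          by (simp add: dist_norm complex_vector.scale_left_diff_distrib algebra_simps)
        also have "\<dots> < e * d" using M that by blast
        finally show ?thesis using d by (simp add: dist_norm)
      qed
      then show "\<exists>M. \<forall>m\<ge>M. \<forall>n\<ge>M. dist (k m) (k n) < e" by blast
    qed
    then obtain c where c: "k \<longlonglongrightarrow> c" by (auto simp: Cauchy_convergent_iff convergent_def)
    have "(\<lambda>n. k n *\<^sub>C x) \<longlonglongrightarrow> c *\<^sub>C x"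
      using continuous_on_tendsto_compose[OF continuous_scaleC_left[of UNIV x] c] by simp
    with lim have "(\<lambda>n. y n - k n *\<^sub>C x) \<longlonglongrightarrow> l - c *\<^sub>C x" by (rule tendsto_diff)
    then have "l - c *\<^sub>C x \<in> V" by (rule closed_sequentially[OF cV k, rotated])
    then show "l \<in> cspan (insert x V)"
      by (auto simp: complex_vector.span_breakdown_eq spV)
  qed
  then show ?thesis by (simp add: closed_csubspace_def)
qed

text \<open>
  With \<open>V = {0}\<close> this says that finite-dimensional subspaces are closed.
\<close>

lemma closed_span_Un_finite:
  assumes "closed_csubspace V" "finite F"
  shows "closed_csubspace (cspan (V \<union> F))"
  using assms(2)
proof (induction F)
  case empty
  then show ?case using assms(1) by (simp add: closed_csubspace_def complex_vector.span_eq_iff[THEN iffD2])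
next
  case (insert x F)
  have "cspan (V \<union> insert x F) = cspan (insert x (cspan (V \<union> F)))"
    by (simp add: complex_vector.span_insert complex_vector.span_span)
  then show ?case using closed_span_insert[OF insert.IH] by simp
qed

lemma span_Un_eq_sum: "csubspace V \<Longrightarrow> cspan (V \<union> F) = V + cspan F"
  by (auto simp: complex_vector.span_Un set_plus_def complex_vector.span_eq_iff[THEN iffD2])

lemma closed_span_finite: "finite F \<Longrightarrow> closed_csubspace (cspan F)"
  using closed_span_Un_finite[of "{0}" F] by (simp add: closed_csubspace_def)


section \<open>Continuous linear functionals\<close>

text \<open>
  The Hahn--Banach theorem is reached through minimal sublinear functionals: these turn out to be
  linear, so that no partially defined functionals have to be extended.
\<close>

definition sublinear :: "('a::real_vector \<Rightarrow> real) \<Rightarrow> bool"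
  where "sublinear p \<longleftrightarrow> (\<forall>x y. p (x + y) \<le> p x + p y) \<and> (\<forall>t\<ge>0. \<forall>x. p (t *\<^sub>R x) = t * p x)"

lemma sublinear_zero: "sublinear p \<Longrightarrow> p 0 = 0"
  unfolding sublinear_def by (metis mult_zero_left order_refl scaleR_zero_left)

lemma sublinear_lower: "sublinear p \<Longrightarrow> - p (- x) \<le> p x"
  using sublinear_zero[of p] unfolding sublinear_def by (metis add.right_inverse add_uminus_conv_diff diff_le_eq add_0)

lemma sublinear_norm: "sublinear norm"
  by (simp add: sublinear_def norm_triangle_ineq)

text \<open>
  One inequality suffices, because it can be applied to \<open>1 / t\<close> as well.
\<close>

lemma homogeneousI:
  assumes "p (0::'a::real_vector) = (0::real)" and "\<And>t x. t > 0 \<Longrightarrow> p (t *\<^sub>R x) \<le> t * p x"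
  shows "\<forall>t\<ge>0. \<forall>x. p (t *\<^sub>R x) = t * p x"
proof (intro allI impI)
  fix t :: real and x assume "t \<ge> 0"
  show "p (t *\<^sub>R x) = t * p x"
  proof (cases "t = 0")
    case False
    then have "t > 0" using \<open>t \<ge> 0\<close> by simp
    then have "p (inverse t *\<^sub>R (t *\<^sub>R x)) \<le> inverse t * p (t *\<^sub>R x)" by (intro assms) simp
    then have "t * p x \<le> p (t *\<^sub>R x)" using \<open>t > 0\<close> by (simp add: field_simps)
    then show ?thesis using assms(2)[OF \<open>t > 0\<close>, of x] by simp
  qed (use assms in simp)
qed

text \<open>
  The functional \<open>q x = inf\<^sub>t (p (x + t y) - t p y)\<close> is sublinear and satisfies \<open>q (- y) \<le> - p y\<close>.
  It serves twice: it shows that a minimal sublinear functional is additive, and, for the norm and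
  \<open>y = w\<close>, it gives the starting point that forces the value at \<open>w\<close> to be positive.
\<close>

lemma sublinear_along:
  assumes p: "sublinear p"
  obtains q where "sublinear q" "\<And>x. q x \<le> p x" "\<And>x t. t \<ge> 0 \<Longrightarrow> q x \<le> p (x + t *\<^sub>R y) - t * p y"
proof -
  have sub: "p (u + v) \<le> p u + p v" and hom: "t \<ge> 0 \<Longrightarrow> p (t *\<^sub>R u) = t * p u" for u v t
    using p by (auto simp: sublinear_def)
  define q where "q x = (INF t\<in>{0..}. p (x + t *\<^sub>R y) - t * p y)" for x
  have lower: "- p (- x) \<le> p (x + t *\<^sub>R y) - t * p y" if "t \<ge> 0" for x t
    using sub[of "x + t *\<^sub>R y" "- x"] hom[OF that, of y] by simp
  have bdd: "bdd_below ((\<lambda>t. p (x + t *\<^sub>R y) - t * p y) ` {0..})" for x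
    by (rule bdd_belowI2[where m = "- p (- x)"]) (use lower in auto)
  have qle: "q x \<le> p (x + t *\<^sub>R y) - t * p y" if "t \<ge> 0" for x t
    unfolding q_def by (rule cINF_lower[OF bdd]) (use that in auto)
  have qge: "z \<le> q x" if "\<And>t. t \<ge> 0 \<Longrightarrow> z \<le> p (x + t *\<^sub>R y) - t * p y" for z x
    unfolding q_def by (rule cINF_greatest) (use that in auto)
  have qp: "q x \<le> p x" for x using qle[of 0 x] by simp
  have qsub: "q (x1 + x2) \<le> q x1 + q x2" for x1 x2
  proof -
    have "q (x1 + x2) \<le> (p (x1 + s *\<^sub>R y) - s * p y) + (p (x2 + t *\<^sub>R y) - t * p y)"
      if "s \<ge> 0" "t \<ge> 0" for s t
      using qle[of "s + t" "x1 + x2"] sub[of "x1 + s *\<^sub>R y" "x2 + t *\<^sub>R y"] that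
      by (simp add: algebra_simps)
    then have "q (x1 + x2) - (p (x2 + t *\<^sub>R y) - t * p y) \<le> q x1" if "t \<ge> 0" for t
      using that by (intro qge) (simp add: algebra_simps)
    then have "q (x1 + x2) - q x1 \<le> q x2" by (intro qge) (simp add: algebra_simps)
    then show ?thesis by simp
  qed
  have "q 0 = 0"
    using qp[of 0] qge[of 0 0] sublinear_zero[OF p] lower[of _ 0] by force
  moreover have "q (t *\<^sub>R x) \<le> t * q x" if t: "t > 0" for t x
  proof -
    have "q (t *\<^sub>R x) / t \<le> q x"
    proof (rule qge)
      fix s :: real assume s: "s \<ge> 0"
      have "q (t *\<^sub>R x) \<le> p (t *\<^sub>R x + (t * s) *\<^sub>R y) - (t * s) * p y" using t s by (intro qle) simp
      also have "p (t *\<^sub>R x + (t * s) *\<^sub>R y) = t * p (x + s *\<^sub>R y)"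
        using hom[of t "x + s *\<^sub>R y"] t by (simp add: scaleR_add_right)
      finally show "q (t *\<^sub>R x) / t \<le> p (x + s *\<^sub>R y) - s * p y" using t by (simp add: field_simps)
    qed
    then show ?thesis using t by (simp add: field_simps)
  qed
  ultimately have "\<forall>t\<ge>0. \<forall>x. q (t *\<^sub>R x) = t * q x" by (intro homogeneousI)
  then have "sublinear q" using qsub by (simp add: sublinear_def)
  then show ?thesis using that qp qle by blast
qed

text \<open>
  Zorn's lemma gives a minimal sublinear functional \<open>p\<close> below \<open>q\<close>.  By minimality \<open>p\<close> equals its
  modification along any \<open>y\<close>, and comparing at \<open>t = 1\<close> gives \<open>p x + p y \<le> p (x + y)\<close>.
\<close>

lemma linear_below_sublinear:
  fixes q :: "'a::real_vector \<Rightarrow> real"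
  assumes q: "sublinear q"
  obtains p where "linear p" "\<And>x. p x \<le> q x"
proof -
  define A where "A = {p. sublinear p \<and> (\<forall>x. p x \<le> q x)}"
  define below :: "('a \<Rightarrow> real) \<Rightarrow> ('a \<Rightarrow> real) \<Rightarrow> bool" where "below a b = (\<forall>x. b x \<le> a x)" for a b
  have po: "partial_order_on A (relation_of below A)"
    by (rule partial_order_on_relation_ofI) (auto simp: below_def fun_eq_iff intro: order_trans order_antisym)
  have ub: "\<exists>u\<in>A. \<forall>a\<in>C. below a u" if C: "C \<in> Chains (relation_of below A)" for C
  proof (cases "C = {}")
    case True
    then show ?thesis using q by (auto simp: A_def)
  next
    case False
    have CA: "C \<subseteq> A" and tot: "a \<in> C \<Longrightarrow> b \<in> C \<Longrightarrow> below a b \<or> below b a" for a b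
      using C by (auto simp: Chains_def relation_of_def)
    define u where "u x = (INF p\<in>C. p x)" for x
    have bdd: "bdd_below ((\<lambda>p. p x) ` C)" for x
    proof (rule bdd_belowI2[where m = "- q (- x)"])
      fix p assume "p \<in> C"
      then have "sublinear p" "p (- x) \<le> q (- x)" using CA by (auto simp: A_def)
      then show "- q (- x) \<le> p x" using sublinear_lower[of p x] by linarith
    qed
    have ule: "u x \<le> p x" if "p \<in> C" for p x unfolding u_def by (rule cINF_lower[OF bdd that])
    have uge: "z \<le> u x" if "\<And>p. p \<in> C \<Longrightarrow> z \<le> p x" for z x
      unfolding u_def by (rule cINF_greatest[OF False]) (use that in auto)
    have usub: "u (x + y) \<le> u x + u y" for x y
    proof -
      have "u (x + y) \<le> p1 x + p2 y" if p: "p1 \<in> C" "p2 \<in> C" for p1 p2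
      proof -
        obtain p where p': "p \<in> C" "p x \<le> p1 x" "p y \<le> p2 y"
          using tot[OF p] p unfolding below_def by blast
        then have "p (x + y) \<le> p x + p y" using CA by (auto simp: A_def sublinear_def)
        then show ?thesis using ule[OF p'(1), of "x + y"] p' by linarith
      qed
      then have "u (x + y) - p2 y \<le> u x" if "p2 \<in> C" for p2
        using that by (intro uge) (simp add: algebra_simps)
      then have "u (x + y) - u x \<le> u y" by (intro uge) (simp add: algebra_simps)
      then show ?thesis by simp
    qed
    have "u 0 = 0"
    proof -
      have "p 0 = 0" if "p \<in> C" for p using that CA sublinear_zero by (auto simp: A_def)
      then show ?thesis using uge[of 0 0] ule[of _ 0] False by fastforce
    qed
    moreover have "u (t *\<^sub>R x) \<le> t * u x" if t: "t > 0" for t x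
    proof -
      have "u (t *\<^sub>R x) / t \<le> u x"
      proof (rule uge)
        fix p assume p: "p \<in> C"
        then have "p (t *\<^sub>R x) = t * p x" using CA t by (auto simp: A_def sublinear_def)
        then show "u (t *\<^sub>R x) / t \<le> p x" using ule[OF p, of "t *\<^sub>R x"] t by (simp add: field_simps)
      qed
      then show ?thesis using t by (simp add: field_simps)
    qed
    ultimately have "\<forall>t\<ge>0. \<forall>x. u (t *\<^sub>R x) = t * u x" by (intro homogeneousI)
    then have "sublinear u" using usub by (simp add: sublinear_def)
    moreover have "u x \<le> q x" for x
      using False CA ule by (metis (no_types, lifting) A_def ex_in_conv mem_Collect_eq order_trans subsetD)
    ultimately show ?thesis using ule by (auto simp: A_def below_def)
  qed
  obtain p where p: "p \<in> A" and min: "\<And>a. a \<in> A \<Longrightarrow> below p a \<Longrightarrow> a = p"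
    using predicate_Zorn[OF po ub] by blast
  have sp: "sublinear p" and pq: "\<And>x. p x \<le> q x" using p by (auto simp: A_def)
  have add: "p (x + y) = p x + p y" for x y
  proof (rule antisym)
    show "p (x + y) \<le> p x + p y" using sp by (simp add: sublinear_def)
    obtain r where r: "sublinear r" "\<And>x. r x \<le> p x"
      "\<And>x t. t \<ge> 0 \<Longrightarrow> r x \<le> p (x + t *\<^sub>R y) - t * p y"
      using sublinear_along[OF sp, of y] by blast
    \<comment> \<open>Minimality of \<open>p\<close> turns the modification \<open>r\<close> along \<open>y\<close> into \<open>p\<close> itself.\<close>
    have "r x \<le> q x" for x using r(2)[of x] pq[of x] by linarith
    then have "r = p" using r by (intro min) (auto simp: A_def below_def)
    then show "p x + p y \<le> p (x + y)" using r(3)[of 1 x] by simp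
  qed
  have neg: "p (- x) = - p x" for x
    using add[of x "- x"] sublinear_zero[OF sp] by simp
  have "p (t *\<^sub>R x) = t * p x" for t x
  proof (cases "t \<ge> 0")
    case False
    then have "p ((- t) *\<^sub>R x) = (- t) * p x" using sp unfolding sublinear_def by (metis linear neg_0_le_iff_le)
    then show ?thesis using neg[of "t *\<^sub>R x"] by simp
  qed (use sp in \<open>simp add: sublinear_def\<close>)
  then have "linear p" using add by (intro linearI) auto
  then show ?thesis using that pq by blast
qed

text \<open>
  A real-linear functional \<open>p\<close> bounded by the norm and positive at \<open>w\<close> becomes complex-linear as
  \<open>p x - \<i> p (\<i> x)\<close>, with real part \<open>p\<close>.
\<close>

lemma separating_functional:
  fixes w :: "'a::complex_normed_vector"
  assumes "w \<noteq> 0"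
  obtains \<phi> :: "'a \<Rightarrow> complex"
  where "bounded_linear \<phi>" "\<And>c x. \<phi> (c *\<^sub>C x) = c * \<phi> x" "\<phi> w \<noteq> 0"
proof -
  obtain q where q: "sublinear q" "\<And>x::'a. q x \<le> norm x"
    "\<And>x t. t \<ge> 0 \<Longrightarrow> q x \<le> norm (x + t *\<^sub>R w) - t * norm w"
    using sublinear_along[OF sublinear_norm, of w] by blast
  obtain p where p: "linear p" "\<And>x. p x \<le> q x" using linear_below_sublinear[OF q(1)] by blast
  have "p (- w) \<le> - norm w" using p(2)[of "- w"] q(3)[of 1 "- w"] by simp
  then have pw: "p w > 0" using linear_neg[OF p(1), of w] assms by simp (smt (verit) norm_le_zero_iff)
  have pn: "\<bar>p x\<bar> \<le> norm x" for x
    using p(2)[of x] q(2)[of x] p(2)[of "- x"] q(2)[of "- x"] linear_neg[OF p(1), of x] by simp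
  define \<phi> where "\<phi> x = Complex (p x) (- p (\<i> *\<^sub>C x))" for x
  have add: "\<phi> (x + y) = \<phi> x + \<phi> y" for x y
    by (simp add: \<phi>_def complex_eq_iff scaleC_add_right linear_add[OF p(1)])
  have scale: "\<phi> (c *\<^sub>C x) = c * \<phi> x" for c x
  proof -
    have lin: "p (c *\<^sub>C x) = Re c * p x + Im c * p (\<i> *\<^sub>C x)" for c x
    proof -
      have "c *\<^sub>C x = Re c *\<^sub>R x + Im c *\<^sub>R (\<i> *\<^sub>C x)"
        by (metis complex_eq mult.commute scaleC_add_left scaleC_scaleC scaleR_scaleC)
      then show ?thesis by (simp add: linear_add[OF p(1)] linear_scale[OF p(1)])
    qed
    show ?thesis
      by (simp add: \<phi>_def complex_eq_iff scaleC_scaleC lin[of c] lin[of "\<i> * c"])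
  qed
  have "bounded_linear \<phi>"
  proof (rule bounded_linear_intro[where K = 2])
    show "\<phi> (r *\<^sub>R x) = r *\<^sub>R \<phi> x" for r x
      using scale[of "complex_of_real r" x] by (simp add: scaleR_scaleC scaleC_complex_def)
    fix x
    have "cmod (\<phi> x) \<le> \<bar>p x\<bar> + \<bar>p (\<i> *\<^sub>C x)\<bar>" using cmod_le[of "\<phi> x"] by (simp add: \<phi>_def)
    then show "norm (\<phi> x) \<le> norm x * 2" using pn[of x] pn[of "\<i> *\<^sub>C x"] by (simp add: norm_scaleC)
  qed (rule add)
  moreover have "\<phi> w \<noteq> 0" using pw by (auto simp: \<phi>_def complex_eq_iff)
  ultimately show ?thesis using that scale by blast
qed

section \<open>The open mapping theorem\<close>

text \<open>
  By Baire's theorem the closure of the image of some ball contains a ball of \<open>V\<close>, so that every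
  \<open>y\<close> in \<open>V\<close> can be approximated arbitrarily well by images of vectors of norm at most \<open>C0 \<parallel>y\<parallel>\<close>.
  Correcting the error again and again, halving it each time, gives an exact preimage as the sum
  of a geometrically convergent series.
\<close>

lemma open_mapping_on_closed_subspaces:
  fixes T :: "'a::banach \<Rightarrow> 'b::banach"
  assumes "closed U" "subspace U" "closed V" "subspace V"
    and add: "\<And>x y. x \<in> U \<Longrightarrow> y \<in> U \<Longrightarrow> T (x + y) = T x + T y"
    and scale: "\<And>r x. x \<in> U \<Longrightarrow> T (r *\<^sub>R x) = r *\<^sub>R T x"
    and bound: "\<And>x. x \<in> U \<Longrightarrow> norm (T x) \<le> norm x * K"
    and surj: "T ` U = V"
  obtains C where "C > 0" "\<And>y. y \<in> V \<Longrightarrow> \<exists>x\<in>U. T x = y \<and> norm x \<le> C * norm y"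
proof -
  have diff: "T (x - y) = T x - T y" if "x \<in> U" "y \<in> U" for x y
    using add[of x "(-1) *\<^sub>R y"] scale[of y "-1"] that subspace_scale[OF \<open>subspace U\<close> that(2), of "-1"]
    by simp
  have T0: "T 0 = 0" using scale[of 0 0] subspace_0[OF \<open>subspace U\<close>] by simp
  \<comment> \<open>The closed sets to which Baire's theorem is applied in \<open>V\<close>.\<close>
  define E where "E n = closure (T ` (U \<inter> cball 0 (real n)))" for n
  have EV: "E n \<subseteq> V" for n
    unfolding E_def using surj \<open>closed V\<close> by (intro closure_minimal) auto
  have UnE: "(\<Union>n. E n) = V"
  proof
    show "(\<Union>n. E n) \<subseteq> V" using EV by blast
    show "V \<subseteq> (\<Union>n. E n)"
    proof
      fix y assume "y \<in> V"
      then obtain x where x: "x \<in> U" "T x = y" using surj by blast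
      obtain n where "norm x \<le> real n" using real_arch_simple by blast
      then have "y \<in> E n" unfolding E_def using x by (intro subsetD[OF closure_subset]) auto
      then show "y \<in> (\<Union>n. E n)" by blast
    qed
  qed
  have "\<exists>n. top_of_set V interior_of E n \<noteq> {}"
  proof (rule ccontr)
    assume "\<nexists>n. top_of_set V interior_of E n \<noteq> {}"
    moreover have "closedin (top_of_set V) (E n)" for n
      using EV[of n] by (auto simp: E_def intro: closed_subset)
    ultimately have "top_of_set V interior_of (\<Union>(range E)) = {}"
      using \<open>closed V\<close> by (intro Baire_category_alt)
        (auto intro!: completely_metrizable_space_closedin completely_metrizable_space_euclidean)
    moreover have "top_of_set V interior_of (\<Union>(range E)) = V"
      using UnE interior_of_topspace[of "top_of_set V"] by simp
    ultimately show False using subspace_0[OF \<open>subspace V\<close>] by auto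
  qed
  then obtain n y0 where "y0 \<in> top_of_set V interior_of E n" by blast
  then obtain W where W: "openin (top_of_set V) W" "y0 \<in> W" "W \<subseteq> E n"
    by (auto simp: interior_of_def)
  then obtain r where r: "r > 0" "ball y0 r \<inter> V \<subseteq> W"
    by (meson openin_contains_ball)
  have y0V: "y0 \<in> V" using W EV by blast
  \<comment> \<open>A difference of two vectors of norm at most \<open>n\<close> is rescaled by \<open>2 \<parallel>y\<parallel> / r\<close>.\<close>
  define C0 where "C0 = 4 * real n / r"
  have C0: "C0 \<ge> 0" using r by (simp add: C0_def)
  have approxE: "\<exists>x\<in>U. norm x \<le> real n \<and> dist (T x) z < e" if "z \<in> E n" "e > 0" for z e
    using that unfolding E_def closure_approachable by force
  have approx1: "\<exists>x\<in>U. norm x \<le> 2 * real n \<and> dist (T x) y < e"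
    if "y \<in> V" "norm y < r" "e > 0" for y e
  proof -
    have "y0 + y \<in> ball y0 r \<inter> V"
      using that subspace_add[OF \<open>subspace V\<close> y0V that(1)] by (simp add: dist_norm)
    then have "y0 + y \<in> E n" "y0 \<in> E n"
      using r W by blast+
    then obtain x1 x2 where x: "x1 \<in> U" "norm x1 \<le> real n" "dist (T x1) (y0 + y) < e / 2"
      "x2 \<in> U" "norm x2 \<le> real n" "dist (T x2) y0 < e / 2"
      using approxE[of _ "e/2"] \<open>e > 0\<close> by (metis half_gt_zero)
    have "dist (T (x1 - x2)) y = norm ((T x1 - (y0 + y)) - (T x2 - y0))"
      unfolding dist_norm diff[OF x(1,4)] by (simp add: algebra_simps)
    also have "\<dots> < e" using x(3,6) norm_triangle_ineq4[of "T x1 - (y0 + y)" "T x2 - y0"]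
      by (simp add: dist_norm)
    finally have "dist (T (x1 - x2)) y < e" .
    moreover have "norm (x1 - x2) \<le> 2 * real n" using x norm_triangle_ineq4[of x1 x2] by simp
    ultimately show ?thesis using x subspace_diff[OF \<open>subspace U\<close>] by blast
  qed
  have approx: "\<exists>x\<in>U. norm x \<le> C0 * norm y \<and> norm (y - T x) < e" if y: "y \<in> V" and e: "e > 0" for y e
  proof (cases "y = 0")
    case True
    then show ?thesis using subspace_0[OF \<open>subspace U\<close>] T0 e by (intro bexI[of _ 0]) auto
  next
    case False
    define s where "s = r / (2 * norm y)"
    have s: "s > 0" using False r by (simp add: s_def)
    have "s *\<^sub>R y \<in> V" "norm (s *\<^sub>R y) < r"
      using y subspace_scale[OF \<open>subspace V\<close>] False r by (auto simp: s_def)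
    then obtain x where x: "x \<in> U" "norm x \<le> 2 * real n" "dist (T x) (s *\<^sub>R y) < s * e"
      using approx1[of "s *\<^sub>R y" "s * e"] s e by auto
    have "norm (x /\<^sub>R s) \<le> C0 * norm y"
    proof -
      have "norm (x /\<^sub>R s) = norm x / s" using s by (simp add: divide_inverse mult.commute)
      also have "\<dots> \<le> (2 * real n) / s" using s x by (simp add: divide_right_mono)
      also have "\<dots> = C0 * norm y" using False r by (simp add: C0_def s_def field_simps)
      finally show ?thesis .
    qed
    moreover have "norm (y - T (x /\<^sub>R s)) < e"
    proof -
      have "y - T (x /\<^sub>R s) = (s *\<^sub>R y - T x) /\<^sub>R s"
        using s x scale by (simp add: scaleR_diff_right)
      then have "norm (y - T (x /\<^sub>R s)) = dist (T x) (s *\<^sub>R y) / s"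
        using s by (simp add: dist_norm norm_minus_commute divide_inverse mult.commute)
      also have "\<dots> < (s * e) / s" using s x by (intro divide_strict_right_mono)
      finally show ?thesis using s by simp
    qed
    ultimately show ?thesis using x subspace_scale[OF \<open>subspace U\<close>] by blast
  qed
  then obtain g where g: "\<And>y e. y \<in> V \<Longrightarrow> e > 0 \<Longrightarrow>
      g y e \<in> U \<and> norm (g y e) \<le> C0 * norm y \<and> norm (y - T (g y e)) < e"
    by metis
  have "\<exists>x\<in>U. T x = y \<and> norm x \<le> (2 * C0 + 1) * norm y" if y: "y \<in> V" for y
  proof (cases "y = 0")
    case True
    then show ?thesis using subspace_0[OF \<open>subspace U\<close>] T0 by (intro bexI[of _ 0]) auto
  next
    case False
    \<comment> \<open>\<open>ys k\<close> is the error that remains after \<open>k\<close> corrections.\<close>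
    define ys where "ys = rec_nat y (\<lambda>k z. z - T (g z (norm y * (1/2)^Suc k)))"
    have ys0: "ys 0 = y" and ysS: "ys (Suc k) = ys k - T (g (ys k) (norm y * (1/2)^Suc k))" for k
      by (simp_all add: ys_def)
    define xs where "xs k = g (ys k) (norm y * (1/2)^Suc k)" for k
    have pos: "norm y * (1/2)^Suc k > 0" for k using False by simp
    have ysV: "ys k \<in> V" for k
    proof (induction k)
      case (Suc k)
      then have "T (xs k) \<in> V" using g[OF Suc pos[of k]] surj unfolding xs_def by blast
      with Suc show ?case unfolding ysS xs_def[symmetric] by (rule subspace_diff[OF \<open>subspace V\<close>])
    qed (use ys0 y in simp)
    have xsU: "xs k \<in> U" for k using g[OF ysV pos] unfolding xs_def by blast
    have ysn: "norm (ys k) \<le> norm y * (1/2)^k" for k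
    proof (cases k)
      case (Suc j)
      then show ?thesis using g[OF ysV[of j] pos[of j]] by (auto simp: ysS)
    qed (use ys0 in simp)
    have xsn: "norm (xs k) \<le> C0 * norm y * (1/2)^k" for k
    proof -
      have "norm (xs k) \<le> C0 * norm (ys k)" using g[OF ysV pos] unfolding xs_def by blast
      also have "\<dots> \<le> C0 * (norm y * (1/2)^k)" by (intro mult_left_mono ysn C0)
      finally show ?thesis by (simp add: mult.assoc)
    qed
    have sg: "summable (\<lambda>k. C0 * norm y * (1/2::real)^k)"
      by (intro summable_mult summable_geometric) simp
    have sx: "summable (\<lambda>k. norm (xs k))"
      by (rule summable_comparison_test[OF _ sg]) (use xsn in auto)
    have sx': "summable xs" using sx by (rule summable_norm_cancel)
    define x where "x = suminf xs"
    define ps where "ps m = (\<Sum>k<m. xs k)" for m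
    have psU: "ps m \<in> U" for m unfolding ps_def by (intro subspace_sum \<open>subspace U\<close> xsU)
    have lim: "ps \<longlonglongrightarrow> x" using summable_LIMSEQ[OF sx'] by (simp add: x_def ps_def[abs_def])
    have xU: "x \<in> U" by (rule closed_sequentially[OF \<open>closed U\<close>, of ps]) (use psU lim in auto)
    have Tps: "T (ps m) = y - ys m" for m
    proof (induction m)
      case 0
      then show ?case by (simp add: ps_def T0 ys0)
    next
      case (Suc m)
      have "T (ps (Suc m)) = T (ps m) + T (xs m)"
        using add[OF psU[of m] xsU[of m]] by (simp add: ps_def)
      also have "\<dots> = y - ys (Suc m)" by (simp only: Suc ysS xs_def) simp
      finally show ?case .
    qed
    have "(\<lambda>m. T (ps m)) \<longlonglongrightarrow> T x"
    proof (rule LIM_zero_cancel, rule Lim_null_comparison)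
      show "\<forall>\<^sub>F m in sequentially. norm (T (ps m) - T x) \<le> norm (ps m - x) * K"
        using bound[of "ps _ - x"] diff[OF psU xU] subspace_diff[OF \<open>subspace U\<close> psU xU] by auto
      show "(\<lambda>m. norm (ps m - x) * K) \<longlonglongrightarrow> 0"
        using tendsto_mult_right[OF tendsto_norm_zero[OF LIM_zero[OF lim]], of K] by simp
    qed
    moreover have "(\<lambda>m. T (ps m)) \<longlonglongrightarrow> y"
    proof -
      have "ys \<longlonglongrightarrow> 0"
      proof (rule Lim_null_comparison)
        show "\<forall>\<^sub>F m in sequentially. norm (ys m) \<le> norm y * (1/2)^m" using ysn by simp
        show "(\<lambda>m. norm y * (1/2)^m) \<longlonglongrightarrow> 0"
          using tendsto_mult_left[OF LIMSEQ_realpow_zero[of "1/2::real"], of "norm y"] by simp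
      qed
      then show ?thesis unfolding Tps using tendsto_diff[OF tendsto_const[of y]] by fastforce
    qed
    ultimately have "T x = y" by (rule LIMSEQ_unique)
    moreover have "norm x \<le> (2 * C0 + 1) * norm y"
    proof -
      have "norm x \<le> (\<Sum>k. norm (xs k))" unfolding x_def by (rule summable_norm[OF sx])
      also have "\<dots> \<le> (\<Sum>k. C0 * norm y * (1/2)^k)" by (rule suminf_le[OF xsn sx sg])
      also have "\<dots> = C0 * norm y * 2"
        using suminf_geometric[of "1/2::real"] by (subst suminf_mult) (auto intro: summable_geometric)
      finally show ?thesis using False by (simp add: algebra_simps) (smt (verit) norm_ge_zero)
    qed
    ultimately show ?thesis using xU by blast
  qed
  then show ?thesis using that[of "2 * C0 + 1"] C0 by auto
qed

section \<open>Bounded operators on a subspace\<close>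

lemma bounded_opsI:
  assumes "\<And>x. x \<in> X \<Longrightarrow> T x \<in> X"
    and "\<And>x y. x \<in> X \<Longrightarrow> y \<in> X \<Longrightarrow> T (x + y) = T x + T y"
    and "\<And>c x. x \<in> X \<Longrightarrow> T (c *\<^sub>C x) = c *\<^sub>C T x"
    and "\<And>x. x \<in> X \<Longrightarrow> norm (T x) \<le> K * norm x"
  shows "T \<in> bounded_ops X"
proof -
  have "\<forall>x\<in>X. norm (T x) \<le> norm x * K" using assms(4) by (simp add: mult.commute)
  then show ?thesis using assms(1-3) unfolding bounded_ops_def by blast
qed

lemma bounded_ops_mem: "T \<in> bounded_ops X \<Longrightarrow> x \<in> X \<Longrightarrow> T x \<in> X"
  and bounded_ops_add: "T \<in> bounded_ops X \<Longrightarrow> x \<in> X \<Longrightarrow> y \<in> X \<Longrightarrow> T (x + y) = T x + T y"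
  and bounded_ops_scale: "T \<in> bounded_ops X \<Longrightarrow> x \<in> X \<Longrightarrow> T (c *\<^sub>C x) = c *\<^sub>C T x"
  by (auto simp: bounded_ops_def)

lemma bounded_ops_bound:
  assumes "T \<in> bounded_ops X"
  obtains K where "K > 0" "\<And>x. x \<in> X \<Longrightarrow> norm (T x) \<le> K * norm x"
proof -
  obtain K where K: "\<And>x. x \<in> X \<Longrightarrow> norm (T x) \<le> norm x * K"
    using assms unfolding bounded_ops_def by blast
  have "norm (T x) \<le> (\<bar>K\<bar> + 1) * norm x" if "x \<in> X" for x
  proof -
    have "norm x * K \<le> norm x * (\<bar>K\<bar> + 1)" by (intro mult_left_mono) auto
    then show ?thesis using K[OF that] by (simp add: mult.commute)
  qed
  then show ?thesis using that[of "\<bar>K\<bar> + 1"] by auto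
qed

lemma bounded_ops_zero: "T \<in> bounded_ops X \<Longrightarrow> csubspace X \<Longrightarrow> T 0 = 0"
  using bounded_ops_scale[of T X 0 0] complex_vector.subspace_0[of X] by simp

lemma bounded_ops_diff:
  assumes "T \<in> bounded_ops X" "csubspace X" "x \<in> X" "y \<in> X"
  shows "T (x - y) = T x - T y"
proof -
  have "T (x - y + y) = T (x - y) + T y"
    using assms by (intro bounded_ops_add) (auto intro: complex_vector.subspace_diff)
  then show ?thesis by simp
qed

lemma bounded_ops_cong:
  assumes "\<And>x. x \<in> X \<Longrightarrow> T x = S x" "csubspace X"
  shows "T \<in> bounded_ops X \<longleftrightarrow> S \<in> bounded_ops X"
  using assms complex_vector.subspace_add[OF assms(2)] complex_vector.subspace_scale[OF assms(2)]
  unfolding bounded_ops_def by (auto simp: image_subset_iff)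

lemma bounded_ops_subset:
  "T \<in> bounded_ops X \<Longrightarrow> Y \<subseteq> X \<Longrightarrow> T ` Y \<subseteq> Y \<Longrightarrow> T \<in> bounded_ops Y"
  unfolding bounded_ops_def by (simp add: subset_iff) meson

lemma bounded_ops_id: "(\<lambda>x. x) \<in> bounded_ops X"
  by (rule bounded_opsI[where K = 1]) auto

lemma bounded_ops_compose:
  assumes "S \<in> bounded_ops X" "T \<in> bounded_ops X"
  shows "(\<lambda>x. S (T x)) \<in> bounded_ops X"
proof -
  obtain K L where K: "K > 0" "\<And>x. x \<in> X \<Longrightarrow> norm (S x) \<le> K * norm x"
    and L: "L > 0" "\<And>x. x \<in> X \<Longrightarrow> norm (T x) \<le> L * norm x"
    using assms by (meson bounded_ops_bound)
  show ?thesis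
  proof (rule bounded_opsI[where K = "K * L"])
    fix x assume "x \<in> X"
    then have "norm (S (T x)) \<le> K * norm (T x)" using K assms bounded_ops_mem by blast
    also have "\<dots> \<le> K * (L * norm x)" using K L \<open>x \<in> X\<close> by (intro mult_left_mono) auto
    finally show "norm (S (T x)) \<le> K * L * norm x" by (simp add: mult.assoc)
  qed (use assms in \<open>auto simp: bounded_ops_mem bounded_ops_add bounded_ops_scale\<close>)
qed

lemma bounded_ops_plus:
  assumes "csubspace X" "S \<in> bounded_ops X" "T \<in> bounded_ops X"
  shows "(\<lambda>x. S x + T x) \<in> bounded_ops X"
proof -
  obtain K L where K: "K > 0" "\<And>x. x \<in> X \<Longrightarrow> norm (S x) \<le> K * norm x"
    and L: "L > 0" "\<And>x. x \<in> X \<Longrightarrow> norm (T x) \<le> L * norm x"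
    using assms by (meson bounded_ops_bound)
  show ?thesis
  proof (rule bounded_opsI[where K = "K + L"])
    fix x assume "x \<in> X"
    then show "norm (S x + T x) \<le> (K + L) * norm x"
      using norm_triangle_ineq[of "S x" "T x"] K(2)[of x] L(2)[of x] by (simp add: algebra_simps)
  qed (use assms in \<open>auto simp: bounded_ops_mem bounded_ops_add bounded_ops_scale scaleC_add_right
      intro: complex_vector.subspace_add\<close>)
qed

lemma bounded_ops_scaleC:
  assumes "csubspace X" "T \<in> bounded_ops X"
  shows "(\<lambda>x. c *\<^sub>C T x) \<in> bounded_ops X"
proof -
  obtain L where L: "L > 0" "\<And>x. x \<in> X \<Longrightarrow> norm (T x) \<le> L * norm x"
    using assms by (meson bounded_ops_bound)
  show ?thesis
  proof (rule bounded_opsI[where K = "cmod c * L"])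
    show "norm (c *\<^sub>C T x) \<le> cmod c * L * norm x" if "x \<in> X" for x
      using mult_left_mono[OF L(2)[OF that], of "cmod c"] by (simp add: norm_scaleC mult.assoc)
  qed (use assms in \<open>auto simp: bounded_ops_mem bounded_ops_add bounded_ops_scale scaleC_add_right
      scaleC_scaleC mult.commute intro: complex_vector.subspace_scale\<close>)
qed

lemma bounded_ops_minus:
  assumes "csubspace X" "S \<in> bounded_ops X" "T \<in> bounded_ops X"
  shows "(\<lambda>x. S x - T x) \<in> bounded_ops X"
  using bounded_ops_plus[OF assms(1,2) bounded_ops_scaleC[OF assms(1,3), of "-1"]] by simp

lemma bounded_ops_shift:
  "csubspace X \<Longrightarrow> T \<in> bounded_ops X \<Longrightarrow> shift T z \<in> bounded_ops X"
  unfolding shift_def by (intro bounded_ops_minus bounded_ops_scaleC bounded_ops_id)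

lemma bounded_ops_power: "T \<in> bounded_ops X \<Longrightarrow> (T ^^ n) \<in> bounded_ops X"
proof (induction n)
  case 0
  then show ?case using bounded_ops_id[of X] by (simp add: id_def)
next
  case (Suc n)
  then show ?case using bounded_ops_compose[of T X "T ^^ n"] by (simp add: comp_def)
qed

lemma bounded_ops_continuous:
  assumes "T \<in> bounded_ops X" "csubspace X"
  shows "continuous_on X T"
proof -
  obtain K where K: "K > 0" "\<And>x. x \<in> X \<Longrightarrow> norm (T x) \<le> K * norm x"
    using assms by (meson bounded_ops_bound)
  have "dist (T x) (T y) \<le> K * dist x y" if "x \<in> X" "y \<in> X" for x y
    using K(2)[of "x - y"] that assms
    by (simp add: dist_norm bounded_ops_diff complex_vector.subspace_diff)
  then have "K-lipschitz_on X T" using K by (intro lipschitz_onI) auto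
  then show ?thesis by (rule lipschitz_on_continuous_on)
qed

lemma csubspace_image: "csubspace Y \<Longrightarrow> T \<in> bounded_ops X \<Longrightarrow> Y \<subseteq> X \<Longrightarrow> csubspace (T ` Y)"
proof (rule complex_vector.subspaceI)
  assume Y: "csubspace Y" "T \<in> bounded_ops X" "Y \<subseteq> X"
  have "0 \<in> Y" using Y(1) by (rule complex_vector.subspace_0)
  then have "T 0 = 0" using bounded_ops_scale[OF Y(2), of 0 0] Y(3) by auto
  then show "0 \<in> T ` Y" using \<open>0 \<in> Y\<close> by force
  fix x y assume "x \<in> T ` Y" "y \<in> T ` Y"
  then obtain u v where "u \<in> Y" "v \<in> Y" "x = T u" "y = T v" by blast
  then show "x + y \<in> T ` Y"
    using bounded_ops_add[OF Y(2), of u v] Y complex_vector.subspace_add[OF Y(1), of u v] by force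
next
  fix c x assume Y: "csubspace Y" "T \<in> bounded_ops X" "Y \<subseteq> X" and "x \<in> T ` Y"
  then obtain u where "u \<in> Y" "x = T u" by blast
  then show "c *\<^sub>C x \<in> T ` Y"
    using bounded_ops_scale[OF Y(2), of u c] Y complex_vector.subspace_scale[OF Y(1), of u c] by force
qed

lemma closed_csubspace_null_space:
  assumes "closed_csubspace X" "T \<in> bounded_ops X"
  shows "closed_csubspace (null_space X T)"
proof -
  have X: "csubspace X" "closed X" using assms by (auto simp: closed_csubspace_def)
  have "closed (X \<inter> T -` {0})"
    using bounded_ops_continuous[OF assms(2) X(1)] X(2) by (intro continuous_closed_preimage) auto
  moreover have "X \<inter> T -` {0} = null_space X T" by (auto simp: null_space_def)
  moreover have "csubspace (null_space X T)"
    unfolding complex_vector.subspace_def null_space_def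
    using assms X by (auto simp: bounded_ops_zero bounded_ops_add bounded_ops_scale
        complex_vector.subspace_0 complex_vector.subspace_add complex_vector.subspace_scale)
  ultimately show ?thesis by (simp add: closed_csubspace_def)
qed

section \<open>Projections and generalized inverses\<close>

text \<open>
  Complemented subspaces are handled through bounded idempotents onto them rather than through their
  complements: idempotents can be composed with operators that commute with them, restricted to
  subspaces and glued.
\<close>

definition projection_onto :: "'a::complex_normed_vector set \<Rightarrow> 'a set \<Rightarrow> ('a \<Rightarrow> 'a) \<Rightarrow> bool"
  where "projection_onto X V P \<longleftrightarrow> P \<in> bounded_ops X \<and> V \<subseteq> X \<and> P ` X \<subseteq> V \<and> (\<forall>v\<in>V. P v = v)"

text \<open>
  The addition map from the product of \<open>M\<close> and \<open>N\<close> onto \<open>X\<close> is open, which bounds the first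
  component of a vector by the norm of the vector.
\<close>

lemma direct_sum_projection:
  fixes X :: "'a::complex_banach set"
  assumes X: "closed_csubspace X" and M: "closed_csubspace M" and N: "closed_csubspace N"
    and XMN: "direct_sum X M N"
  obtains P where "projection_onto X M P" "\<And>x. x \<in> X \<Longrightarrow> x - P x \<in> N" "\<And>y. y \<in> N \<Longrightarrow> P y = 0"
proof -
  have sM: "csubspace M" and sN: "csubspace N" and sX: "csubspace X"
    using M N X by (auto simp: closed_csubspace_def)
  have sum: "M + N = X" and int: "M \<inter> N = {0}" using XMN by (auto simp: direct_sum_def)
  have "0 \<in> M" "0 \<in> N" using sM sN by (auto intro: complex_vector.subspace_0)
  then have MX: "M \<subseteq> X" and NX: "N \<subseteq> X" unfolding sum[symmetric]
    by (force simp: set_plus_def)+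
  have uniq: "m = m'" "n = n'" if "m \<in> M" "n \<in> N" "m' \<in> M" "n' \<in> N" "m + n = m' + n'" for m n m' n'
  proof -
    have "m - m' = n' - n" using that by (simp add: algebra_simps)
    moreover have "m - m' \<in> M" "n' - n \<in> N"
      using that sM sN by (auto intro: complex_vector.subspace_diff)
    ultimately have "m - m' \<in> M \<inter> N" by simp
    then show "m = m'" unfolding int by simp
    then show "n = n'" using that by simp
  qed
  define P where "P x = (THE m. m \<in> M \<and> x - m \<in> N)" for x
  have Peq: "P (m + n) = m" if "m \<in> M" "n \<in> N" for m n
    unfolding P_def
  proof (rule the_equality)
    fix m' assume "m' \<in> M \<and> m + n - m' \<in> N"
    then show "m' = m" using uniq(1)[OF that, of m' "m + n - m'"] by simp
  qed (use that in simp)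
  obtain C where C: "C > 0"
    "\<And>x. x \<in> X \<Longrightarrow> \<exists>u\<in>M \<times> N. fst u + snd u = x \<and> norm u \<le> C * norm x"
  proof (rule open_mapping_on_closed_subspaces[where U = "M \<times> N" and V = X and K = 2
        and T = "\<lambda>u. fst u + snd u"])
    show "closed (M \<times> N)" using M N by (auto simp: closed_csubspace_def closed_Times)
    show "subspace (M \<times> N)"
      by (intro subspace_Times csubspace_imp_subspace sM sN)
    show "closed X" "subspace X" using X by (auto simp: closed_csubspace_def intro: csubspace_imp_subspace)
    show "(\<lambda>u. fst u + snd u) ` (M \<times> N) = X"
      unfolding sum[symmetric] by (force simp: set_plus_def)
    show "norm (fst u + snd u) \<le> norm u * 2" for u :: "'a \<times> 'a"
      using norm_triangle_ineq[of "fst u" "snd u"] norm_fst_le[of "fst u" "snd u"]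
        norm_snd_le[of "snd u" "fst u"] by simp
  qed (auto simp: scaleR_add_right)
  have split: "\<exists>m\<in>M. \<exists>n\<in>N. x = m + n" if "x \<in> X" for x
    using that unfolding sum[symmetric] by (auto simp: set_plus_def)
  have PM: "P x \<in> M" and PN: "x - P x \<in> N" if "x \<in> X" for x
    using split[OF that] Peq by auto
  have "P \<in> bounded_ops X"
  proof (rule bounded_opsI[where K = C])
    fix x y assume xy: "x \<in> X" "y \<in> X"
    have "x + y = (P x + P y) + ((x - P x) + (y - P y))" by simp
    also have "P \<dots> = P x + P y"
      using xy PM PN sM sN by (intro Peq) (auto intro: complex_vector.subspace_add)
    finally show "P (x + y) = P x + P y" .
  next
    fix c x assume x: "x \<in> X"
    have "c *\<^sub>C x = c *\<^sub>C P x + c *\<^sub>C (x - P x)" by (simp add: scaleC_add_right[symmetric])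
    also have "P \<dots> = c *\<^sub>C P x"
      using x PM PN sM sN by (intro Peq) (auto intro: complex_vector.subspace_scale)
    finally show "P (c *\<^sub>C x) = c *\<^sub>C P x" .
  next
    fix x assume "x \<in> X"
    then obtain m n where u: "m \<in> M" "n \<in> N" "m + n = x" "norm (m, n) \<le> C * norm x" using C(2) by force
    then show "norm (P x) \<le> C * norm x" using Peq[of m n] norm_fst_le[of m n] by simp
  qed (use PM MX in blast)
  moreover have "P m = m" if "m \<in> M" for m using Peq[OF that \<open>0 \<in> N\<close>] by simp
  moreover have "P n = 0" if "n \<in> N" for n using Peq[OF \<open>0 \<in> M\<close> that] by simp
  ultimately show ?thesis using that[of P] PM PN MX by (auto simp: projection_onto_def)
qed

text \<open>
  The range of an idempotent \<open>P\<close> is the null space of \<open>I - P\<close>.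
\<close>

lemma projection_onto_closed:
  assumes X: "closed_csubspace X" and P: "projection_onto X V P"
  shows "closed_csubspace V"
proof -
  have "(\<lambda>x. x - P x) \<in> bounded_ops X"
    using P X by (intro bounded_ops_minus bounded_ops_id) (auto simp: projection_onto_def closed_csubspace_def)
  moreover have "V = null_space X (\<lambda>x. x - P x)"
    using P by (fastforce simp: projection_onto_def null_space_def)
  ultimately show ?thesis using closed_csubspace_null_space[OF X] by metis
qed

lemma complemented_iff_projection:
  fixes X :: "'a::complex_banach set"
  assumes X: "closed_csubspace X"
  shows "complemented X V \<longleftrightarrow> (\<exists>P. projection_onto X V P)"
proof
  assume "complemented X V"
  then show "\<exists>P. projection_onto X V P"
    unfolding complemented_def using direct_sum_projection[OF X] by metis
next
  assume "\<exists>P. projection_onto X V P"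
  then obtain P where P: "projection_onto X V P" by blast
  then have PB: "P \<in> bounded_ops X" and VX: "V \<subseteq> X" and PX: "\<And>x. x \<in> X \<Longrightarrow> P x \<in> V"
    and Pid: "\<And>v. v \<in> V \<Longrightarrow> P v = v" by (auto simp: projection_onto_def)
  have sX: "csubspace X" using X by (simp add: closed_csubspace_def)
  have V: "closed_csubspace V" by (rule projection_onto_closed[OF X P])
  have W: "closed_csubspace (null_space X P)" by (rule closed_csubspace_null_space[OF X PB])
  have "V + null_space X P = X"
  proof
    show "V + null_space X P \<subseteq> X"
      using VX sX by (auto simp: set_plus_def null_space_def intro: complex_vector.subspace_add)
    show "X \<subseteq> V + null_space X P"
    proof
      fix x assume x: "x \<in> X"
      have "P x \<in> X" using PX[OF x] VX by blast
      then have "x - P x \<in> null_space X P"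
        using PX[OF x] x sX Pid PB by (auto simp: null_space_def bounded_ops_diff intro: complex_vector.subspace_diff)
      then show "x \<in> V + null_space X P" using PX[OF x] by (metis add.commute diff_add_cancel set_plus_intro)
    qed
  qed
  moreover have "V \<inter> null_space X P = {0}"
    using Pid V W by (auto simp: null_space_def closed_csubspace_def complex_vector.subspace_0)
      (metis complex_vector.subspace_0 null_space_def mem_Collect_eq)+
  ultimately show "complemented X V" using V W by (auto simp: complemented_def direct_sum_def)
qed

text \<open>
  On the kernel of \<open>P\<close> the operator \<open>T\<close> is a bijection onto its range, and by the open mapping
  theorem its inverse is bounded; \<open>S\<close> is this inverse composed with the projection \<open>E\<close>.
\<close>

lemma generalized_inverse:
  fixes X :: "'a::complex_banach set"
  assumes X: "closed_csubspace X" and T: "T \<in> bounded_ops X"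
    and P: "projection_onto X (null_space X T) P" and E: "projection_onto X (T ` X) E"
  obtains S where "S \<in> bounded_ops X" "\<And>y. y \<in> X \<Longrightarrow> T (S y) = E y" "\<And>x. x \<in> X \<Longrightarrow> S (T x) = x - P x"
proof -
  have sX: "csubspace X" using X by (simp add: closed_csubspace_def)
  have PB: "P \<in> bounded_ops X" and PT: "\<And>x. x \<in> X \<Longrightarrow> P x \<in> X \<and> T (P x) = 0"
    and Pid: "\<And>v. v \<in> X \<Longrightarrow> T v = 0 \<Longrightarrow> P v = v"
    using P by (auto simp: projection_onto_def null_space_def)
  have EB: "E \<in> bounded_ops X" and ET: "\<And>x. x \<in> X \<Longrightarrow> E x \<in> T ` X"
    and Eid: "\<And>x. x \<in> X \<Longrightarrow> E (T x) = T x"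
    using E by (auto simp: projection_onto_def)
  obtain L where L: "L > 0" "\<And>x. x \<in> X \<Longrightarrow> norm (x - P x) \<le> L * norm x"
    using bounded_ops_bound[OF bounded_ops_minus[OF sX bounded_ops_id PB]] by blast
  obtain L' where L': "L' > 0" "\<And>x. x \<in> X \<Longrightarrow> norm (E x) \<le> L' * norm x"
    using bounded_ops_bound[OF EB] by blast
  obtain K where K: "\<And>x. x \<in> X \<Longrightarrow> norm (T x) \<le> K * norm x" using bounded_ops_bound[OF T] by blast
  have TX: "closed_csubspace (T ` X)" by (rule projection_onto_closed[OF X E])
  obtain C where C: "C > 0" "\<And>y. y \<in> T ` X \<Longrightarrow> \<exists>x\<in>X. T x = y \<and> norm x \<le> C * norm y"
  proof (rule open_mapping_on_closed_subspaces[where U = X and V = "T ` X" and T = T and K = K])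
    show "closed X" "subspace X" "closed (T ` X)" "subspace (T ` X)"
      using X TX by (auto simp: closed_csubspace_def intro: csubspace_imp_subspace)
  qed (use T K in \<open>auto simp: bounded_ops_add bounded_ops_scale scaleR_scaleC mult.commute\<close>)
  define S where "S y = (THE u. u \<in> X \<and> P u = 0 \<and> T u = E y)" for y
  have Seq: "S y = x - P x" if "x \<in> X" "T x = E y" for x y
    unfolding S_def
  proof (rule the_equality)
    show "x - P x \<in> X \<and> P (x - P x) = 0 \<and> T (x - P x) = E y"
      using that PT[of x] Pid[of "P x"] sX PB T
      by (auto simp: bounded_ops_diff intro: complex_vector.subspace_diff)
    fix u assume u: "u \<in> X \<and> P u = 0 \<and> T u = E y"
    then have "P (x - u) = x - u"
      using that sX T by (intro Pid) (auto simp: bounded_ops_diff intro: complex_vector.subspace_diff)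
    then show "u = x - P x" using u that sX PB by (simp add: bounded_ops_diff)
  qed
  have pre: "\<exists>x\<in>X. T x = E y \<and> norm x \<le> C * norm (E y)" if "y \<in> X" for y using C(2)[OF ET[OF that]] .
  have "S \<in> bounded_ops X"
  proof (rule bounded_opsI[where K = "L * (C * L')"])
    fix y assume y: "y \<in> X"
    then obtain x where x: "x \<in> X" "T x = E y" "norm x \<le> C * norm (E y)" using pre by blast
    show "S y \<in> X" using Seq[OF x(1,2)] x PT sX by (auto intro: complex_vector.subspace_diff)
    have "norm (S y) \<le> L * norm x" using Seq[OF x(1,2)] L x by simp
    also have "\<dots> \<le> L * (C * (L' * norm y))"
      using L C x(3) L'(2)[OF y] by (intro mult_left_mono order_trans[OF x(3)]) auto
    finally show "norm (S y) \<le> L * (C * L') * norm y" by (simp add: mult.assoc)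
  next
    fix y1 y2 assume y: "y1 \<in> X" "y2 \<in> X"
    then obtain x1 x2 where x: "x1 \<in> X" "T x1 = E y1" "x2 \<in> X" "T x2 = E y2" using pre by meson
    have "S (y1 + y2) = (x1 + x2) - P (x1 + x2)"
      using x y T EB sX by (intro Seq) (auto simp: bounded_ops_add intro: complex_vector.subspace_add)
    then show "S (y1 + y2) = S y1 + S y2"
      using x PB by (simp add: Seq[of x1] Seq[of x2] bounded_ops_add)
  next
    fix c y assume y: "y \<in> X"
    then obtain x where x: "x \<in> X" "T x = E y" using pre by blast
    have "S (c *\<^sub>C y) = c *\<^sub>C x - P (c *\<^sub>C x)"
      using x y T EB sX by (intro Seq) (auto simp: bounded_ops_scale intro: complex_vector.subspace_scale)
    then show "S (c *\<^sub>C y) = c *\<^sub>C S y"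
      using x PB by (simp add: Seq[of x] bounded_ops_scale complex_vector.scale_right_diff_distrib)
  qed
  moreover have "T (S y) = E y" if y: "y \<in> X" for y
  proof -
    obtain x where x: "x \<in> X" "T x = E y" using pre y by blast
    then show ?thesis using PT[of x] T sX by (simp add: Seq[of x] bounded_ops_diff)
  qed
  moreover have "S (T x) = x - P x" if "x \<in> X" for x
    using that Eid by (intro Seq) auto
  ultimately show ?thesis by (rule that)
qed

lemma projection_onto_self: "projection_onto X X (\<lambda>x. x)"
  by (auto simp: projection_onto_def bounded_ops_id)

lemma right_invertible_iff:
  fixes X :: "'a::complex_banach set"
  assumes X: "closed_csubspace X" and T: "T \<in> bounded_ops X"
  shows "right_invertible X T \<longleftrightarrow> T ` X = X \<and> complemented X (null_space X T)"
proof
  assume "T ` X = X \<and> complemented X (null_space X T)"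
  then obtain P where "T ` X = X" "projection_onto X (null_space X T) P"
    using complemented_iff_projection[OF X] by blast
  then obtain S where "S \<in> bounded_ops X" "\<And>y. y \<in> X \<Longrightarrow> T (S y) = y"
    using generalized_inverse[OF X T, of P "\<lambda>x. x"] projection_onto_self by metis
  then show "right_invertible X T" by (auto simp: right_invertible_def)
next
  assume "right_invertible X T"
  then obtain S where S: "S \<in> bounded_ops X" "\<And>x. x \<in> X \<Longrightarrow> T (S x) = x"
    by (auto simp: right_invertible_def)
  have sX: "csubspace X" using X by (simp add: closed_csubspace_def)
  have "x \<in> T ` X" if "x \<in> X" for x
    using S(2)[OF that] bounded_ops_mem[OF S(1) that] by (metis imageI)
  then have "T ` X = X" using T by (auto simp: bounded_ops_mem)
  moreover have "projection_onto X (null_space X T) (\<lambda>x. x - S (T x))"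
    unfolding projection_onto_def
  proof (intro conjI)
    show "(\<lambda>x. x - S (T x)) \<in> bounded_ops X"
      using S T sX by (intro bounded_ops_minus bounded_ops_id bounded_ops_compose[of S X T])
    show "null_space X T \<subseteq> X" by (auto simp: null_space_def)
    show "(\<lambda>x. x - S (T x)) ` X \<subseteq> null_space X T"
      using S T sX by (auto simp: null_space_def bounded_ops_mem bounded_ops_diff
          intro!: complex_vector.subspace_diff)
    show "\<forall>v\<in>null_space X T. v - S (T v) = v"
      using bounded_ops_zero[OF S(1) sX] by (auto simp: null_space_def)
  qed
  ultimately show "T ` X = X \<and> complemented X (null_space X T)"
    using complemented_iff_projection[OF X] by blast
qed

section \<open>Neumann series\<close>

lemma closed_subspace_suminf:
  assumes "closed V" "csubspace V" "summable f" "\<And>k. f k \<in> V"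
  shows "suminf f \<in> V"
proof (rule closed_sequentially[OF assms(1) _ summable_LIMSEQ[OF assms(3)]])
  show "sum f {..<n} \<in> V" for n using assms by (intro complex_vector.subspace_sum) auto
qed

text \<open>
  The operators \<open>R z = (I - z S)\<^sup>-\<^sup>1\<close> for small \<open>z\<close>.  Both inverse identities are recorded.  The last
  property transfers closed conditions on the orbit of \<open>y\<close> under \<open>S\<close> to \<open>R z y\<close>; it is what connects
  the series with the ranges of the powers of a Saphar operator.
\<close>

lemma neumann_series:
  fixes X :: "'a::complex_banach set"
  assumes X: "closed_csubspace X" and S: "S \<in> bounded_ops X"
  obtains e R where "e > 0"
    and "\<And>z. cmod z < e \<Longrightarrow> R z \<in> bounded_ops X"
    and "\<And>z y. cmod z < e \<Longrightarrow> y \<in> X \<Longrightarrow> norm (R z y) \<le> 2 * norm y"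
    and "\<And>z y. cmod z < e \<Longrightarrow> y \<in> X \<Longrightarrow> R z y = y + z *\<^sub>C S (R z y)"
    and "\<And>z y. cmod z < e \<Longrightarrow> y \<in> X \<Longrightarrow> R z y = y + z *\<^sub>C R z (S y)"
    and "\<And>z y V. cmod z < e \<Longrightarrow> y \<in> X \<Longrightarrow> closed_csubspace V \<Longrightarrow> (\<And>k. (S ^^ k) y \<in> V) \<Longrightarrow> R z y \<in> V"
proof -
  have sX: "csubspace X" "closed X" using X by (auto simp: closed_csubspace_def)
  obtain K where K: "K > 0" "\<And>x. x \<in> X \<Longrightarrow> norm (S x) \<le> K * norm x"
    using bounded_ops_bound[OF S] by blast
  \<comment> \<open>For \<open>|z| < e\<close> the terms are dominated by \<open>(1 / 2)\<^sup>k \<parallel>y\<parallel>\<close>, whence the bound \<open>2\<close> below.\<close>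
  define e where "e = 1 / (2 * K)"
  define f where "f z y k = z ^ k *\<^sub>C (S ^^ k) y" for z y k
  define R where "R z y = suminf (f z y)" for z y
  have SX: "(S ^^ k) y \<in> X" if "y \<in> X" for y k
    using bounded_ops_mem[OF bounded_ops_power[OF S] that] .
  have fX: "f z y k \<in> X" if "y \<in> X" for z y k
    unfolding f_def using sX(1) SX[OF that] by (rule complex_vector.subspace_scale)
  have nS: "norm ((S ^^ k) y) \<le> K ^ k * norm y" if "y \<in> X" for y k
  proof (induction k)
    case (Suc k)
    have "norm ((S ^^ Suc k) y) \<le> K * norm ((S ^^ k) y)" using K(2)[OF SX[OF that]] by simp
    also have "\<dots> \<le> K * (K ^ k * norm y)" using Suc K by (intro mult_left_mono) auto
    finally show ?case by (simp add: mult.assoc)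
  qed simp
  have nf: "norm (f z y k) \<le> norm y * (1/2) ^ k" if "cmod z < e" "y \<in> X" for z y k
  proof -
    have "norm (f z y k) \<le> cmod z ^ k * (K ^ k * norm y)"
      unfolding f_def norm_scaleC norm_power by (intro mult_left_mono nS that) simp
    also have "\<dots> = (cmod z * K) ^ k * norm y" by (simp add: power_mult_distrib)
    also have "\<dots> \<le> (1/2) ^ k * norm y"
      using that K by (intro mult_right_mono power_mono) (auto simp: e_def field_simps)
    finally show ?thesis by (simp add: mult.commute)
  qed
  have sg: "summable (\<lambda>k. a * (1/2::real) ^ k)" for a
    by (intro summable_mult summable_geometric) simp
  have snf: "summable (\<lambda>k. norm (f z y k))" if "cmod z < e" "y \<in> X" for z y
    by (rule summable_comparison_test[OF _ sg[of "norm y"]]) (use nf[OF that] in auto)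
  have sf: "summable (f z y)" if "cmod z < e" "y \<in> X" for z y
    using snf[OF that] by (rule summable_norm_cancel)
  have RX: "R z y \<in> X" if "cmod z < e" "y \<in> X" for z y
    unfolding R_def using sX sf[OF that] fX[OF that(2)] by (intro closed_subspace_suminf)
  have Rn: "norm (R z y) \<le> 2 * norm y" if "cmod z < e" "y \<in> X" for z y
  proof -
    have "norm (R z y) \<le> (\<Sum>k. norm (f z y k))" unfolding R_def by (rule summable_norm[OF snf[OF that]])
    also have "\<dots> \<le> (\<Sum>k. norm y * (1/2) ^ k)" by (rule suminf_le[OF nf[OF that] snf[OF that] sg])
    also have "\<dots> = norm y * 2"
      using suminf_geometric[of "1/2::real"] by (subst suminf_mult) (auto intro: summable_geometric)
    finally show ?thesis by simp
  qed
  have RB: "R z \<in> bounded_ops X" if z: "cmod z < e" for z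
  proof (rule bounded_opsI[where K = 2])
    fix x y assume xy: "x \<in> X" "y \<in> X"
    have "f z (x + y) = (\<lambda>k. f z x k + f z y k)"
      using bounded_ops_add[OF bounded_ops_power[OF S] xy] by (simp add: f_def scaleC_add_right fun_eq_iff)
    then show "R z (x + y) = R z x + R z y"
      unfolding R_def using suminf_add[OF sf[OF z xy(1)] sf[OF z xy(2)]] by simp
  next
    fix c x assume x: "x \<in> X"
    have "f z (c *\<^sub>C x) = (\<lambda>k. c *\<^sub>C f z x k)"
      using bounded_ops_scale[OF bounded_ops_power[OF S] x]
      by (simp add: f_def fun_eq_iff scaleC_scaleC mult.commute)
    then show "R z (c *\<^sub>C x) = c *\<^sub>C R z x"
      unfolding R_def using bounded_linear.suminf[OF bounded_linear_scaleC sf[OF z x], of c] by simp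
  qed (use RX Rn z in auto)
  have R2: "R z y = y + z *\<^sub>C R z (S y)" if z: "cmod z < e" and y: "y \<in> X" for z y
  proof -
    have Sy: "S y \<in> X" using S y by (rule bounded_ops_mem)
    have "R z y = f z y 0 + (\<Sum>k. f z y (Suc k))"
      unfolding R_def using suminf_split_head[OF sf[OF z y]] by simp
    also have "(\<lambda>k. f z y (Suc k)) = (\<lambda>k. z *\<^sub>C f z (S y) k)"
      by (simp add: f_def fun_eq_iff scaleC_scaleC funpow_swap1)
    also have "f z y 0 + suminf \<dots> = y + z *\<^sub>C R z (S y)"
      unfolding R_def bounded_linear.suminf[OF bounded_linear_scaleC sf[OF z Sy], of z]
      by (simp add: f_def)
    finally show ?thesis .
  qed
  have R1: "R z y = y + z *\<^sub>C S (R z y)" if z: "cmod z < e" and y: "y \<in> X" for z y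
  proof -
    have ps: "(\<Sum>k<n. f z y k) \<in> X" for n
      using fX[OF y] by (intro complex_vector.subspace_sum sX)
    have Sps: "(\<Sum>k<Suc n. f z y k) = y + z *\<^sub>C S (\<Sum>k<n. f z y k)" for n
    proof (induction n)
      case 0
      then show ?case using bounded_ops_zero[OF S sX(1)] by (simp add: f_def)
    next
      case (Suc n)
      have "S (f z y n) = z ^ n *\<^sub>C (S ^^ Suc n) y"
        using bounded_ops_scale[OF S SX[OF y]] by (simp add: f_def)
      then have "f z y (Suc n) = z *\<^sub>C S (f z y n)" by (simp add: f_def scaleC_scaleC)
      then show ?case
        using Suc bounded_ops_add[OF S ps[of n] fX[OF y], of z n]
        by (simp add: scaleC_add_right add.assoc)
    qed
    have lim: "(\<lambda>n. \<Sum>k<n. f z y k) \<longlonglongrightarrow> R z y"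
      unfolding R_def by (rule summable_LIMSEQ[OF sf[OF z y]])
    have "(\<lambda>n. S (\<Sum>k<n. f z y k)) \<longlonglongrightarrow> S (R z y)"
      using continuous_on_tendsto_compose[OF bounded_ops_continuous[OF S sX(1)] lim RX[OF z y]] ps by simp
    then have "(\<lambda>n. y + z *\<^sub>C S (\<Sum>k<n. f z y k)) \<longlonglongrightarrow> y + z *\<^sub>C S (R z y)"
      by (intro tendsto_add tendsto_const bounded_linear.tendsto[OF bounded_linear_scaleC])
    then have "(\<lambda>n. \<Sum>k<Suc n. f z y k) \<longlonglongrightarrow> y + z *\<^sub>C S (R z y)" unfolding Sps .
    moreover have "(\<lambda>n. \<Sum>k<Suc n. f z y k) \<longlonglongrightarrow> R z y" using lim by (rule LIMSEQ_Suc)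
    ultimately show ?thesis by (metis LIMSEQ_unique)
  qed
  have RV: "R z y \<in> V" if "cmod z < e" "y \<in> X" "closed_csubspace V" "\<And>k. (S ^^ k) y \<in> V" for z y V
    unfolding R_def using that sf[OF that(1,2)]
    by (intro closed_subspace_suminf) (auto simp: f_def closed_csubspace_def intro: complex_vector.subspace_scale)
  have "e > 0" using K by (simp add: e_def)
  then show ?thesis using that[of e R] RB Rn R1 R2 RV by blast
qed

text \<open>
  If \<open>T S = I\<close>, then \<open>(T - z I) S = I - z S\<close> is invertible for small \<open>z\<close>.
\<close>

lemma right_invertible_perturb:
  fixes X :: "'a::complex_banach set"
  assumes X: "closed_csubspace X" and T: "T \<in> bounded_ops X" and "right_invertible X T"
  obtains e where "e > 0" "\<And>z. cmod z < e \<Longrightarrow> right_invertible X (shift T z)"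
proof -
  obtain S where S: "S \<in> bounded_ops X" "\<And>x. x \<in> X \<Longrightarrow> T (S x) = x"
    using assms by (auto simp: right_invertible_def)
  obtain e R where e: "e > 0" and RB: "\<And>z. cmod z < e \<Longrightarrow> R z \<in> bounded_ops X"
    and R: "\<And>z y. cmod z < e \<Longrightarrow> y \<in> X \<Longrightarrow> R z y = y + z *\<^sub>C S (R z y)"
    using neumann_series[OF X S(1)] by metis
  have "right_invertible X (shift T z)" if z: "cmod z < e" for z
    unfolding right_invertible_def
  proof (intro bexI ballI)
    show "(\<lambda>x. S (R z x)) \<in> bounded_ops X" by (rule bounded_ops_compose[OF S(1) RB[OF z]])
    show "shift T z (S (R z x)) = x" if x: "x \<in> X" for x
      using R[OF z x] S(2)[OF bounded_ops_mem[OF RB[OF z] x]] by (simp add: shift_def diff_eq_eq)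
  qed
  then show ?thesis using that e by blast
qed

text \<open>
  For large \<open>z\<close> the operator \<open>T - z I = - z (I - z\<^sup>-\<^sup>1 T)\<close> is invertible by the Neumann series.
\<close>

lemma right_invertible_large:
  fixes X :: "'a::complex_banach set"
  assumes X: "closed_csubspace X" and T: "T \<in> bounded_ops X"
  obtains r where "r > 0" "\<And>z. cmod z > r \<Longrightarrow> right_invertible X (shift T z)"
proof -
  have sX: "csubspace X" using X by (auto simp: closed_csubspace_def)
  obtain e R where e: "e > 0" and RB: "\<And>z. cmod z < e \<Longrightarrow> R z \<in> bounded_ops X"
    and R: "\<And>z y. cmod z < e \<Longrightarrow> y \<in> X \<Longrightarrow> R z y = y + z *\<^sub>C T (R z y)"
    using neumann_series[OF X T] by metis
  have "right_invertible X (shift T z)" if z: "cmod z > 1 / e" for z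
    unfolding right_invertible_def
  proof (intro bexI ballI)
    have "z \<noteq> 0" using z e by (auto simp: not_less)
    then have w: "cmod (inverse z) < e" using z e by (simp add: norm_inverse field_simps norm_divide)
    show "(\<lambda>x. (- inverse z) *\<^sub>C R (inverse z) x) \<in> bounded_ops X"
      by (intro bounded_ops_scaleC sX RB w)
    fix x assume x: "x \<in> X"
    have "R (inverse z) x \<in> X" using bounded_ops_mem[OF RB[OF w] x] .
    then have "shift T z ((- inverse z) *\<^sub>C R (inverse z) x)
        = R (inverse z) x - inverse z *\<^sub>C T (R (inverse z) x)"
      using bounded_ops_scale[OF T, of "R (inverse z) x" "- inverse z"] \<open>z \<noteq> 0\<close>
      by (simp add: shift_def scaleC_scaleC scaleC_one)
    then show "shift T z ((- inverse z) *\<^sub>C R (inverse z) x) = x" using R[OF w x] by (simp add: diff_eq_eq)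
  qed
  then show ?thesis using that[of "1 / e"] e by auto
qed

section \<open>Saphar operators near zero\<close>

lemma funpow_image_mono:
  assumes "T \<in> bounded_ops X" "j \<le> k"
  shows "(T ^^ k) ` X \<subseteq> (T ^^ j) ` X"
proof -
  have "(T ^^ k) x = (T ^^ j) ((T ^^ (k - j)) x)" for x
    using assms(2) by (simp flip: funpow_add comp_apply[of "T ^^ j"])
  then show ?thesis using bounded_ops_mem[OF bounded_ops_power[OF assms(1)]] by (metis image_subsetI imageI)
qed

text \<open>
  If \<open>T\<^sup>n\<^sup>+\<^sup>1 x = 0\<close>, then \<open>T\<^sup>n x\<close> lies in the null space of \<open>T\<close>, hence equals \<open>T\<^sup>n\<^sup>+\<^sup>1 u\<close> for some \<open>u\<close>.
  Then \<open>T\<^sup>n\<close> kills \<open>x - T u\<close>, and induction applies.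
\<close>

lemma Kato_null_power_subset:
  assumes sX: "csubspace X" and T: "T \<in> bounded_ops X" and K: "\<And>k. null_space X T \<subseteq> (T ^^ k) ` X"
  shows "null_space X (T ^^ n) \<subseteq> T ` X"
proof (induction n)
  case 0
  have "T 0 = 0" using T sX by (rule bounded_ops_zero)
  then show ?case using complex_vector.subspace_0[OF sX] by (force simp: null_space_def)
next
  case (Suc n)
  show ?case
  proof
    fix x assume "x \<in> null_space X (T ^^ Suc n)"
    then have x: "x \<in> X" "T ((T ^^ n) x) = 0" by (auto simp: null_space_def)
    have "(T ^^ n) x \<in> null_space X T"
      using x bounded_ops_mem[OF bounded_ops_power[OF T] x(1)] by (simp add: null_space_def)
    then obtain u where u: "u \<in> X" "(T ^^ n) x = (T ^^ Suc n) u" using K[of "Suc n"] by blast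
    have Tu: "T u \<in> X" using T u(1) by (rule bounded_ops_mem)
    have "(T ^^ n) (x - T u) = 0"
      using bounded_ops_diff[OF bounded_ops_power[OF T] sX x(1) Tu] u(2) by (simp add: funpow_swap1)
    then have "x - T u \<in> T ` X"
      using Suc x(1) Tu sX by (auto simp: null_space_def subset_iff intro: complex_vector.subspace_diff)
    moreover have "csubspace (T ` X)" using csubspace_image[OF sX T] by simp
    ultimately have "(x - T u) + T u \<in> T ` X" using u(1) by (intro complex_vector.subspace_add) auto
    then show "x \<in> T ` X" by simp
  qed
qed

text \<open>
  If \<open>T x - z x\<close> is in the range of every power of \<open>T\<close>, then \<open>x = z\<^sup>-\<^sup>1 (T x - (T x - z x))\<close> moves from
  the range of \<open>T\<^sup>k\<close> into the range of \<open>T\<^sup>k\<^sup>+\<^sup>1\<close>.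
\<close>

lemma null_shift_power_subset:
  assumes sX: "csubspace X" and T: "T \<in> bounded_ops X" and z: "z \<noteq> 0"
  shows "null_space X (shift T z ^^ n) \<subseteq> (T ^^ k) ` X"
proof (induction n arbitrary: k)
  case 0
  have "0 \<in> (T ^^ k) ` X"
    using bounded_ops_zero[OF bounded_ops_power[OF T] sX] complex_vector.subspace_0[OF sX] by (metis imageI)
  then show ?case by (auto simp: null_space_def)
next
  case (Suc n)
  note IH = Suc
  show ?case
  proof (induction k)
    case 0
    show ?case by (auto simp: null_space_def)
  next
    case (Suc k)
    show ?case
    proof
      fix x assume x: "x \<in> null_space X (shift T z ^^ Suc n)"
      have xX: "x \<in> X" using x by (simp add: null_space_def)
      have "shift T z x \<in> null_space X (shift T z ^^ n)"
        using x bounded_ops_mem[OF bounded_ops_shift[OF sX T] xX, of z]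
        by (auto simp: null_space_def funpow_swap1)
      then have 1: "shift T z x \<in> (T ^^ Suc k) ` X" using IH by blast
      have "x \<in> (T ^^ k) ` X" using Suc x by blast
      then have 2: "T x \<in> (T ^^ Suc k) ` X" by auto
      have s: "csubspace ((T ^^ Suc k) ` X)"
        using csubspace_image[OF sX bounded_ops_power[OF T]] by blast
      have "inverse z *\<^sub>C (T x - shift T z x) \<in> (T ^^ Suc k) ` X"
        by (intro complex_vector.subspace_scale complex_vector.subspace_diff s 1 2)
      then show "x \<in> (T ^^ Suc k) ` X" using z by (simp add: shift_def)
    qed
  qed
qed

text \<open>
  Let \<open>S\<close> be a generalized inverse of \<open>T\<close>, let \<open>F = I - T S\<close>, which annihilates exactly the range of
  \<open>T\<close>, and let \<open>R z = (I - z S)\<^sup>-\<^sup>1\<close>.  The intersection \<open>W\<close> of the ranges of all powers of \<open>T\<close> contains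
  the null space of \<open>T\<close>, by the Kato property, and is invariant under \<open>S\<close>.  Therefore \<open>R z\<close> maps \<open>W\<close>
  into the range of \<open>T\<close>, which has two consequences.  First, \<open>F R\<^sub>z (T - z I) = 0\<close>, since
  \<open>R\<^sub>z (T - z I) x\<close> is \<open>T x\<close> up to a multiple of \<open>R z\<close> applied to a vector of the null space of \<open>T\<close>.
  Secondly, \<open>(T - z I) S R\<^sub>z y = y\<close> for \<open>y\<close> in \<open>W\<close>, so that the null spaces of the powers of \<open>T - z I\<close>
  lie in the range of \<open>T - z I\<close>.  The vector \<open>w\<close> witnesses that \<open>F\<close> is not zero.
\<close>

lemma Saphar_resolvent:
  fixes X :: "'a::complex_banach set"
  assumes X: "closed_csubspace X" and T: "T \<in> bounded_ops X"
    and Sa: "Saphar X T" and ns: "T ` X \<noteq> X"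
  obtains e F S R w where "e > 0" "F \<in> bounded_ops X" "S \<in> bounded_ops X" "w \<in> X" "F w \<noteq> 0"
    and "\<And>z. cmod z < e \<Longrightarrow> R z \<in> bounded_ops X"
    and "\<And>z y. cmod z < e \<Longrightarrow> y \<in> X \<Longrightarrow> norm (R z y) \<le> 2 * norm y"
    and "\<And>z y. cmod z < e \<Longrightarrow> y \<in> X \<Longrightarrow> R z y = y + z *\<^sub>C S (R z y)"
    and "\<And>z y. cmod z < e \<Longrightarrow> y \<in> X \<Longrightarrow> R z y = y + z *\<^sub>C R z (S y)"
    and "\<And>z x. cmod z < e \<Longrightarrow> x \<in> X \<Longrightarrow> F (R z (shift T z x)) = 0"
    and "\<And>z n. cmod z < e \<Longrightarrow> null_space X (shift T z ^^ n) \<subseteq> shift T z ` X"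
proof -
  have sX: "csubspace X" using X by (auto simp: closed_csubspace_def)
  have K: "null_space X T \<subseteq> (T ^^ k) ` X" for k using Sa by (auto simp: Saphar_def Kato_def)
  obtain P where P: "projection_onto X (null_space X T) P"
    using Sa complemented_iff_projection[OF X] by (auto simp: Saphar_def)
  obtain E where E: "projection_onto X (T ` X) E"
    using Sa complemented_iff_projection[OF X] by (auto simp: Saphar_def)
  have TX: "closed_csubspace (T ` X)" by (rule projection_onto_closed[OF X E])
  obtain S where S: "S \<in> bounded_ops X" and TS: "\<And>y. y \<in> X \<Longrightarrow> T (S y) = E y"
    and ST: "\<And>x. x \<in> X \<Longrightarrow> S (T x) = x - P x"
    using generalized_inverse[OF X T P E] by blast
  have EB: "E \<in> bounded_ops X" and EX: "\<And>y. y \<in> X \<Longrightarrow> E y \<in> T ` X" and Eid: "\<And>y. y \<in> T ` X \<Longrightarrow> E y = y"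
    using E by (auto simp: projection_onto_def)
  have PN: "\<And>x. x \<in> X \<Longrightarrow> P x \<in> null_space X T" using P by (auto simp: projection_onto_def)
  define F where "F y = y - E y" for y
  have FB: "F \<in> bounded_ops X" unfolding F_def by (intro bounded_ops_minus bounded_ops_id sX EB)
  obtain w where w: "w \<in> X" "w \<notin> T ` X" using ns T by (auto simp: bounded_ops_mem)
  have Fw: "F w \<noteq> 0"
  proof
    assume "F w = 0"
    then have "E w = w" by (simp add: F_def)
    then show False using w(2) EX[OF w(1)] by simp
  qed
  obtain e R where e: "e > 0" and RB: "\<And>z. cmod z < e \<Longrightarrow> R z \<in> bounded_ops X"
    and Rn: "\<And>z y. cmod z < e \<Longrightarrow> y \<in> X \<Longrightarrow> norm (R z y) \<le> 2 * norm y"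
    and R1: "\<And>z y. cmod z < e \<Longrightarrow> y \<in> X \<Longrightarrow> R z y = y + z *\<^sub>C S (R z y)"
    and R2: "\<And>z y. cmod z < e \<Longrightarrow> y \<in> X \<Longrightarrow> R z y = y + z *\<^sub>C R z (S y)"
    and RV: "\<And>z y V. cmod z < e \<Longrightarrow> y \<in> X \<Longrightarrow> closed_csubspace V \<Longrightarrow> (\<And>k. (S ^^ k) y \<in> V) \<Longrightarrow> R z y \<in> V"
    by (rule neumann_series[OF X S]) (rule that, blast+)
  define W where "W = (\<Inter>k. (T ^^ k) ` X)"
  have WTX: "W \<subseteq> T ` X"
  proof -
    have "W \<subseteq> (T ^^ 1) ` X" unfolding W_def by blast
    then show ?thesis by simp
  qed
  have WX: "W \<subseteq> X" using WTX T by (auto simp: bounded_ops_mem)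
  have NW: "null_space X T \<subseteq> W" using K by (auto simp: W_def)
  have SW: "S y \<in> W" if y: "y \<in> W" for y
  proof -
    have "S y \<in> (T ^^ k) ` X" for k
    proof -
      have s: "csubspace ((T ^^ k) ` X)" using csubspace_image[OF sX bounded_ops_power[OF T]] by blast
      have "y \<in> (T ^^ Suc k) ` X" using y unfolding W_def by blast
      then obtain u where u: "u \<in> X" "y = T ((T ^^ k) u)" by auto
      have uk: "(T ^^ k) u \<in> X" by (rule bounded_ops_mem[OF bounded_ops_power[OF T] u(1)])
      have Sy: "S y = (T ^^ k) u - P ((T ^^ k) u)" using ST[OF uk] u(2) by simp
      show ?thesis unfolding Sy using u(1) PN[OF uk] K[of k]
        by (intro complex_vector.subspace_diff s) auto
    qed
    then show ?thesis by (simp add: W_def)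
  qed
  have RW: "R z y \<in> T ` X" if "cmod z < e" "y \<in> W" for z y
  proof (rule RV[OF that(1) _ TX])
    have "(S ^^ k) y \<in> W" for k by (induction k) (use that SW in auto)
    then show "(S ^^ k) y \<in> T ` X" for k using WTX by blast
  qed (use WX that in blast)
  have FR: "F (R z (shift T z x)) = 0" if z: "cmod z < e" and x: "x \<in> X" for z x
  proof -
    have Tx: "T x \<in> X" "T x \<in> T ` X" and Px: "P x \<in> W"
      using x T PN[OF x] NW by (auto simp: bounded_ops_mem)
    have PX: "P x \<in> X" using Px WX by blast
    have RX: "R z x \<in> X" "R z (T x) \<in> X" "R z (P x) \<in> X"
      using bounded_ops_mem[OF RB[OF z]] x Tx(1) PX by auto
    have "R z (shift T z x) = R z (T x) - z *\<^sub>C R z x"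
      using bounded_ops_diff[OF RB[OF z] sX Tx(1), of "z *\<^sub>C x"] bounded_ops_scale[OF RB[OF z] x] sX x
      by (simp add: shift_def complex_vector.subspace_scale)
    also have "R z (T x) = T x + z *\<^sub>C R z (S (T x))" by (rule R2[OF z Tx(1)])
    also have "R z (S (T x)) = R z x - R z (P x)"
      unfolding ST[OF x] by (rule bounded_ops_diff[OF RB[OF z] sX x PX])
    finally have "R z (shift T z x) = T x - z *\<^sub>C R z (P x)"
      by (simp add: complex_vector.scale_right_diff_distrib)
    also have "\<dots> \<in> T ` X"
      using TX RW[OF z Px] Tx(2) unfolding closed_csubspace_def
      by (blast intro: complex_vector.subspace_diff complex_vector.subspace_scale)
    finally show ?thesis by (simp add: F_def Eid)
  qed
  have nul: "null_space X (shift T z ^^ n) \<subseteq> shift T z ` X" if z: "cmod z < e" for z n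
  proof (cases "z = 0")
    case True
    then have "shift T z = T" by (simp add: shift_def fun_eq_iff)
    then show ?thesis using Kato_null_power_subset[OF sX T K] by simp
  next
    case False
    show ?thesis
    proof
      fix y assume "y \<in> null_space X (shift T z ^^ n)"
      then have y: "y \<in> W" using null_shift_power_subset[OF sX T False] unfolding W_def by blast
      then have yX: "y \<in> X" using WX by blast
      have RX: "R z y \<in> X" by (rule bounded_ops_mem[OF RB[OF z] yX])
      have "T (S (R z y)) = R z y" using TS[OF RX] Eid[OF RW[OF z y]] by simp
      then have "shift T z (S (R z y)) = y" using R1[OF z yX] by (simp add: shift_def diff_eq_eq)
      then show "y \<in> shift T z ` X" using bounded_ops_mem[OF S RX] by (metis imageI)
    qed
  qed
  show ?thesis by (rule that[OF e FB S w(1) Fw RB Rn R1 R2 FR nul])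
qed

text \<open>
  A Saphar operator that is not onto stays far from being onto under small shifts: the nonzero
  operator \<open>F R\<^sub>z\<close> vanishes on the range of \<open>T - z I\<close>, and adding the null spaces of the powers of
  \<open>T - z I\<close> does not enlarge this range.
\<close>

lemma Saphar_not_onto_near:
  fixes X :: "'a::complex_banach set"
  assumes X: "closed_csubspace X" and T: "T \<in> bounded_ops X"
    and Sa: "Saphar X T" and ns: "T ` X \<noteq> X"
  obtains e where "e > 0" "\<And>z. cmod z < e \<Longrightarrow> \<not> X \<subseteq> closure (shift T z ` X)"
    "\<And>z. cmod z < e \<Longrightarrow> descent X (shift T z) = \<infinity>"
proof -
  have sX: "csubspace X" using X by (auto simp: closed_csubspace_def)
  obtain e F S R w where e: "e > 0" and F: "F \<in> bounded_ops X" and S: "S \<in> bounded_ops X"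
    and w: "w \<in> X" "F w \<noteq> 0"
    and RB: "\<And>z. cmod z < e \<Longrightarrow> R z \<in> bounded_ops X"
    and R2: "\<And>z y. cmod z < e \<Longrightarrow> y \<in> X \<Longrightarrow> R z y = y + z *\<^sub>C R z (S y)"
    and FR: "\<And>z x. cmod z < e \<Longrightarrow> x \<in> X \<Longrightarrow> F (R z (shift T z x)) = 0"
    and nul: "\<And>z n. cmod z < e \<Longrightarrow> null_space X (shift T z ^^ n) \<subseteq> shift T z ` X"
    by (rule Saphar_resolvent[OF assms]) blast
  have nd: "\<not> X \<subseteq> closure (shift T z ` X)" if z: "cmod z < e" for z
  proof
    assume dense: "X \<subseteq> closure (shift T z ` X)"
    have FRB: "(\<lambda>x. F (R z x)) \<in> bounded_ops X" by (rule bounded_ops_compose[OF F RB[OF z]])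
    have "closed (null_space X (\<lambda>x. F (R z x)))"
      using closed_csubspace_null_space[OF X FRB] by (simp add: closed_csubspace_def)
    moreover have "shift T z ` X \<subseteq> null_space X (\<lambda>x. F (R z x))"
      using FR[OF z] bounded_ops_mem[OF bounded_ops_shift[OF sX T]] by (auto simp: null_space_def)
    ultimately have "X \<subseteq> null_space X (\<lambda>x. F (R z x))" using dense closure_minimal by blast
    moreover have "w - z *\<^sub>C S w \<in> X"
      using w(1) S sX by (intro complex_vector.subspace_diff complex_vector.subspace_scale) (auto intro: bounded_ops_mem)
    ultimately have "F (R z (w - z *\<^sub>C S w)) = 0" by (auto simp: null_space_def)
    \<comment> \<open>\<open>w\<close> is in the range of \<open>R z\<close>, so that \<open>F R\<^sub>z\<close> is not zero.\<close>
    moreover have "R z (w - z *\<^sub>C S w) = w"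
    proof -
      have Sw: "S w \<in> X" using S w(1) by (rule bounded_ops_mem)
      have "R z (w - z *\<^sub>C S w) = R z w - z *\<^sub>C R z (S w)"
        using bounded_ops_diff[OF RB[OF z] sX w(1), of "z *\<^sub>C S w"] bounded_ops_scale[OF RB[OF z] Sw] sX Sw
        by (simp add: complex_vector.subspace_scale)
      then show ?thesis using R2[OF z w(1)] by (simp add: diff_eq_eq)
    qed
    ultimately show False using w(2) by simp
  qed
  have "descent X (shift T z) = \<infinity>" if z: "cmod z < e" for z
  proof -
    have s: "csubspace (shift T z ` X)" using csubspace_image[OF sX bounded_ops_shift[OF sX T]] by blast
    have "shift T z ` X + null_space X (shift T z ^^ n) \<subseteq> shift T z ` X" for n
      using nul[OF z, of n] s by (auto simp: set_plus_def intro!: complex_vector.subspace_add)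
    moreover have "\<not> X \<subseteq> shift T z ` X" using nd[OF z] closure_subset by blast
    ultimately have "{n. shift T z ` X + null_space X (shift T z ^^ n) = X} = {}" by blast
    then show ?thesis unfolding descent_def by (simp add: top_enat_def)
  qed
  then show ?thesis using that e nd by blast
qed

section \<open>Finite dimension and finite codimension\<close>

text \<open>
  Both notions are stated in a form that is monotone in \<open>V\<close>; for subspaces they agree with the
  finiteness of \<open>cdim\<close> and \<open>codim\<close>.
\<close>

definition finite_dim :: "'a::complex_normed_vector set \<Rightarrow> bool"
  where "finite_dim V \<longleftrightarrow> (\<exists>F. finite F \<and> V \<subseteq> cspan F)"

definition finite_codim :: "'a::complex_normed_vector set \<Rightarrow> 'a set \<Rightarrow> bool"
  where "finite_codim X V \<longleftrightarrow> (\<exists>F. finite F \<and> F \<subseteq> X \<and> (\<forall>x\<in>X. \<exists>v\<in>V. x - v \<in> cspan F))"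

lemma INF_enat_less_infinity_iff: "(INF x\<in>A. enat (f x)) < \<infinity> \<longleftrightarrow> A \<noteq> {}"
proof
  assume "A \<noteq> {}"
  then obtain a where "a \<in> A" by blast
  then have "(INF x\<in>A. enat (f x)) \<le> enat (f a)" by (rule INF_lower)
  then show "(INF x\<in>A. enat (f x)) < \<infinity>" using enat_ord_simps(4) order_le_less_trans by blast
qed (auto simp: top_enat_def)

lemma finite_dim_basis:
  assumes "finite_dim V" "csubspace V"
  obtains B where "finite B" "complex_vector.independent B" "B \<subseteq> V" "cspan B = V" "card B = complex_vector.dim V"
proof -
  obtain B where B: "B \<subseteq> V" "complex_vector.independent B" "V \<subseteq> cspan B" "card B = complex_vector.dim V"
    using complex_vector.basis_exists by blast
  obtain F where "finite F" "V \<subseteq> cspan F" using assms by (auto simp: finite_dim_def)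
  then have "finite B" using complex_vector.independent_span_bound[OF _ B(2)] B(1) by blast
  moreover have "cspan B = V" using B assms(2) by (intro complex_vector.span_subspace)
  ultimately show ?thesis using that B by blast
qed

lemma cdim_finite_iff:
  assumes "csubspace V"
  shows "cdim V < \<infinity> \<longleftrightarrow> finite_dim V"
proof -
  have "(\<exists>F. finite F \<and> cspan F = V) \<longleftrightarrow> finite_dim V"
    using finite_dim_basis[OF _ assms] unfolding finite_dim_def by (metis order_refl)
  then show ?thesis unfolding cdim_def INF_enat_less_infinity_iff by blast
qed

lemma codim_finite_iff:
  assumes "csubspace X" "V \<subseteq> X"
  shows "codim X V < \<infinity> \<longleftrightarrow> finite_codim X V"
proof -
  have eq: "V + cspan F = X \<longleftrightarrow> (\<forall>x\<in>X. \<exists>v\<in>V. x - v \<in> cspan F)" if F: "F \<subseteq> X" for F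
  proof
    assume X: "V + cspan F = X"
    show "\<forall>x\<in>X. \<exists>v\<in>V. x - v \<in> cspan F"
    proof
      fix x assume "x \<in> X"
      then obtain v w where "v \<in> V" "w \<in> cspan F" "x = v + w" unfolding X[symmetric] by (rule set_plus_elim)
      then show "\<exists>v\<in>V. x - v \<in> cspan F" by (intro bexI[of _ v]) auto
    qed
  next
    assume *: "\<forall>x\<in>X. \<exists>v\<in>V. x - v \<in> cspan F"
    have "cspan F \<subseteq> X" using F assms by (intro complex_vector.span_minimal)
    then have "V + cspan F \<subseteq> X"
      using assms by (auto simp: set_plus_def subset_iff intro: complex_vector.subspace_add)
    moreover have "X \<subseteq> V + cspan F"
    proof
      fix x assume "x \<in> X"
      then obtain v where "v \<in> V" "x - v \<in> cspan F" using * by blast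
      then have "v + (x - v) \<in> V + cspan F" by (rule set_plus_intro)
      then show "x \<in> V + cspan F" by simp
    qed
    ultimately show "V + cspan F = X" by blast
  qed
  have "{F. finite F \<and> F \<subseteq> X \<and> V + cspan F = X} \<noteq> {} \<longleftrightarrow> finite_codim X V"
    unfolding finite_codim_def Collect_empty_eq not_all not_not
    by (rule ex_cong1) (simp add: eq cong: conj_cong)
  then show ?thesis unfolding codim_def INF_enat_less_infinity_iff .
qed

lemma descent_finite_iff: "descent X T < \<infinity> \<longleftrightarrow> (\<exists>n. T ` X + null_space X (T ^^ n) = X)"
  unfolding descent_def INF_enat_less_infinity_iff[of "\<lambda>n. n"] by simp

lemma finite_dim_subset: "finite_dim V \<Longrightarrow> W \<subseteq> V \<Longrightarrow> finite_dim W"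
  unfolding finite_dim_def by (meson order_trans)

lemma finite_dim_closed: "finite_dim V \<Longrightarrow> csubspace V \<Longrightarrow> closed_csubspace V"
  by (metis finite_dim_basis closed_span_finite)

text \<open>
  A projection \<open>P\<close> onto the span of \<open>F\<close> extends to one more vector \<open>x\<close> by adding the rank-one
  operator \<open>y \<mapsto> \<phi> (y - P y) / \<phi> u \<cdot> u\<close> with \<open>u = x - P x\<close> and a functional \<open>\<phi>\<close> that does not vanish at \<open>u\<close>.
\<close>

lemma projection_onto_span_finite:
  assumes "finite F"
  shows "\<exists>P. projection_onto UNIV (cspan F) P"
  using assms
proof (induction F)
  case empty
  have "projection_onto UNIV {0} (\<lambda>x::'a. 0)"
    unfolding projection_onto_def by (auto intro!: bounded_opsI[where K = 0])
  then show ?case by auto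
next
  case (insert x F)
  then obtain P where "projection_onto UNIV (cspan F) P" by blast
  then have PB: "P \<in> bounded_ops UNIV" and PF: "\<And>y. P y \<in> cspan F" and Pid: "\<And>y. y \<in> cspan F \<Longrightarrow> P y = y"
    by (auto simp: projection_onto_def)
  define u where "u = x - P x"
  show ?case
  proof (cases "u = 0")
    case True
    then have "x \<in> cspan F" using PF[of x] by (simp add: u_def)
    then show ?thesis using \<open>projection_onto UNIV (cspan F) P\<close> complex_vector.span_redundant by metis
  next
    case False
    then obtain \<phi> :: "'a \<Rightarrow> complex" where \<phi>: "bounded_linear \<phi>" "\<And>c x. \<phi> (c *\<^sub>C x) = c * \<phi> x" "\<phi> u \<noteq> 0"
      using separating_functional by blast
    define a where "a y = \<phi> (y - P y) / \<phi> u" for y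
    have "projection_onto UNIV (cspan (insert x F)) (\<lambda>y. P y + a y *\<^sub>C u)"
      unfolding projection_onto_def
    proof (intro conjI ballI)
      obtain K where K: "\<And>y. cmod (\<phi> y) \<le> norm y * K" using bounded_linear.bounded[OF \<phi>(1)] by blast
      obtain L where L: "L > 0" "\<And>y. norm (y - P y) \<le> L * norm y"
        using bounded_ops_bound[OF bounded_ops_minus[OF _ bounded_ops_id PB]] by auto
      have "(\<lambda>y. a y *\<^sub>C u) \<in> bounded_ops UNIV"
      proof (rule bounded_opsI[where K = "L * \<bar>K\<bar> / cmod (\<phi> u) * norm u"])
        show "a (y1 + y2) *\<^sub>C u = a y1 *\<^sub>C u + a y2 *\<^sub>C u" for y1 y2
          using bounded_ops_add[OF PB, of y1 y2] linear_add[OF bounded_linear.linear[OF \<phi>(1)], of "y1 - P y1" "y2 - P y2"]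
          by (simp add: a_def scaleC_add_left[symmetric] add_divide_distrib[symmetric] algebra_simps)
        show "a (c *\<^sub>C y) *\<^sub>C u = c *\<^sub>C a y *\<^sub>C u" for c y
          using bounded_ops_scale[OF PB, of y c] \<phi>(2)[of c "y - P y"]
          by (simp add: a_def complex_vector.scale_right_diff_distrib)
        show "norm (a y *\<^sub>C u) \<le> L * \<bar>K\<bar> / cmod (\<phi> u) * norm u * norm y" for y
        proof -
          have "cmod (\<phi> (y - P y)) \<le> norm (y - P y) * K" by (rule K)
          also have "\<dots> \<le> norm (y - P y) * \<bar>K\<bar>" by (intro mult_left_mono) auto
          also have "\<dots> \<le> (L * norm y) * \<bar>K\<bar>" by (intro mult_right_mono L) auto
          finally have "cmod (a y) \<le> (L * norm y) * \<bar>K\<bar> / cmod (\<phi> u)"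
            by (simp add: a_def norm_divide divide_right_mono)
          then show ?thesis
            using mult_right_mono[of "cmod (a y)" "(L * norm y) * \<bar>K\<bar> / cmod (\<phi> u)" "norm u"]
            by (simp add: norm_scaleC mult_ac)
        qed
      qed auto
      then show "(\<lambda>y. P y + a y *\<^sub>C u) \<in> bounded_ops UNIV" by (intro bounded_ops_plus PB) auto
      have Fx: "cspan F \<subseteq> cspan (insert x F)" by (rule complex_vector.span_mono) blast
      have ux: "u \<in> cspan (insert x F)"
        unfolding u_def using PF Fx by (intro complex_vector.span_diff) (auto intro: complex_vector.span_base)
      then show "range (\<lambda>y. P y + a y *\<^sub>C u) \<subseteq> cspan (insert x F)"
        using PF Fx by (auto intro!: complex_vector.span_add complex_vector.span_scale)
      fix v assume "v \<in> cspan (insert x F)"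
      then obtain k where k: "v - k *\<^sub>C x \<in> cspan F" by (auto simp: complex_vector.span_breakdown_eq)
      have "v - P v = k *\<^sub>C u"
        using Pid[OF k] bounded_ops_diff[OF PB, of v "k *\<^sub>C x"] bounded_ops_scale[OF PB, of x k]
        by (simp add: u_def complex_vector.scale_right_diff_distrib algebra_simps)
      moreover from this have "a v = k" using \<phi> by (simp add: a_def)
      ultimately show "P v + a v *\<^sub>C u = v" by (metis add.commute diff_add_cancel)
    qed auto
    then show ?thesis by blast
  qed
qed

lemma finite_dim_complemented:
  fixes X :: "'a::complex_banach set"
  assumes X: "closed_csubspace X" and V: "csubspace V" "finite_dim V" "V \<subseteq> X"
  shows "complemented X V"
proof -
  obtain B where "finite B" "cspan B = V" using finite_dim_basis[OF V(2,1)] by metis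
  then obtain P where P: "projection_onto UNIV V P" using projection_onto_span_finite by blast
  then have "projection_onto X V P"
    using V(3) by (auto simp: projection_onto_def intro!: bounded_ops_subset[of P UNIV X])
  then show ?thesis using complemented_iff_projection[OF X] by blast
qed

lemma finite_codim_complement:
  assumes sX: "csubspace X" and V: "csubspace V" "V \<subseteq> X" and "finite_codim X V"
  obtains W where "csubspace W" "finite_dim W" "W \<subseteq> X" "direct_sum X V W"
proof -
  obtain F where F: "finite F" "F \<subseteq> X" "\<And>x. x \<in> X \<Longrightarrow> \<exists>v\<in>V. x - v \<in> cspan F"
    using assms by (auto simp: finite_codim_def)
  have "\<exists>G\<subseteq>F. V \<inter> cspan G = {0} \<and> cspan (V \<union> F) = cspan (V \<union> G)"
    using F(1)
  proof (induction F)
    case empty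
    then show ?case using complex_vector.subspace_0[OF V(1)] by auto
  next
    case (insert x F)
    then obtain G where G: "G \<subseteq> F" "V \<inter> cspan G = {0}" "cspan (V \<union> F) = cspan (V \<union> G)" by blast
    have eq: "cspan (V \<union> insert x F) = cspan (insert x (V \<union> G))"
      using G(3) by (simp add: complex_vector.span_insert)
    show ?case
    proof (cases "x \<in> cspan (V \<union> G)")
      case True
      then show ?thesis using G eq complex_vector.span_redundant[OF True] by (metis subset_insertI2)
    next
      case False
      have "V \<inter> cspan (insert x G) \<subseteq> {0}"
      proof
        fix v assume v: "v \<in> V \<inter> cspan (insert x G)"
        then obtain k where k: "v - k *\<^sub>C x \<in> cspan G" by (auto simp: complex_vector.span_breakdown_eq)
        have "k = 0"
        proof (rule ccontr)
          assume "k \<noteq> 0"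
          have "v \<in> cspan (V \<union> G)" "v - k *\<^sub>C x \<in> cspan (V \<union> G)"
            using v k complex_vector.span_mono[of G "V \<union> G"] by (auto intro: complex_vector.span_base)
          then have "inverse k *\<^sub>C (v - (v - k *\<^sub>C x)) \<in> cspan (V \<union> G)"
            by (rule complex_vector.span_scale[OF complex_vector.span_diff])
          moreover have "inverse k *\<^sub>C (v - (v - k *\<^sub>C x)) = x" using \<open>k \<noteq> 0\<close> by (simp del: complex_vector.scale_right_diff_distrib)
          ultimately show False using False by simp
        qed
        then show "v \<in> {0}" using k v G(2) by auto
      qed
      then have "V \<inter> cspan (insert x G) = {0}"
        using complex_vector.subspace_0[OF V(1)] complex_vector.span_zero by blast
      then show ?thesis using G(1) eq by (intro exI[of _ "insert x G"]) auto
    qed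
  qed
  then obtain G where G: "G \<subseteq> F" "V \<inter> cspan G = {0}" "cspan (V \<union> F) = cspan (V \<union> G)" by blast
  have "finite G" using G(1) F(1) by (rule finite_subset)
  have GX: "cspan G \<subseteq> X" using G(1) F(2) sX by (intro complex_vector.span_minimal) auto
  have "V + cspan G = X"
  proof
    show "V + cspan G \<subseteq> X"
      using V(2) GX sX by (auto simp: set_plus_def subset_iff intro: complex_vector.subspace_add)
    show "X \<subseteq> V + cspan G"
    proof
      fix x assume "x \<in> X"
      then obtain v where "v \<in> V" "x - v \<in> cspan F" using F(3) by blast
      then have "v + (x - v) \<in> V + cspan F" by (rule set_plus_intro)
      then show "x \<in> V + cspan G"
        using G(3) span_Un_eq_sum[OF V(1)] by simp
    qed
  qed
  then show ?thesis
    using that[of "cspan G"] \<open>finite G\<close> G(2) GX by (auto simp: direct_sum_def finite_dim_def)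
qed

text \<open>
  Let \<open>W\<close> be a finite-dimensional complement of the range.  The map \<open>(x, w) \<mapsto> T x + w\<close> is open, which
  bounds the \<open>W\<close>-component of \<open>l\<close> by the distance from \<open>l\<close> to any point of the range.
\<close>

lemma closed_range_finite_codim:
  fixes X :: "'a::complex_banach set"
  assumes X: "closed_csubspace X" and T: "T \<in> bounded_ops X" and "finite_codim X (T ` X)"
  shows "closed_csubspace (T ` X)"
proof -
  have sX: "csubspace X" "closed X" using X by (auto simp: closed_csubspace_def)
  have sTX: "csubspace (T ` X)" "T ` X \<subseteq> X"
    using csubspace_image[OF sX(1) T] T by (auto simp: bounded_ops_mem)
  obtain W where W: "csubspace W" "finite_dim W" "W \<subseteq> X" "direct_sum X (T ` X) W"
    using finite_codim_complement[OF sX(1) sTX assms(3)] by blast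
  have cW: "closed W" using finite_dim_closed[OF W(2,1)] by (simp add: closed_csubspace_def)
  have sum: "T ` X + W = X" and int: "T ` X \<inter> W = {0}" using W(4) by (auto simp: direct_sum_def)
  obtain K where K: "K > 0" "\<And>x. x \<in> X \<Longrightarrow> norm (T x) \<le> K * norm x" using bounded_ops_bound[OF T] by blast
  obtain C where C: "C > 0"
    "\<And>y. y \<in> X \<Longrightarrow> \<exists>u\<in>X \<times> W. T (fst u) + snd u = y \<and> norm u \<le> C * norm y"
  proof (rule open_mapping_on_closed_subspaces[where U = "X \<times> W" and V = X and K = "K + 1"
        and T = "\<lambda>u. T (fst u) + snd u"])
    show "closed (X \<times> W)" "subspace (X \<times> W)" "closed X" "subspace X"
      using sX W cW by (auto simp: closed_Times intro: subspace_Times csubspace_imp_subspace)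
    show "(\<lambda>u. T (fst u) + snd u) ` (X \<times> W) = X"
      using sum by (force simp: set_plus_def)
    show "norm (T (fst u) + snd u) \<le> norm u * (K + 1)" if "u \<in> X \<times> W" for u
    proof -
      have "norm (T (fst u) + snd u) \<le> norm (T (fst u)) + norm (snd u)" by (rule norm_triangle_ineq)
      also have "\<dots> \<le> K * norm (fst u) + norm (snd u)" using K(2)[of "fst u"] that by auto
      also have "\<dots> \<le> K * norm u + norm u"
        using K(1) norm_fst_le[of "fst u" "snd u"] norm_snd_le[of "snd u" "fst u"]
        by (intro add_mono mult_left_mono) auto
      finally show ?thesis by (simp add: algebra_simps)
    qed
  qed (use T in \<open>auto simp: bounded_ops_add bounded_ops_scale scaleR_scaleC scaleC_add_right\<close>)
  have "closed (T ` X)"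
    unfolding closed_sequential_limits
  proof (intro allI impI, elim conjE)
    fix y l assume y: "\<forall>n. y n \<in> T ` X" and lim: "y \<longlonglongrightarrow> l"
    have "l \<in> X" using closed_sequentially[OF sX(2) _ lim] y sTX(2) by blast
    then obtain v g where vg: "v \<in> T ` X" "g \<in> W" "l = v + g"
      using sum by (metis set_plus_elim)
    have bound: "norm g \<le> C * norm (l - y n)" for n
    proof -
      have "l - y n \<in> X" using \<open>l \<in> X\<close> y sTX(2) sX(1) by (auto intro: complex_vector.subspace_diff)
      then obtain x h where u: "x \<in> X" "h \<in> W" "T x + h = l - y n" "norm (x, h) \<le> C * norm (l - y n)"
        using C(2) by force
      have "g - h = T x - (v - y n)" using u(3) vg(3) by (simp add: algebra_simps)
      moreover have "T x - (v - y n) \<in> T ` X"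
        using u(1) vg(1) y sTX(1) by (intro complex_vector.subspace_diff) auto
      moreover have "g - h \<in> W" using vg(2) u(2) W(1) by (intro complex_vector.subspace_diff)
      ultimately have "g - h \<in> T ` X \<inter> W" by simp
      then have "g = h" using int by simp
      then show ?thesis using u(4) norm_snd_le[of h x] by simp
    qed
    have "(\<lambda>n. C * norm (l - y n)) \<longlonglongrightarrow> C * norm (l - l)"
      by (intro tendsto_intros lim)
    then have "norm g \<le> 0" using bound by (intro Lim_bounded2[where f = "\<lambda>n. C * norm (l - y n)"]) auto
    then show "l \<in> T ` X" using vg by simp
  qed
  then show ?thesis using sTX by (simp add: closed_csubspace_def)
qed

lemma finite_codim_closed_complemented:
  assumes sX: "csubspace X" and V: "closed_csubspace V" "V \<subseteq> X" and "finite_codim X V"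
  shows "complemented X V"
proof -
  obtain W where "csubspace W" "finite_dim W" "W \<subseteq> X" "direct_sum X V W"
    using finite_codim_complement[OF sX _ V(2) assms(4)] V(1) by (auto simp: closed_csubspace_def)
  then show ?thesis using V(1) finite_dim_closed by (auto simp: complemented_def)
qed

lemma image_span_subset:
  assumes "csubspace X" "T \<in> bounded_ops X" "F \<subseteq> X" "x \<in> cspan F"
  shows "T x \<in> cspan (T ` F)"
proof -
  have "x \<in> X \<and> T x \<in> cspan (T ` F)"
    using assms(4)
  proof (induction x rule: complex_vector.span_induct_alt)
    case base
    then show ?case using assms by (auto simp: bounded_ops_zero complex_vector.subspace_0 complex_vector.span_zero)
  next
    case (step c a y)
    then have a: "a \<in> X" "T a \<in> cspan (T ` F)" using assms(3) by (auto intro: complex_vector.span_base)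
    have ca: "c *\<^sub>C a \<in> X" using assms(1) a(1) by (rule complex_vector.subspace_scale)
    have "T (c *\<^sub>C a + y) = c *\<^sub>C T a + T y"
      using bounded_ops_add[OF assms(2) ca, of y] bounded_ops_scale[OF assms(2) a(1)] step by simp
    then show ?case
      using step a(2) complex_vector.subspace_add[OF assms(1) ca]
      by (simp add: complex_vector.span_add complex_vector.span_scale)
  qed
  then show ?thesis ..
qed

text \<open>
  If \<open>X = T X + span F\<close> and \<open>X = T\<^sup>n X + span G\<close>, then \<open>X = T\<^sup>n\<^sup>+\<^sup>1 X + span (T\<^sup>n F) + span G\<close>.
\<close>

lemma finite_codim_range_power:
  assumes sX: "csubspace X" and T: "T \<in> bounded_ops X" and "finite_codim X (T ` X)"
  shows "finite_codim X ((T ^^ n) ` X)"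
proof (induction n)
  case 0
  then show ?case unfolding finite_codim_def by (intro exI[of _ "{}"]) auto
next
  case (Suc n)
  have Tn: "(T ^^ n) \<in> bounded_ops X" using T by (rule bounded_ops_power)
  obtain F where F: "finite F" "F \<subseteq> X" "\<And>x. x \<in> X \<Longrightarrow> \<exists>v\<in>T ` X. x - v \<in> cspan F"
    using assms(3) by (auto simp: finite_codim_def)
  obtain G where G: "finite G" "G \<subseteq> X" "\<And>x. x \<in> X \<Longrightarrow> \<exists>v\<in>(T ^^ n) ` X. x - v \<in> cspan G"
    using Suc by (auto simp: finite_codim_def)
  have "\<exists>v\<in>(T ^^ Suc n) ` X. x - v \<in> cspan (G \<union> (T ^^ n) ` F)" if x: "x \<in> X" for x
  proof -
    obtain u where u: "u \<in> X" "x - (T ^^ n) u \<in> cspan G" using G(3)[OF x] by blast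
    obtain w where w: "w \<in> X" "u - T w \<in> cspan F" using F(3)[OF u(1)] by blast
    have "(T ^^ n) (u - T w) \<in> cspan ((T ^^ n) ` F)" by (rule image_span_subset[OF sX Tn F(2) w(2)])
    moreover have "(T ^^ n) (u - T w) = (T ^^ n) u - (T ^^ Suc n) w"
      using bounded_ops_diff[OF Tn sX u(1) bounded_ops_mem[OF T w(1)]] by (simp add: funpow_swap1)
    ultimately have "(x - (T ^^ n) u) + ((T ^^ n) u - (T ^^ Suc n) w) \<in> cspan (G \<union> (T ^^ n) ` F)"
      using u(2) complex_vector.span_mono[of G "G \<union> (T ^^ n) ` F"] complex_vector.span_mono[of "(T ^^ n) ` F" "G \<union> (T ^^ n) ` F"]
      by (intro complex_vector.span_add) auto
    then show ?thesis using w(1) by (intro bexI[of _ "(T ^^ Suc n) w"]) auto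
  qed
  then show ?case
    unfolding finite_codim_def using F G bounded_ops_mem[OF Tn]
    by (intro exI[of _ "G \<union> (T ^^ n) ` F"]) auto
qed

lemma span_exchange:
  assumes "finite H" "x \<in> cspan (A \<union> H)" "x \<notin> cspan A"
  shows "\<exists>h\<in>H. h \<in> cspan (insert x (A \<union> (H - {h})))"
  using assms
proof (induction H)
  case (insert a H)
  show ?case
  proof (cases "x \<in> cspan (A \<union> H)")
    case True
    then obtain h where h: "h \<in> H" "h \<in> cspan (insert x (A \<union> (H - {h})))" using insert by blast
    have "cspan (insert x (A \<union> (H - {h}))) \<subseteq> cspan (insert x (A \<union> (insert a H - {h})))"
      by (rule complex_vector.span_mono) blast
    then show ?thesis using h by blast
  next
    case False
    have "a \<in> cspan (insert x (A \<union> H))"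
      using insert.prems(1) by (intro complex_vector.in_span_insert[OF _ False]) simp
    then show ?thesis using insert.hyps(2) by (intro bexI[of _ a]) auto
  qed
qed simp

section \<open>Splitting off a nilpotent part\<close>

text \<open>
  An operator that is onto on \<open>M\<close> and nilpotent modulo \<open>M\<close> has an invariant complement of \<open>M\<close>.  It is
  built one vector at a time.  As long as \<open>M + N\<close> is not everything, nilpotency modulo \<open>M\<close> gives a vector
  \<open>x\<close> outside \<open>M + N\<close> with \<open>T x = m + n\<close>; writing \<open>m = T m0\<close> one can replace \<open>x\<close> by \<open>y = x - m0\<close>, for which
  \<open>T y = n\<close>, so that \<open>N\<close> may be enlarged by \<open>y\<close>.  By the exchange lemma each step lowers the number of
  vectors that are needed to span \<open>X\<close> modulo \<open>M + N\<close>.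
\<close>

lemma nilpotent_complement:
  assumes sX: "csubspace X" and T: "T \<in> bounded_ops X"
    and M: "csubspace M" "M \<subseteq> X" "T ` M = M" "(T ^^ d) ` X \<subseteq> M" and fc: "finite_codim X M"
  obtains N where "csubspace N" "N \<subseteq> X" "finite_dim N" "T ` N \<subseteq> N" "direct_sum X M N"
proof -
  define ok where "ok N \<longleftrightarrow> csubspace N \<and> N \<subseteq> X \<and> finite_dim N \<and> T ` N \<subseteq> N \<and> M \<inter> N = {0}" for N
  have "\<exists>N. ok N \<and> M + N = X" if "ok N" "finite H" "X \<subseteq> cspan (M \<union> N \<union> H)" for N H
    using that
  proof (induction "card H" arbitrary: N H rule: less_induct)
    case less
    have N: "csubspace N" "N \<subseteq> X" "finite_dim N" "T ` N \<subseteq> N" "M \<inter> N = {0}"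
      using less.prems(1) by (auto simp: ok_def)
    have MN: "cspan (M \<union> N) = M + N"
      using span_Un_eq_sum[OF M(1), of N] N(1) by (simp add: complex_vector.span_eq_iff[THEN iffD2])
    have MNX: "M + N \<subseteq> X"
      using M(2) N(2) sX by (auto simp: set_plus_def subset_iff intro: complex_vector.subspace_add)
    have sMN: "csubspace (M + N)" unfolding MN[symmetric] by simp
    show ?case
    proof (cases "M + N = X")
      case False
      then obtain u where u: "u \<in> X" "u \<notin> M + N" using MNX by blast
      \<comment> \<open>The last vector of the orbit of \<open>u\<close> before it enters \<open>M + N\<close>.\<close>
      define j where "j = (LEAST j. (T ^^ j) u \<in> M + N)"
      have "(T ^^ d) u \<in> M + N"
        using M(4) u(1) complex_vector.subspace_0[OF N(1)] by (force simp: set_plus_def)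
      then have j: "(T ^^ j) u \<in> M + N" unfolding j_def by (rule LeastI)
      then have "j \<noteq> 0" using u(2) by (intro notI) simp
      then obtain i where i: "j = Suc i" using not0_implies_Suc by blast
      define x where "x = (T ^^ i) u"
      have x: "x \<in> X" "x \<notin> M + N" "T x \<in> M + N"
        using bounded_ops_mem[OF bounded_ops_power[OF T] u(1)] j not_less_Least[of i "\<lambda>j. (T ^^ j) u \<in> M + N"]
        by (auto simp: x_def i j_def[symmetric])
      obtain m n where mn: "m \<in> M" "n \<in> N" "T x = m + n" using x(3) by (auto simp: set_plus_def)
      obtain m0 where m0: "m0 \<in> M" "m = T m0" using M(3) mn(1) by blast
      define y where "y = x - m0"
      have yX: "y \<in> X" unfolding y_def using x(1) m0(1) M(2) sX by (auto intro: complex_vector.subspace_diff)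
      have Ty: "T y = n"
        using bounded_ops_diff[OF T sX x(1), of m0] m0 M(2) mn(3) by (auto simp: y_def)
      have m0': "m0 \<in> M + N" using m0(1) complex_vector.subspace_0[OF N(1)] by (force simp: set_plus_def)
      have yMN: "y \<notin> M + N"
        using complex_vector.subspace_add[OF sMN _ m0', of y] x(2) by (auto simp: y_def)
      define N' where "N' = cspan (insert y N)"
      have N'eq: "v \<in> N' \<longleftrightarrow> (\<exists>k. v - k *\<^sub>C y \<in> N)" for v
        using N(1) by (simp add: N'_def complex_vector.span_breakdown_eq complex_vector.span_eq_iff[THEN iffD2])
      have "ok N'"
        unfolding ok_def
      proof (intro conjI)
        show "csubspace N'" by (simp add: N'_def)
        show "N' \<subseteq> X" unfolding N'_def using yX N(2) sX by (intro complex_vector.span_minimal) auto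
        obtain F where F: "finite F" "N \<subseteq> cspan F" using N(3) by (auto simp: finite_dim_def)
        have "N' \<subseteq> cspan (insert y F)"
          unfolding N'_def using F(2) complex_vector.span_mono[of F "insert y F"]
          by (intro complex_vector.span_minimal) (auto intro: complex_vector.span_base)
        then show "finite_dim N'" using F(1) unfolding finite_dim_def by blast
        show "T ` N' \<subseteq> N'"
        proof
          fix t assume "t \<in> T ` N'"
          then obtain v k where v: "t = T v" "v - k *\<^sub>C y \<in> N" using N'eq by blast
          have ky: "k *\<^sub>C y \<in> X" using sX yX by (rule complex_vector.subspace_scale)
          have "T ((v - k *\<^sub>C y) + k *\<^sub>C y) = T (v - k *\<^sub>C y) + k *\<^sub>C n"
            using bounded_ops_add[OF T _ ky, of "v - k *\<^sub>C y"] v(2) N(2) bounded_ops_scale[OF T yX] Ty by auto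
          then have "t = T (v - k *\<^sub>C y) + k *\<^sub>C n" using v(1) by simp
          also have "\<dots> \<in> N"
            using v(2) N(1,4) mn(2) by (intro complex_vector.subspace_add complex_vector.subspace_scale) auto
          finally show "t \<in> N'" unfolding N'_def by (intro complex_vector.span_base) simp
        qed
        have "v = 0" if v: "v \<in> M" "v \<in> N'" for v
        proof -
          obtain k where k: "v - k *\<^sub>C y \<in> N" using v(2) N'eq by blast
          have "k = 0"
          proof (rule ccontr)
            assume "k \<noteq> 0"
            have "v \<in> M + N" "v - k *\<^sub>C y \<in> M + N"
              unfolding MN[symmetric] using v(1) k by (auto intro: complex_vector.span_base)
            then have "inverse k *\<^sub>C (v - (v - k *\<^sub>C y)) \<in> M + N"
              by (rule complex_vector.subspace_scale[OF sMN complex_vector.subspace_diff[OF sMN]])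
            moreover have "inverse k *\<^sub>C (v - (v - k *\<^sub>C y)) = y" using \<open>k \<noteq> 0\<close> by (simp del: complex_vector.scale_right_diff_distrib)
            ultimately show False using yMN by simp
          qed
          then show "v = 0" using k v(1) N(5) by auto
        qed
        then show "M \<inter> N' = {0}"
          using complex_vector.subspace_0[OF M(1)] by (auto simp: N'_def complex_vector.span_zero)
      qed
      obtain h where h: "h \<in> H" "h \<in> cspan (insert y ((M \<union> N) \<union> (H - {h})))"
        using span_exchange[OF less.prems(2), of y "M \<union> N"] yX less.prems(3) yMN unfolding MN by blast
      have "X \<subseteq> cspan (M \<union> N' \<union> (H - {h}))"
      proof -
        have "insert y ((M \<union> N) \<union> (H - {h})) \<subseteq> cspan (M \<union> N' \<union> (H - {h}))"
          by (auto simp: N'_def intro!: complex_vector.span_base)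
        then have 1: "cspan (insert y ((M \<union> N) \<union> (H - {h}))) \<subseteq> cspan (M \<union> N' \<union> (H - {h}))"
          by (intro complex_vector.span_minimal) auto
        have "M \<union> N \<union> H \<subseteq> cspan (insert y ((M \<union> N) \<union> (H - {h})))"
          using h(2) by (auto intro: complex_vector.span_base)
        then have "cspan (M \<union> N \<union> H) \<subseteq> cspan (insert y ((M \<union> N) \<union> (H - {h})))"
          by (intro complex_vector.span_minimal) auto
        then show ?thesis using 1 less.prems(3) by blast
      qed
      moreover have "card (H - {h}) < card H"
        using h(1) less.prems(2) by (intro card_Diff1_less)
      ultimately show ?thesis
        using less.hyps[of "H - {h}" N'] less.prems(2) \<open>ok N'\<close> by blast
    qed (use less.prems in blast)
  qed
  moreover have "ok {0}"
    using sX T M(1) unfolding ok_def finite_dim_def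
    by (auto simp: bounded_ops_zero complex_vector.subspace_0 intro!: exI[of _ "{}"])
  moreover obtain F where F: "finite F" "F \<subseteq> X" "\<And>x. x \<in> X \<Longrightarrow> \<exists>v\<in>M. x - v \<in> cspan F"
    using fc by (auto simp: finite_codim_def)
  moreover have "X \<subseteq> cspan (M \<union> {0} \<union> F)"
  proof
    fix x assume "x \<in> X"
    then obtain v where v: "v \<in> M" "x - v \<in> cspan F" using F(3) by blast
    have "v \<in> cspan (M \<union> {0} \<union> F)" "x - v \<in> cspan (M \<union> {0} \<union> F)"
      using v complex_vector.span_mono[of F "M \<union> {0} \<union> F"] by (auto intro: complex_vector.span_base)
    then have "v + (x - v) \<in> cspan (M \<union> {0} \<union> F)" by (rule complex_vector.span_add)
    then show "x \<in> cspan (M \<union> {0} \<union> F)" by simp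
  qed
  ultimately obtain N where "ok N" "M + N = X" by blast
  then show ?thesis using that by (auto simp: ok_def direct_sum_def)
qed

section \<open>Right Browder and Riesz operators\<close>

text \<open>
  This form of the descent condition mentions only values of \<open>T\<close>, which makes it easy to transport
  along projections that commute with \<open>T\<close>.
\<close>

lemma descent_finite_iff_preimage:
  assumes sX: "csubspace X" and T: "T \<in> bounded_ops X"
  shows "descent X T < \<infinity> \<longleftrightarrow> (\<exists>n. \<forall>x\<in>X. \<exists>u\<in>X. (T ^^ n) (x - T u) = 0)"
proof -
  have "T ` X + null_space X (T ^^ n) = X \<longleftrightarrow> (\<forall>x\<in>X. \<exists>u\<in>X. (T ^^ n) (x - T u) = 0)" for n
  proof
    assume eq: "T ` X + null_space X (T ^^ n) = X"
    show "\<forall>x\<in>X. \<exists>u\<in>X. (T ^^ n) (x - T u) = 0"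
    proof
      fix x assume "x \<in> X"
      then have "x \<in> T ` X + null_space X (T ^^ n)" using eq by simp
      then obtain u v where "u \<in> X" "v \<in> null_space X (T ^^ n)" "x = T u + v" by (auto simp: set_plus_def)
      then show "\<exists>u\<in>X. (T ^^ n) (x - T u) = 0" by (intro bexI[of _ u]) (auto simp: null_space_def)
    qed
  next
    assume *: "\<forall>x\<in>X. \<exists>u\<in>X. (T ^^ n) (x - T u) = 0"
    have "T ` X + null_space X (T ^^ n) \<subseteq> X"
      using T sX by (auto simp: set_plus_def null_space_def bounded_ops_mem intro: complex_vector.subspace_add)
    moreover have "X \<subseteq> T ` X + null_space X (T ^^ n)"
    proof
      fix x assume x: "x \<in> X"
      then obtain u where u: "u \<in> X" "(T ^^ n) (x - T u) = 0" using * by blast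
      have "x - T u \<in> null_space X (T ^^ n)"
        using u x bounded_ops_mem[OF T u(1)] sX by (simp add: null_space_def complex_vector.subspace_diff)
      then have "T u + (x - T u) \<in> T ` X + null_space X (T ^^ n)" using u(1) by (intro set_plus_intro) auto
      then show "x \<in> T ` X + null_space X (T ^^ n)" by simp
    qed
    ultimately show "T ` X + null_space X (T ^^ n) = X" by blast
  qed
  then show ?thesis unfolding descent_finite_iff by simp
qed

lemma right_Browder_iff:
  assumes sX: "csubspace X" and T: "T \<in> bounded_ops X"
  shows "right_Browder X T \<longleftrightarrow> finite_codim X (T ` X)
    \<and> (\<exists>n. \<forall>x\<in>X. \<exists>u\<in>X. (T ^^ n) (x - T u) = 0) \<and> complemented X (null_space X T)"
  unfolding right_Browder_def descent_finite_iff_preimage[OF assms]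
  using codim_finite_iff[OF sX, of "T ` X"] T by (simp add: bounded_ops_mem image_subset_iff)

lemma Riesz_iff:
  assumes X: "closed_csubspace X" and T: "T \<in> bounded_ops X"
  shows "Riesz X T \<longleftrightarrow>
    (\<forall>z. z \<noteq> 0 \<longrightarrow> finite_dim (null_space X (shift T z)) \<and> finite_codim X (shift T z ` X))"
proof -
  have sX: "csubspace X" using X by (simp add: closed_csubspace_def)
  have "csubspace (null_space X (shift T z))" "shift T z ` X \<subseteq> X" for z
    using closed_csubspace_null_space[OF X bounded_ops_shift[OF sX T]] bounded_ops_shift[OF sX T, of z]
    by (auto simp: closed_csubspace_def bounded_ops_mem)
  then show ?thesis
    unfolding Riesz_def by (simp only: cdim_finite_iff codim_finite_iff[OF sX])
qed

lemma finite_codim_self: "finite_codim X X"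
  unfolding finite_codim_def by (intro exI[of _ "{}"]) auto

lemma finite_dim_imp_Riesz:
  assumes X: "closed_csubspace X" and T: "T \<in> bounded_ops X" and fd: "finite_dim X"
  shows "Riesz X T"
  unfolding Riesz_iff[OF X T]
proof (intro allI impI conjI)
  fix z :: complex
  have sX: "csubspace X" using X by (simp add: closed_csubspace_def)
  show "finite_dim (null_space X (shift T z))"
    by (rule finite_dim_subset[OF fd]) (auto simp: null_space_def)
  obtain B where B: "finite B" "B \<subseteq> X" "cspan B = X" using finite_dim_basis[OF fd sX] by metis
  have "shift T z 0 = 0" "0 \<in> X"
    using bounded_ops_zero[OF bounded_ops_shift[OF sX T] sX] complex_vector.subspace_0[OF sX] by auto
  then have "0 \<in> shift T z ` X" by force
  then show "finite_codim X (shift T z ` X)"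
    unfolding finite_codim_def using B by (intro exI[of _ B] conjI ballI bexI[of _ 0]) auto
qed

lemma funpow_cong_on:
  assumes "T \<in> bounded_ops X" "\<And>x. x \<in> X \<Longrightarrow> T x = S x" "x \<in> X"
  shows "(T ^^ n) x = (S ^^ n) x"
proof (induction n)
  case (Suc n)
  have "(T ^^ n) x \<in> X" by (rule bounded_ops_mem[OF bounded_ops_power[OF assms(1)] assms(3)])
  then show ?case using Suc assms(2)[of "(T ^^ n) x"] by simp
qed simp

lemma null_space_cong: "(\<And>x. x \<in> X \<Longrightarrow> T x = S x) \<Longrightarrow> null_space X T = null_space X S"
  by (auto simp: null_space_def)

lemma right_Browder_cong:
  assumes "T \<in> bounded_ops X" "\<And>x. x \<in> X \<Longrightarrow> T x = S x"
  shows "right_Browder X T \<longleftrightarrow> right_Browder X S"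
proof -
  have "T ` X = S ` X" using assms(2) by (rule image_cong[OF refl])
  moreover have "null_space X (T ^^ n) = null_space X (S ^^ n)" for n
    using funpow_cong_on[OF assms] by (rule null_space_cong)
  moreover have "null_space X T = null_space X S" using assms(2) by (rule null_space_cong)
  ultimately show ?thesis by (simp add: right_Browder_def descent_def)
qed

lemma Riesz_cong:
  assumes "\<And>x. x \<in> X \<Longrightarrow> T x = S x"
  shows "Riesz X T \<longleftrightarrow> Riesz X S"
proof -
  have "shift T z ` X = shift S z ` X" "null_space X (shift T z) = null_space X (shift S z)" for z
    using assms by (auto simp: shift_def null_space_def)
  then show ?thesis by (simp add: Riesz_def)
qed

lemma right_invertible_imp_right_Browder:
  fixes X :: "'a::complex_banach set"
  assumes X: "closed_csubspace X" and T: "T \<in> bounded_ops X" and "right_invertible X T"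
  shows "right_Browder X T"
proof -
  have sX: "csubspace X" using X by (simp add: closed_csubspace_def)
  have TX: "T ` X = X" "complemented X (null_space X T)"
    using right_invertible_iff[OF X T] assms by auto
  have "\<forall>x\<in>X. \<exists>u\<in>X. (T ^^ 0) (x - T u) = 0" using TX(1) by force
  then have "\<exists>n. \<forall>x\<in>X. \<exists>u\<in>X. (T ^^ n) (x - T u) = 0" by blast
  then show ?thesis unfolding right_Browder_iff[OF sX T] using TX finite_codim_self[of X] by simp
qed

section \<open>Invariant direct sum decompositions\<close>

text \<open>
  The pair \<open>(M, N)\<close> reduces \<open>T\<close>.  The bounded projection \<open>Q\<close> onto \<open>M\<close> along \<open>N\<close> commutes with \<open>T\<close>; through
  it, finiteness, complementedness, descent and density of ranges pass between \<open>X\<close> and the two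
  summands.
\<close>

locale reducing =
  fixes X M N :: "'a::complex_banach set" and T :: "'a \<Rightarrow> 'a"
  assumes X: "closed_csubspace X" and M: "closed_csubspace M" and N: "closed_csubspace N"
    and direct: "direct_sum X M N" and T: "T \<in> bounded_ops X"
    and TM: "T ` M \<subseteq> M" and TN: "T ` N \<subseteq> N"
begin

lemma sX: "csubspace X" and sM: "csubspace M" and sN: "csubspace N"
  using X M N by (simp_all add: closed_csubspace_def)

lemma swap: "reducing X N M T"
  using X M N direct T TM TN by unfold_locales (auto simp: direct_sum_def add.commute Int_commute)

text \<open>
  By the conditions chosen, \<open>Q\<close> is determined on \<open>X\<close>; its values outside \<open>X\<close> are arbitrary.
\<close>

definition Q :: "'a \<Rightarrow> 'a"
  where "Q = (SOME Q. projection_onto X M Q \<and> (\<forall>x\<in>X. x - Q x \<in> N) \<and> (\<forall>y\<in>N. Q y = 0))"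

lemma Q: "projection_onto X M Q" "x \<in> X \<Longrightarrow> x - Q x \<in> N" "y \<in> N \<Longrightarrow> Q y = 0"
proof -
  have "\<exists>Q. projection_onto X M Q \<and> (\<forall>x\<in>X. x - Q x \<in> N) \<and> (\<forall>y\<in>N. Q y = 0)"
    using direct_sum_projection[OF X M N direct] by metis
  from someI_ex[OF this, folded Q_def]
  show "projection_onto X M Q" "x \<in> X \<Longrightarrow> x - Q x \<in> N" "y \<in> N \<Longrightarrow> Q y = 0" by blast+
qed

lemma Q_bounded: "Q \<in> bounded_ops X" and MX: "M \<subseteq> X" and Q_mem: "x \<in> X \<Longrightarrow> Q x \<in> M"
  and Q_id: "m \<in> M \<Longrightarrow> Q m = m"
  using Q(1) by (auto simp: projection_onto_def)

lemma NX: "N \<subseteq> X"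
proof
  fix x assume "x \<in> N"
  then have "0 + x \<in> M + N" using complex_vector.subspace_0[OF sM] by (intro set_plus_intro)
  then show "x \<in> X" using direct by (simp add: direct_sum_def)
qed

lemma T_M: "T \<in> bounded_ops M" and T_N: "T \<in> bounded_ops N"
  using bounded_ops_subset[OF T MX TM] bounded_ops_subset[OF T NX TN] .

lemma Q_add: "m \<in> M \<Longrightarrow> n \<in> N \<Longrightarrow> Q (m + n) = m"
  using bounded_ops_add[OF Q_bounded, of m n] MX NX Q_id Q(3) by auto

lemma T_Q: assumes "x \<in> X" shows "T (Q x) = Q (T x)"
proof -
  have "T x = T (Q x) + T (x - Q x)"
    using bounded_ops_add[OF T, of "Q x" "x - Q x"] Q_mem[OF assms] Q(2)[OF assms] MX NX by auto
  moreover have "T (Q x) \<in> M" "T (x - Q x) \<in> N"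
    using Q_mem[OF assms] Q(2)[OF assms] TM TN by auto
  ultimately show ?thesis using Q_add by simp
qed

lemma reducing_shift: "reducing X M N (shift T z)"
proof -
  have "shift T z \<in> bounded_ops M" "shift T z \<in> bounded_ops N"
    using bounded_ops_shift sM sN T_M T_N by auto
  then show ?thesis
    using X M N direct bounded_ops_shift[OF sX T] by unfold_locales (auto simp: bounded_ops_mem)
qed

lemma reducing_power: "reducing X M N (T ^^ n)"
  using X M N direct bounded_ops_power[OF T] bounded_ops_mem[OF bounded_ops_power[OF T_M]]
    bounded_ops_mem[OF bounded_ops_power[OF T_N]]
  by unfold_locales auto

lemma finite_codim_M: assumes "finite_codim X (T ` X)" shows "finite_codim M (T ` M)"
proof -
  obtain F where F: "finite F" "F \<subseteq> X" "\<And>x. x \<in> X \<Longrightarrow> \<exists>v\<in>T ` X. x - v \<in> cspan F"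
    using assms by (auto simp: finite_codim_def)
  have "\<exists>v\<in>T ` M. x - v \<in> cspan (Q ` F)" if x: "x \<in> M" for x
  proof -
    obtain u where u: "u \<in> X" "x - T u \<in> cspan F" using F(3) x MX by blast
    have "Q (x - T u) = x - T (Q u)"
      using bounded_ops_diff[OF Q_bounded sX, of x "T u"] x MX bounded_ops_mem[OF T u(1)] T_Q[OF u(1)] Q_id
      by auto
    then show ?thesis using image_span_subset[OF sX Q_bounded F(2) u(2)] Q_mem[OF u(1)] by auto
  qed
  then show ?thesis unfolding finite_codim_def using F Q_mem by (intro exI[of _ "Q ` F"]) auto
qed

lemma finite_codim_X:
  assumes "finite_codim M (T ` M)" "finite_codim N (T ` N)" shows "finite_codim X (T ` X)"
proof -
  obtain F where F: "finite F" "F \<subseteq> M" "\<And>x. x \<in> M \<Longrightarrow> \<exists>v\<in>T ` M. x - v \<in> cspan F"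
    using assms by (auto simp: finite_codim_def)
  obtain G where G: "finite G" "G \<subseteq> N" "\<And>x. x \<in> N \<Longrightarrow> \<exists>v\<in>T ` N. x - v \<in> cspan G"
    using assms by (auto simp: finite_codim_def)
  have "\<exists>v\<in>T ` X. x - v \<in> cspan (F \<union> G)" if x: "x \<in> X" for x
  proof -
    obtain u v where u: "u \<in> M" "Q x - T u \<in> cspan F" and v: "v \<in> N" "(x - Q x) - T v \<in> cspan G"
      using F(3)[OF Q_mem[OF x]] G(3)[OF Q(2)[OF x]] by blast
    have "(Q x - T u) + ((x - Q x) - T v) \<in> cspan (F \<union> G)"
      using u(2) v(2) complex_vector.span_mono[of F "F \<union> G"] complex_vector.span_mono[of G "F \<union> G"]
      by (intro complex_vector.span_add) auto
    moreover have "(Q x - T u) + ((x - Q x) - T v) = x - T (u + v)"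
      using bounded_ops_add[OF T, of u v] u(1) v(1) MX NX by (auto simp: algebra_simps)
    moreover have "u + v \<in> X" using u(1) v(1) MX NX sX by (auto intro: complex_vector.subspace_add)
    ultimately show ?thesis by (intro bexI[of _ "T (u + v)"]) auto
  qed
  then show ?thesis unfolding finite_codim_def using F G MX NX by (intro exI[of _ "F \<union> G"]) auto
qed

lemma null_space_split:
  assumes "x \<in> null_space X T" shows "Q x \<in> null_space M T" "x - Q x \<in> null_space N T"
proof -
  have x: "x \<in> X" "T x = 0" using assms by (auto simp: null_space_def)
  have "T (Q x) = 0" using T_Q[OF x(1)] x(2) bounded_ops_zero[OF Q_bounded sX] by simp
  moreover from this have "T (x - Q x) = 0"
    using bounded_ops_diff[OF T sX x(1)] Q_mem[OF x(1)] MX x(2) by auto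
  ultimately show "Q x \<in> null_space M T" "x - Q x \<in> null_space N T"
    using Q_mem[OF x(1)] Q(2)[OF x(1)] by (auto simp: null_space_def)
qed

lemma finite_dim_null_M: "finite_dim (null_space X T) \<Longrightarrow> finite_dim (null_space M T)"
  using MX by (elim finite_dim_subset) (auto simp: null_space_def)

lemma finite_dim_null_X:
  assumes "finite_dim (null_space M T)" "finite_dim (null_space N T)"
  shows "finite_dim (null_space X T)"
proof -
  obtain F G where F: "finite F" "null_space M T \<subseteq> cspan F" and G: "finite G" "null_space N T \<subseteq> cspan G"
    using assms by (auto simp: finite_dim_def)
  have "x \<in> cspan (F \<union> G)" if "x \<in> null_space X T" for x
  proof -
    have "Q x + (x - Q x) \<in> cspan (F \<union> G)"
      using null_space_split[OF that] F(2) G(2)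
        complex_vector.span_mono[of F "F \<union> G"] complex_vector.span_mono[of G "F \<union> G"]
      by (intro complex_vector.span_add) auto
    then show ?thesis by simp
  qed
  then show ?thesis unfolding finite_dim_def using F(1) G(1) by (intro exI[of _ "F \<union> G"]) auto
qed

lemma complemented_null_M:
  assumes "complemented X (null_space X T)" shows "complemented M (null_space M T)"
proof -
  obtain P where P: "projection_onto X (null_space X T) P"
    using assms complemented_iff_projection[OF X] by blast
  then have PB: "P \<in> bounded_ops X" and Pn: "\<And>x. x \<in> X \<Longrightarrow> P x \<in> null_space X T"
    and Pid: "\<And>x. x \<in> null_space X T \<Longrightarrow> P x = x" by (auto simp: projection_onto_def)
  have "projection_onto M (null_space M T) (\<lambda>x. Q (P x))"
    unfolding projection_onto_def
  proof (intro conjI ballI)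
    show "(\<lambda>x. Q (P x)) \<in> bounded_ops M"
      using bounded_ops_compose[OF Q_bounded PB] MX
      by (rule bounded_ops_subset) (use Q_mem bounded_ops_mem[OF PB] MX in auto)
    show "null_space M T \<subseteq> M" by (auto simp: null_space_def)
    show "(\<lambda>x. Q (P x)) ` M \<subseteq> null_space M T" using null_space_split(1) Pn MX by blast
    show "Q (P v) = v" if "v \<in> null_space M T" for v
    proof -
      have "v \<in> null_space X T" "v \<in> M" using that MX by (auto simp: null_space_def)
      then show ?thesis using Pid Q_id by simp
    qed
  qed
  then show ?thesis using complemented_iff_projection[OF M] by blast
qed

lemma bounded_ops_glue:
  assumes "S1 \<in> bounded_ops M" "S2 \<in> bounded_ops N"
  shows "(\<lambda>x. S1 (Q x) + S2 (x - Q x)) \<in> bounded_ops X"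
proof -
  obtain K1 where K1: "K1 > 0" "\<And>x. x \<in> M \<Longrightarrow> norm (S1 x) \<le> K1 * norm x" using bounded_ops_bound[OF assms(1)] by blast
  obtain K2 where K2: "K2 > 0" "\<And>x. x \<in> N \<Longrightarrow> norm (S2 x) \<le> K2 * norm x" using bounded_ops_bound[OF assms(2)] by blast
  obtain L1 where L1: "L1 > 0" "\<And>x. x \<in> X \<Longrightarrow> norm (Q x) \<le> L1 * norm x" using bounded_ops_bound[OF Q_bounded] by blast
  have IQ: "(\<lambda>x. x - Q x) \<in> bounded_ops X" by (intro bounded_ops_minus sX bounded_ops_id Q_bounded)
  obtain L2 where L2: "L2 > 0" "\<And>x. x \<in> X \<Longrightarrow> norm (x - Q x) \<le> L2 * norm x" using bounded_ops_bound[OF IQ] by blast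
  show ?thesis
  proof (rule bounded_opsI[where K = "K1 * L1 + K2 * L2"])
    fix x assume x: "x \<in> X"
    show "S1 (Q x) + S2 (x - Q x) \<in> X"
      using bounded_ops_mem[OF assms(1) Q_mem[OF x]] bounded_ops_mem[OF assms(2) Q(2)[OF x]] MX NX sX
      by (auto intro: complex_vector.subspace_add)
    have "norm (S1 (Q x)) \<le> K1 * (L1 * norm x)"
      using K1(2)[OF Q_mem[OF x]] mult_left_mono[OF L1(2)[OF x], of K1] K1(1) by linarith
    moreover have "norm (S2 (x - Q x)) \<le> K2 * (L2 * norm x)"
      using K2(2)[OF Q(2)[OF x]] mult_left_mono[OF L2(2)[OF x], of K2] K2(1) by linarith
    ultimately show "norm (S1 (Q x) + S2 (x - Q x)) \<le> (K1 * L1 + K2 * L2) * norm x"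
      using norm_triangle_ineq[of "S1 (Q x)" "S2 (x - Q x)"] by (simp add: algebra_simps)
    show "S1 (Q (c *\<^sub>C x)) + S2 (c *\<^sub>C x - Q (c *\<^sub>C x)) = c *\<^sub>C (S1 (Q x) + S2 (x - Q x))" for c
      using bounded_ops_scale[OF Q_bounded x, of c] bounded_ops_scale[OF IQ x, of c]
        bounded_ops_scale[OF assms(1) Q_mem[OF x]] bounded_ops_scale[OF assms(2) Q(2)[OF x]]
      by (simp add: scaleC_add_right del: complex_vector.scale_right_diff_distrib)
    fix y assume y: "y \<in> X"
    have "x + y - Q (x + y) = (x - Q x) + (y - Q y)" using bounded_ops_add[OF IQ x y] .
    then show "S1 (Q (x + y)) + S2 (x + y - Q (x + y)) = S1 (Q x) + S2 (x - Q x) + (S1 (Q y) + S2 (y - Q y))"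
      unfolding bounded_ops_add[OF Q_bounded x y, symmetric]
      by (simp only: bounded_ops_add[OF Q_bounded x y] bounded_ops_add[OF assms(1) Q_mem[OF x] Q_mem[OF y]]
        bounded_ops_add[OF assms(2) Q(2)[OF x] Q(2)[OF y]]) (simp only: ac_simps)
  qed
qed

lemma T_glue: "x \<in> M \<Longrightarrow> y \<in> N \<Longrightarrow> T (x + y) = T x + T y"
  using bounded_ops_add[OF T] MX NX by blast

lemma complemented_null_X:
  assumes "complemented M (null_space M T)" "complemented N (null_space N T)"
  shows "complemented X (null_space X T)"
proof -
  obtain P1 P2 where P: "projection_onto M (null_space M T) P1" "projection_onto N (null_space N T) P2"
    using assms complemented_iff_projection M N by blast
  then have P1: "P1 \<in> bounded_ops M" "\<And>x. x \<in> M \<Longrightarrow> P1 x \<in> null_space M T" "\<And>x. x \<in> null_space M T \<Longrightarrow> P1 x = x"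
    and P2: "P2 \<in> bounded_ops N" "\<And>x. x \<in> N \<Longrightarrow> P2 x \<in> null_space N T" "\<And>x. x \<in> null_space N T \<Longrightarrow> P2 x = x"
    by (auto simp: projection_onto_def)
  have "projection_onto X (null_space X T) (\<lambda>x. P1 (Q x) + P2 (x - Q x))"
    unfolding projection_onto_def
  proof (intro conjI ballI)
    show g: "(\<lambda>x. P1 (Q x) + P2 (x - Q x)) \<in> bounded_ops X" by (rule bounded_ops_glue[OF P1(1) P2(1)])
    show "null_space X T \<subseteq> X" by (auto simp: null_space_def)
    show "(\<lambda>x. P1 (Q x) + P2 (x - Q x)) ` X \<subseteq> null_space X T"
    proof
      fix y assume "y \<in> (\<lambda>x. P1 (Q x) + P2 (x - Q x)) ` X"
      then obtain x where x: "x \<in> X" "y = P1 (Q x) + P2 (x - Q x)" by blast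
      have "P1 (Q x) \<in> null_space M T" "P2 (x - Q x) \<in> null_space N T"
        using P1(2)[OF Q_mem[OF x(1)]] P2(2)[OF Q(2)[OF x(1)]] .
      then show "y \<in> null_space X T"
        using T_glue[of "P1 (Q x)" "P2 (x - Q x)"] bounded_ops_mem[OF g x(1)] x(2)
        by (auto simp: null_space_def)
    qed
    show "P1 (Q v) + P2 (v - Q v) = v" if "v \<in> null_space X T" for v
      using null_space_split[OF that] P1(3) P2(3) by simp
  qed
  then show ?thesis using complemented_iff_projection[OF X] by blast
qed

lemma descent_M:
  assumes "\<forall>x\<in>X. \<exists>u\<in>X. (T ^^ n) (x - T u) = 0"
  shows "\<forall>x\<in>M. \<exists>u\<in>M. (T ^^ n) (x - T u) = 0"
proof
  fix x assume x: "x \<in> M"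
  then obtain u where u: "u \<in> X" "(T ^^ n) (x - T u) = 0" using assms MX by blast
  interpret pow: reducing X M N "T ^^ n" by (rule reducing_power)
  have Tu: "T u \<in> X" using T u(1) by (rule bounded_ops_mem)
  have "x - T u \<in> X" using x MX Tu sX by (auto intro: complex_vector.subspace_diff)
  then have "(T ^^ n) (Q (x - T u)) = 0"
    using pow.T_Q u(2) bounded_ops_zero[OF Q_bounded sX] by simp
  moreover have "Q (x - T u) = x - T (Q u)"
    using bounded_ops_diff[OF Q_bounded sX, of x "T u"] x MX Tu Q_id T_Q[OF u(1)] by auto
  ultimately show "\<exists>u\<in>M. (T ^^ n) (x - T u) = 0" using Q_mem[OF u(1)] by auto
qed

lemma descent_X:
  assumes "\<forall>x\<in>M. \<exists>u\<in>M. (T ^^ n) (x - T u) = 0" "\<forall>x\<in>N. \<exists>u\<in>N. (T ^^ m) (x - T u) = 0"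
  shows "\<forall>x\<in>X. \<exists>u\<in>X. (T ^^ (m + n)) (x - T u) = 0"
proof
  fix x assume x: "x \<in> X"
  obtain u where u: "u \<in> M" "(T ^^ n) (Q x - T u) = 0" using assms(1) Q_mem[OF x] by blast
  obtain v where v: "v \<in> N" "(T ^^ m) ((x - Q x) - T v) = 0" using assms(2) Q(2)[OF x] by blast
  have z: "(T ^^ k) 0 = 0" for k using bounded_ops_zero[OF bounded_ops_power[OF T] sX] .
  have 1: "(T ^^ (m + n)) (Q x - T u) = 0" using u(2) z by (simp add: funpow_add)
  have 2: "(T ^^ (m + n)) ((x - Q x) - T v) = 0"
    using v(2) z by (subst add.commute) (simp add: funpow_add)
  have "Q x \<in> X" "x - Q x \<in> X" "T u \<in> X" "T v \<in> X"
    using Q_mem[OF x] Q(2)[OF x] u(1) v(1) TM TN MX NX by auto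
  then have "Q x - T u \<in> X" "(x - Q x) - T v \<in> X" using sX by (auto intro: complex_vector.subspace_diff)
  then have "(T ^^ (m + n)) ((Q x - T u) + ((x - Q x) - T v)) = 0"
    by (simp only: bounded_ops_add[OF bounded_ops_power[OF T]] 1 2) simp
  moreover have "(Q x - T u) + ((x - Q x) - T v) = x - T (u + v)"
    using T_glue[OF u(1) v(1)] by simp
  moreover have "u + v \<in> X" using u(1) v(1) MX NX sX by (auto intro: complex_vector.subspace_add)
  ultimately show "\<exists>u\<in>X. (T ^^ (m + n)) (x - T u) = 0" by auto
qed

lemma descent_finite_M: "descent X T < \<infinity> \<Longrightarrow> descent M T < \<infinity>"
  unfolding descent_finite_iff_preimage[OF sX T] descent_finite_iff_preimage[OF sM T_M]
  using descent_M by blast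

lemma right_Browder_M: "right_Browder X T \<Longrightarrow> right_Browder M T"
  unfolding right_Browder_iff[OF sX T] right_Browder_iff[OF sM T_M]
  using descent_M finite_codim_M complemented_null_M by blast

lemma right_Browder_X:
  assumes "right_Browder M T" "right_Browder N T" shows "right_Browder X T"
  using assms descent_X finite_codim_X complemented_null_X
  unfolding right_Browder_iff[OF sX T] right_Browder_iff[OF sM T_M] right_Browder_iff[OF sN T_N]
  by blast

lemma right_invertible_X:
  assumes "right_invertible M T" "right_invertible N T" shows "right_invertible X T"
proof -
  obtain S1 S2 where S1: "S1 \<in> bounded_ops M" "\<And>x. x \<in> M \<Longrightarrow> T (S1 x) = x"
    and S2: "S2 \<in> bounded_ops N" "\<And>x. x \<in> N \<Longrightarrow> T (S2 x) = x"
    using assms by (auto simp: right_invertible_def)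
  have "T (S1 (Q x) + S2 (x - Q x)) = x" if x: "x \<in> X" for x
    using T_glue[OF bounded_ops_mem[OF S1(1) Q_mem[OF x]] bounded_ops_mem[OF S2(1) Q(2)[OF x]]]
      S1(2)[OF Q_mem[OF x]] S2(2)[OF Q(2)[OF x]] by simp
  then show ?thesis
    unfolding right_invertible_def by (intro bexI[OF _ bounded_ops_glue[OF S1(1) S2(1)]] ballI)
qed

lemma Riesz_M: "Riesz X T \<Longrightarrow> Riesz M T"
  unfolding Riesz_iff[OF X T] Riesz_iff[OF M T_M]
  using reducing.finite_dim_null_M[OF reducing_shift] reducing.finite_codim_M[OF reducing_shift] by blast

lemma Riesz_X:
  assumes "Riesz M T" "Riesz N T" shows "Riesz X T"
  unfolding Riesz_iff[OF X T]
proof (intro allI impI conjI)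
  fix z :: complex assume "z \<noteq> 0"
  then have "finite_dim (null_space M (shift T z))" "finite_codim M (shift T z ` M)"
    "finite_dim (null_space N (shift T z))" "finite_codim N (shift T z ` N)"
    using assms unfolding Riesz_iff[OF M T_M] Riesz_iff[OF N T_N] by auto
  then show "finite_dim (null_space X (shift T z))" "finite_codim X (shift T z ` X)"
    using reducing.finite_dim_null_X[OF reducing_shift] reducing.finite_codim_X[OF reducing_shift]
    by blast+
qed

lemma dense_range_M:
  assumes "X \<subseteq> closure (T ` X)" shows "M \<subseteq> closure (T ` M)"
proof
  fix x assume x: "x \<in> M"
  then have "x \<in> closure (T ` X)" using assms MX by blast
  then obtain y where y: "\<And>n. y n \<in> T ` X" "y \<longlonglongrightarrow> x" by (auto simp: closure_sequential)
  have "T ` X \<subseteq> X" using T by (auto simp: bounded_ops_mem)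
  then have yX: "y n \<in> X" for n using y(1) by blast
  have "(\<lambda>n. Q (y n)) \<longlonglongrightarrow> Q x"
    using continuous_on_tendsto_compose[OF bounded_ops_continuous[OF Q_bounded sX] y(2)] x MX yX by auto
  moreover have "Q (y n) \<in> T ` M" for n
  proof -
    obtain u where u: "u \<in> X" "y n = T u" using y(1)[of n] by blast
    then show ?thesis using T_Q[OF u(1), symmetric] Q_mem[OF u(1)] by simp
  qed
  ultimately show "x \<in> closure (T ` M)"
    unfolding closure_sequential using Q_id[OF x] by (intro exI[of _ "\<lambda>n. Q (y n)"]) simp
qed

end

section \<open>Decomposition of right Browder operators\<close>

lemma shift_shift: "shift (shift T a) b = shift T (a + b)"
  by (simp add: shift_def fun_eq_iff scaleC_add_left)

lemma funpow_shift_commute: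
  assumes sX: "csubspace X" and T: "T \<in> bounded_ops X" and x: "x \<in> X"
  shows "shift T z ((T ^^ k) x) = (T ^^ k) (shift T z x)"
proof -
  have "T x \<in> X" "z *\<^sub>C x \<in> X"
    using bounded_ops_mem[OF T x] complex_vector.subspace_scale[OF sX x] by auto
  then show ?thesis
    using bounded_ops_diff[OF bounded_ops_power[OF T] sX, of "T x" "z *\<^sub>C x" k]
      bounded_ops_scale[OF bounded_ops_power[OF T] x, of k z]
    by (simp add: shift_def funpow_swap1)
qed

text \<open>
  If the descent of \<open>T\<close> is at most \<open>n\<close>, then \<open>T\<close> maps \<open>M = T\<^sup>n X\<close> onto itself, and \<open>M\<close> is closed because
  its codimension is finite.  The invariant complement \<open>N\<close> is finite-dimensional, and the null space of
  \<open>T\<close> in \<open>M\<close> inherits its complement from the null space of \<open>T\<close> in \<open>X\<close>.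
\<close>

lemma right_Browder_decomposition:
  fixes X :: "'a::complex_banach set"
  assumes X: "closed_csubspace X" and T: "T \<in> bounded_ops X" and B: "right_Browder X T"
  obtains M N n where "reducing X M N T" "right_invertible M T" "finite_dim N"
    "\<And>x. x \<in> N \<Longrightarrow> (T ^^ n) x = 0"
proof -
  have sX: "csubspace X" using X by (simp add: closed_csubspace_def)
  obtain n where n: "\<And>x. x \<in> X \<Longrightarrow> \<exists>u\<in>X. (T ^^ n) (x - T u) = 0"
    and fc: "finite_codim X (T ` X)" and cn: "complemented X (null_space X T)"
    using B unfolding right_Browder_iff[OF sX T] by blast
  have Tn: "T ^^ n \<in> bounded_ops X" by (rule bounded_ops_power[OF T])
  define M where "M = (T ^^ n) ` X"
  have M: "closed_csubspace M"
    unfolding M_def by (rule closed_range_finite_codim[OF X Tn finite_codim_range_power[OF sX T fc]])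
  have MX: "M \<subseteq> X" using bounded_ops_mem[OF Tn] by (auto simp: M_def)
  have onto: "T ` M = M"
  proof
    show "T ` M \<subseteq> M" using bounded_ops_mem[OF T] by (force simp: M_def funpow_swap1)
    show "M \<subseteq> T ` M"
    proof
      fix y assume "y \<in> M"
      then obtain x where x: "x \<in> X" "y = (T ^^ n) x" by (auto simp: M_def)
      obtain u where u: "u \<in> X" "(T ^^ n) (x - T u) = 0" using n[OF x(1)] by blast
      have "y = T ((T ^^ n) u)"
        using u bounded_ops_diff[OF Tn sX x(1) bounded_ops_mem[OF T u(1)]] x(2) by (simp add: funpow_swap1)
      then show "y \<in> T ` M" using u(1) by (simp add: M_def)
    qed
  qed
  obtain N where N: "csubspace N" "N \<subseteq> X" "finite_dim N" "T ` N \<subseteq> N" "direct_sum X M N"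
  proof (rule nilpotent_complement[OF sX T, of M n])
    show "csubspace M" "M \<subseteq> X" "T ` M = M" using M MX onto by (auto simp: closed_csubspace_def)
    show "finite_codim X M" unfolding M_def by (rule finite_codim_range_power[OF sX T fc])
    show "(T ^^ n) ` X \<subseteq> M" by (simp add: M_def)
  qed
  have fdN: "finite_dim N" by (rule N(3))
  interpret reducing X M N T
  proof
    show "T ` M \<subseteq> M" using onto by blast
  qed (fact X M finite_dim_closed[OF N(3,1)] N(4,5) T)+
  have inv: "right_invertible M T"
    unfolding right_invertible_iff[OF M T_M] using onto complemented_null_M[OF cn] by simp
  have nil: "(T ^^ n) x = 0" if "x \<in> N" for x
  proof -
    have "(T ^^ n) x \<in> M \<inter> N"
      using that NX bounded_ops_mem[OF bounded_ops_power[OF T_N] that] by (auto simp: M_def)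
    then show ?thesis using direct by (auto simp: direct_sum_def)
  qed
  show ?thesis by (rule that[OF reducing_axioms inv fdN nil])
qed

text \<open>
  If \<open>T\<^sup>k\<^sup>+\<^sup>1 x = 0\<close>, then \<open>T x\<close> is in the range of \<open>T - z I\<close> by induction, and so is
  \<open>x = z\<^sup>-\<^sup>1 (T x - (T - z I) x)\<close>.  Injectivity holds since \<open>T x = z x\<close> implies \<open>T\<^sup>n x = z\<^sup>n x\<close>.
\<close>

lemma nilpotent_shift_right_invertible:
  fixes X :: "'a::complex_banach set"
  assumes X: "closed_csubspace X" and T: "T \<in> bounded_ops X"
    and nil: "\<And>x. x \<in> X \<Longrightarrow> (T ^^ n) x = 0" and z: "z \<noteq> 0"
  shows "right_invertible X (shift T z)"
proof -
  have sX: "csubspace X" using X by (simp add: closed_csubspace_def)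
  have sT: "shift T z \<in> bounded_ops X" by (rule bounded_ops_shift[OF sX T])
  have srange: "csubspace (shift T z ` X)" using csubspace_image[OF sX sT] by blast
  have "x \<in> shift T z ` X" if "x \<in> X" "(T ^^ k) x = 0" for x k
    using that
  proof (induction k arbitrary: x)
    case 0
    then show ?case using complex_vector.subspace_0[OF srange] by simp
  next
    case (Suc k)
    have "T x \<in> shift T z ` X"
      using Suc bounded_ops_mem[OF T] by (auto simp: funpow_swap1)
    then have "inverse z *\<^sub>C (T x - shift T z x) \<in> shift T z ` X"
      using Suc.prems(1) by (intro complex_vector.subspace_scale complex_vector.subspace_diff srange) auto
    then show ?case using z by (simp add: shift_def)
  qed
  then have onto: "shift T z ` X = X" using nil bounded_ops_mem[OF sT] by blast
  have "x = 0" if "x \<in> null_space X (shift T z)" for x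
  proof -
    have x: "x \<in> X" "T x = z *\<^sub>C x" using that by (auto simp: null_space_def shift_def)
    have "(T ^^ k) x = z ^ k *\<^sub>C x" for k
      by (induction k) (use x bounded_ops_scale[OF T x(1)] in \<open>auto simp: scaleC_scaleC mult.commute\<close>)
    then show ?thesis using nil[OF x(1)] z by simp
  qed
  moreover have "0 \<in> null_space X (shift T z)"
    using bounded_ops_zero[OF sT sX] complex_vector.subspace_0[OF sX] by (simp add: null_space_def)
  ultimately have "null_space X (shift T z) = {0}" by blast
  moreover have "complemented X {0}"
    using complex_vector.subspace_0[OF sX]
    by (intro finite_dim_complemented[OF X]) (auto simp: finite_dim_def intro!: exI[of _ "{}"])
  ultimately show ?thesis using right_invertible_iff[OF X sT] onto by simp
qed

text \<open>
  On the summand where \<open>T\<close> is right invertible small shifts are harmless; on the nilpotent summand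
  every nonzero shift is invertible.
\<close>

lemma right_Browder_punctured:
  fixes X :: "'a::complex_banach set"
  assumes X: "closed_csubspace X" and T: "T \<in> bounded_ops X" and B: "right_Browder X T"
  obtains e where "e > 0" "\<And>z. z \<noteq> 0 \<Longrightarrow> cmod z < e \<Longrightarrow> right_invertible X (shift T z)"
proof -
  obtain M N n where red: "reducing X M N T" and M: "right_invertible M T" and N: "\<And>x. x \<in> N \<Longrightarrow> (T ^^ n) x = 0"
    by (rule right_Browder_decomposition[OF X T B]) (rule that)
  interpret red: reducing X M N T by (rule red)
  obtain e where e: "e > 0" "\<And>z. cmod z < e \<Longrightarrow> right_invertible M (shift T z)"
    by (rule right_invertible_perturb[OF red.M red.T_M M]) (rule that)
  have "right_invertible X (shift T z)" if "z \<noteq> 0" "cmod z < e" for z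
    using reducing.right_invertible_X[OF red.reducing_shift e(2)[OF that(2)]
        nilpotent_shift_right_invertible[OF red.N red.T_N N that(1)]] .
  then show ?thesis using that e(1) by blast
qed

section \<open>Riesz operators away from zero\<close>

lemma finite_dim_decreasing_stabilizes:
  assumes "\<And>k. csubspace (V k)" "\<And>j k. j \<le> k \<Longrightarrow> V k \<subseteq> V j" "finite_dim (V 0)"
  shows "\<exists>k. \<forall>j\<ge>k. V j = V (k::nat)"
proof -
  have fd: "finite_dim (V j)" for j using finite_dim_subset[OF assms(3) assms(2)[of 0 j]] by simp
  \<comment> \<open>The dimensions decrease, so the least one is attained from some \<open>k\<close> on.\<close>
  obtain k where k: "\<And>j. complex_vector.dim (V k) \<le> complex_vector.dim (V j)"
    using ex_has_least_nat[of "\<lambda>_. True" _ "\<lambda>j. complex_vector.dim (V j)"] by blast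
  have "V j = V k" if "j \<ge> k" for j
  proof
    show sub: "V j \<subseteq> V k" using assms(2) that .
    obtain B where B: "finite B" "complex_vector.independent B" "B \<subseteq> V j" "cspan B = V j"
      "card B = complex_vector.dim (V j)" using finite_dim_basis[OF fd assms(1)] by metis
    obtain C where C: "B \<subseteq> C" "C \<subseteq> V k" "complex_vector.independent C" "V k \<subseteq> cspan C"
      using complex_vector.maximal_independent_subset_extend[OF _ B(2), of "V k"] B(3) sub by blast
    obtain F where F: "finite F" "V k \<subseteq> cspan F" using fd by (auto simp: finite_dim_def)
    have "finite C" using complex_vector.independent_span_bound[OF F(1) C(3)] C(2) F(2) by blast
    moreover have "card C = complex_vector.dim (V k)"
      using C by (intro complex_vector.basis_card_eq_dim)
    ultimately have "B = C" using C(1) B(5) k[of j] by (intro card_seteq) auto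
    then show "V k \<subseteq> V j" using B(4) C(4) by blast
  qed
  then show ?thesis by blast
qed

text \<open>
  The intersections of the finite-dimensional null space with the ranges of the powers of \<open>T\<close>
  stabilize, say at \<open>k\<close>.  Therefore \<open>T\<close> is a Saphar operator on \<open>Y = T\<^sup>k X\<close>.  If it were not onto there,
  no small shift of it would be onto on \<open>Y\<close>; but shifts that are onto on \<open>X\<close> are onto on \<open>Y\<close>, because
  they commute with \<open>T\<^sup>k\<close>.  Hence \<open>T Y = Y\<close>, which bounds the descent by \<open>k\<close>.
\<close>

lemma right_Browder_of_onto_near:
  fixes X :: "'a::complex_banach set"
  assumes X: "closed_csubspace X" and T: "T \<in> bounded_ops X"
    and fd: "finite_dim (null_space X T)" and fc: "finite_codim X (T ` X)"
    and near: "\<And>e. e > 0 \<Longrightarrow> \<exists>z. cmod z < e \<and> shift T z ` X = X"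
  shows "right_Browder X T"
proof -
  have sX: "csubspace X" using X by (simp add: closed_csubspace_def)
  have Tk: "T ^^ k \<in> bounded_ops X" for k by (rule bounded_ops_power[OF T])
  have nT: "closed_csubspace (null_space X T)" by (rule closed_csubspace_null_space[OF X T])
  have R: "closed_csubspace ((T ^^ k) ` X)" for k
    by (rule closed_range_finite_codim[OF X Tk finite_codim_range_power[OF sX T fc]])
  define V where "V k = null_space X T \<inter> (T ^^ k) ` X" for k
  have V: "csubspace (V k)" for k
    unfolding V_def using nT R[of k] by (auto simp: closed_csubspace_def intro: complex_vector.subspace_inter)
  have Vdec: "V k \<subseteq> V j" if "j \<le> k" for j k
    unfolding V_def using funpow_image_mono[OF T that] by blast
  have V0: "finite_dim (V 0)" by (rule finite_dim_subset[OF fd]) (simp add: V_def)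
  have "\<exists>k. \<forall>j\<ge>k. V j = V k"
    by (rule finite_dim_decreasing_stabilizes[of V]) (simp_all add: V Vdec V0)
  then obtain k where k: "\<And>j. j \<ge> k \<Longrightarrow> V j = V k" by blast
  define Y where "Y = (T ^^ k) ` X"
  have Y: "closed_csubspace Y" unfolding Y_def by (rule R)
  have sY: "csubspace Y" using Y by (simp add: closed_csubspace_def)
  have YX: "Y \<subseteq> X" using bounded_ops_mem[OF Tk] by (auto simp: Y_def)
  have TjY: "(T ^^ j) ` Y = (T ^^ (j + k)) ` X" for j
    by (simp add: Y_def funpow_add image_comp)
  have TY: "T \<in> bounded_ops Y"
    by (rule bounded_ops_subset[OF T YX]) (use bounded_ops_mem[OF T] in \<open>force simp: Y_def funpow_swap1\<close>)
  have nY: "null_space Y T = V k" using YX by (auto simp: null_space_def V_def Y_def)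
  have TY_eq: "T ` Y = (T ^^ Suc k) ` X" using TjY[of 1] by simp
  have "Saphar Y T"
    unfolding Saphar_def Kato_def
  proof (intro conjI allI)
    show "closed (T ` Y)" unfolding TY_eq using R[of "Suc k"] by (rule closed_csubspaceD(2))
    show "null_space Y T \<subseteq> (T ^^ j) ` Y" for j
      unfolding nY TjY using k[of "j + k"] by (auto simp: V_def)
    show "complemented Y (null_space Y T)"
      by (intro finite_dim_complemented[OF Y])
        (use V finite_dim_subset[OF V0 Vdec] nY in \<open>auto simp: null_space_def\<close>)
    have "finite_codim Y (T ` Y)"
    proof -
      obtain F where F: "finite F" "F \<subseteq> X" "\<And>x. x \<in> X \<Longrightarrow> \<exists>v\<in>T ` X. x - v \<in> cspan F"
        using fc by (auto simp: finite_codim_def)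
      have "\<exists>v\<in>T ` Y. y - v \<in> cspan ((T ^^ k) ` F)" if y: "y \<in> Y" for y
      proof -
        obtain x where x: "x \<in> X" "y = (T ^^ k) x" using y by (auto simp: Y_def)
        obtain u where u: "u \<in> X" "x - T u \<in> cspan F" using F(3)[OF x(1)] by blast
        have "(T ^^ k) (x - T u) = y - T ((T ^^ k) u)"
          using bounded_ops_diff[OF Tk sX x(1) bounded_ops_mem[OF T u(1)]] x(2) by (simp add: funpow_swap1)
        then have "y - T ((T ^^ k) u) \<in> cspan ((T ^^ k) ` F)"
          using image_span_subset[OF sX Tk[of k] F(2) u(2)] by simp
        moreover have "T ((T ^^ k) u) \<in> T ` Y" using u(1) by (auto simp: Y_def)
        ultimately show ?thesis by blast
      qed
      then show ?thesis
        unfolding finite_codim_def using F(1,2) by (intro exI[of _ "(T ^^ k) ` F"]) (auto simp: Y_def)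
    qed
    moreover have "closed_csubspace (T ` Y)" unfolding TY_eq by (rule R)
    ultimately show "complemented Y (T ` Y)"
      using TY by (intro finite_codim_closed_complemented sY) (auto simp: bounded_ops_mem)
  qed
  have "T ` Y = Y"
  proof (rule ccontr)
    assume "T ` Y \<noteq> Y"
    then obtain e where e: "e > 0" "\<And>z. cmod z < e \<Longrightarrow> \<not> Y \<subseteq> closure (shift T z ` Y)"
      by (rule Saphar_not_onto_near[OF Y TY \<open>Saphar Y T\<close>]) (rule that)
    obtain z where z: "cmod z < e" "shift T z ` X = X" using near[OF e(1)] by blast
    have "Y \<subseteq> shift T z ` Y"
    proof
      fix y assume "y \<in> Y"
      then obtain x where x: "x \<in> X" "y = (T ^^ k) x" by (auto simp: Y_def)
      then obtain u where u: "u \<in> X" "x = shift T z u" using z(2) by blast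
      then have "y = shift T z ((T ^^ k) u)" using funpow_shift_commute[OF sX T u(1)] x(2) by simp
      then show "y \<in> shift T z ` Y" using u(1) by (auto simp: Y_def)
    qed
    then show False using e(2)[OF z(1)] closure_subset by blast
  qed
  have "\<exists>u\<in>X. (T ^^ k) (x - T u) = 0" if x: "x \<in> X" for x
  proof -
    have "(T ^^ k) x \<in> T ` Y" using x \<open>T ` Y = Y\<close> by (simp add: Y_def)
    then obtain u where u: "u \<in> X" "(T ^^ k) x = T ((T ^^ k) u)" by (auto simp: Y_def)
    then have "(T ^^ k) (x - T u) = 0"
      using bounded_ops_diff[OF Tk[of k] sX x bounded_ops_mem[OF T u(1)]] by (simp add: funpow_swap1)
    then show ?thesis using u(1) by blast
  qed
  moreover have "complemented X (null_space X T)"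
    using nT fd by (intro finite_dim_complemented[OF X]) (auto simp: closed_csubspace_def null_space_def)
  ultimately show ?thesis unfolding right_Browder_iff[OF sX T] using fc by blast
qed

text \<open>
  Let \<open>G\<close> be the set of all nonzero \<open>w\<close> for which \<open>T - w I\<close> is right Browder.  It is open, since right
  Browder operators become right invertible after small nonzero shifts.  It is relatively closed in the
  punctured plane: near a limit point \<open>w\<close> of \<open>G\<close> there are shifts that are onto, so that the preceding
  lemma applies to \<open>T - w I\<close>.  Finally \<open>G\<close> contains all \<open>w\<close> of large modulus, and the punctured plane is
  connected.
\<close>

theorem Riesz_imp_right_Browder:
  fixes X :: "'a::complex_banach set"
  assumes X: "closed_csubspace X" and T: "T \<in> bounded_ops X" and Ri: "Riesz X T" and "z \<noteq> 0"
  shows "right_Browder X (shift T z)"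
proof -
  have sX: "csubspace X" using X by (simp add: closed_csubspace_def)
  have sT: "shift T w \<in> bounded_ops X" for w by (rule bounded_ops_shift[OF sX T])
  define G where "G = {w. w \<noteq> 0 \<and> right_Browder X (shift T w)}"
  have punct: "\<exists>e>0. \<forall>v. v \<noteq> 0 \<and> cmod v < e \<longrightarrow> right_invertible X (shift T (w + v))" if "w \<in> G" for w
  proof -
    have "right_Browder X (shift T w)" using that by (simp add: G_def)
    from right_Browder_punctured[OF X sT this] show ?thesis unfolding shift_shift by metis
  qed
  have "open G"
    unfolding open_dist
  proof
    fix w assume w: "w \<in> G"
    then obtain e where e: "e > 0" "\<And>v. v \<noteq> 0 \<Longrightarrow> cmod v < e \<Longrightarrow> right_invertible X (shift T (w + v))"
      using punct by blast
    have "y \<in> G" if "dist y w < min e (cmod w)" for y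
    proof (cases "y = w")
      case False
      have "right_invertible X (shift T (w + (y - w)))" using e(2)[of "y - w"] that False by (simp add: dist_norm)
      moreover have "y \<noteq> 0" using that by auto
      ultimately show ?thesis
        using right_invertible_imp_right_Browder[OF X sT] by (simp add: G_def)
    qed (use w in simp)
    moreover have "min e (cmod w) > 0" using e(1) w by (simp add: G_def)
    ultimately show "\<exists>e>0. \<forall>y. dist y w < e \<longrightarrow> y \<in> G" by blast
  qed
  moreover have "open (- {0} - G)"
    unfolding open_dist
  proof
    fix w assume "w \<in> - {0} - G"
    then have w: "w \<noteq> 0" "\<not> right_Browder X (shift T w)" by (auto simp: G_def)
    have fin: "finite_dim (null_space X (shift T w))" "finite_codim X (shift T w ` X)"
      using Ri w(1) unfolding Riesz_iff[OF X T] by auto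
    obtain e where e: "e > 0" "\<And>v. cmod v < e \<Longrightarrow> shift (shift T w) v ` X \<noteq> X"
      using right_Browder_of_onto_near[OF X sT fin] w(2) by blast
    have "y \<in> - {0} - G" if y: "dist y w < min e (cmod w)" for y
    proof -
      have "y \<notin> G"
      proof
        assume "y \<in> G"
        then obtain d where d: "d > 0" "\<And>v. v \<noteq> 0 \<Longrightarrow> cmod v < d \<Longrightarrow> right_invertible X (shift T (y + v))"
          using punct by blast
        \<comment> \<open>From \<open>y\<close> a step \<open>v\<close> that is short enough to stay near \<open>w\<close> leads to an operator that is onto.\<close>
        define v where "v = complex_of_real (min d (e - dist y w) / 2)"
        have pos: "min d (e - dist y w) > 0" using d(1) y by simp
        have v: "v \<noteq> 0" "cmod v < d" "cmod v < e - dist y w"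
          using pos unfolding v_def norm_of_real by auto
        have "right_invertible X (shift T (y + v))" using d(2)[OF v(1,2)] .
        then have "shift T (y + v) ` X = X" using right_invertible_iff[OF X sT] by blast
        moreover have "cmod (y - w + v) < e"
          using norm_triangle_ineq[of "y - w" v] v(3) by (simp add: dist_norm)
        ultimately show False using e(2)[of "y - w + v"] by (simp add: shift_shift)
      qed
      moreover have "y \<noteq> 0" using y by auto
      ultimately show ?thesis by simp
    qed
    moreover have "min e (cmod w) > 0" using e(1) w by simp
    ultimately show "\<exists>e>0. \<forall>y. dist y w < e \<longrightarrow> y \<in> - {0} - G" by blast
  qed
  moreover have "connected (- {0::complex})" by (rule connected_punctured_universe) simp
  ultimately have "G \<inter> - {0} = {} \<or> (- {0} - G) \<inter> - {0} = {}"
    by (intro connectedD) auto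
  moreover obtain r where r: "r > 0" "\<And>w. cmod w > r \<Longrightarrow> right_invertible X (shift T w)"
    using right_invertible_large[OF X T] by blast
  have "complex_of_real (r + 1) \<in> G"
    using r right_invertible_imp_right_Browder[OF X sT, of "complex_of_real (r + 1)"]
    by (auto simp: G_def simp del: of_real_add)
  moreover have "complex_of_real (r + 1) \<noteq> 0" using r(1) by (simp del: of_real_add)
  ultimately have "z \<in> G" using \<open>z \<noteq> 0\<close> by blast
  then show ?thesis by (simp add: G_def)
qed

section \<open>Decompositions into a right invertible and a Riesz part\<close>

lemma bounded_ops_const_zero: "csubspace X \<Longrightarrow> (\<lambda>x. 0) \<in> bounded_ops X"
  by (rule bounded_opsI[where K = 0]) (auto simp: complex_vector.subspace_0)

text \<open>
  For the operator \<open>A (I - Q)\<close>, whose part on the range of \<open>Q\<close> is zero.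
\<close>

lemma Riesz_const_zero:
  fixes X :: "'a::complex_banach set"
  assumes X: "closed_csubspace X"
  shows "Riesz X (\<lambda>x. 0)"
proof -
  have sX: "csubspace X" using X by (simp add: closed_csubspace_def)
  have "finite_dim (null_space X (shift (\<lambda>x. 0) z)) \<and> finite_codim X (shift (\<lambda>x. 0) z ` X)" if z: "z \<noteq> 0" for z
  proof -
    have "null_space X (shift (\<lambda>x. 0) z) \<subseteq> cspan {}" using z by (auto simp: null_space_def shift_def)
    then have "finite_dim (null_space X (shift (\<lambda>x. 0) z))" unfolding finite_dim_def by blast
    moreover have "x \<in> shift (\<lambda>x. 0) z ` X" if "x \<in> X" for x
    proof
      show "x = shift (\<lambda>x. 0) z ((- inverse z) *\<^sub>C x)" using z by (simp add: shift_def)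
      show "(- inverse z) *\<^sub>C x \<in> X" using sX that by (rule complex_vector.subspace_scale)
    qed
    moreover have "shift (\<lambda>x. 0) z ` X \<subseteq> X"
      using bounded_ops_mem[OF bounded_ops_shift[OF sX bounded_ops_const_zero[OF sX]]] by blast
    ultimately show ?thesis using finite_codim_self[of X] by (metis subsetI subset_antisym)
  qed
  then show ?thesis unfolding Riesz_iff[OF X bounded_ops_const_zero[OF sX]] by blast
qed

text \<open>
  For an operator that is onto, the Kato condition is automatic, and the complement of the null space
  provides the right inverse.
\<close>

lemma Saphar_onto_iff:
  fixes X :: "'a::complex_banach set"
  assumes X: "closed_csubspace X" and T: "T \<in> bounded_ops X"
  shows "right_invertible X T \<longleftrightarrow> Saphar X T \<and> T ` X = X"
proof
  assume "Saphar X T \<and> T ` X = X"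
  then show "right_invertible X T" by (simp add: right_invertible_iff[OF X T] Saphar_def)
next
  assume "right_invertible X T"
  then have TX: "T ` X = X" and c: "complemented X (null_space X T)"
    by (simp_all add: right_invertible_iff[OF X T])
  have Tn: "(T ^^ n) ` X = X" for n
  proof (induction n)
    case (Suc n)
    have "(T ^^ Suc n) ` X = T ` ((T ^^ n) ` X)" by (simp add: image_comp)
    then show ?case using Suc TX by simp
  qed simp
  have "complemented X X" using complemented_iff_projection[OF X] projection_onto_self by blast
  then show "Saphar X T \<and> T ` X = X"
    using X TX c Tn by (auto simp: Saphar_def Kato_def null_space_def closed_csubspace_def)
qed

context reducing
begin

lemma reducing_of:
  assumes "S \<in> bounded_ops X" "\<And>x. x \<in> M \<Longrightarrow> S x \<in> M" "\<And>x. x \<in> N \<Longrightarrow> S x \<in> N"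
  shows "reducing X M N S"
  by unfold_locales (fact X M N direct assms(1) | use assms(2,3) in blast)+

lemma Riesz_N_iff:
  assumes "\<And>x. x \<in> X \<Longrightarrow> D x = T (x - Q x)"
  shows "Riesz X D \<longleftrightarrow> Riesz N T"
proof -
  have IQ: "(\<lambda>x. x - Q x) \<in> bounded_ops X" by (intro bounded_ops_minus sX bounded_ops_id Q_bounded)
  have D: "D \<in> bounded_ops X"
    using bounded_ops_compose[OF T IQ] bounded_ops_cong[of X D "\<lambda>x. T (x - Q x)"] assms sX by simp
  have T0: "T 0 = 0" using T sX by (rule bounded_ops_zero)
  have DM: "D x = 0" if "x \<in> M" for x using assms[of x] that MX Q_id T0 by auto
  have DN: "D x = T x" if "x \<in> N" for x using assms[of x] that NX Q(3) by auto
  have red: "reducing X M N D"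
    using DM DN TN complex_vector.subspace_0[OF sM] by (intro reducing_of D) auto
  have "Riesz M D" using Riesz_cong[of M D "\<lambda>x. 0"] DM Riesz_const_zero[OF M] by simp
  moreover have "Riesz N D \<longleftrightarrow> Riesz N T" using DN by (rule Riesz_cong)
  ultimately show ?thesis
    using reducing.Riesz_X[OF red] reducing.Riesz_M[OF reducing.swap[OF red]] by blast
qed

text \<open>
  Both summands of \<open>T - z I\<close> are right Browder: on \<open>M\<close> it stays right invertible for small \<open>z\<close>, and on \<open>N\<close>
  the theory of Riesz operators applies to every nonzero \<open>z\<close>.
\<close>

lemma right_Browder_punctured_of_decomposition:
  assumes "right_invertible M T" "Riesz N T"
  obtains e where "e > 0" "\<And>z. z \<noteq> 0 \<Longrightarrow> cmod z < e \<Longrightarrow> right_Browder X (shift T z)"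
proof -
  obtain e where e: "e > 0" "\<And>z. cmod z < e \<Longrightarrow> right_invertible M (shift T z)"
    by (rule right_invertible_perturb[OF M T_M assms(1)]) (rule that)
  have "right_Browder X (shift T z)" if z: "z \<noteq> 0" "cmod z < e" for z
    by (rule reducing.right_Browder_X[OF reducing_shift
        right_invertible_imp_right_Browder[OF M bounded_ops_shift[OF sM T_M] e(2)[OF z(2)]]
        Riesz_imp_right_Browder[OF N T_N assms(2) z(1)]])
  then show ?thesis using that e(1) by blast
qed

text \<open>
  Starting from a small \<open>a\<close> for which \<open>T - a I\<close> is right Browder, a further small shift by \<open>b\<close> makes
  the operator right invertible.
\<close>

lemma right_invertible_near_of_decomposition:
  assumes "right_invertible M T" "Riesz N T" "r > 0"
  obtains z where "z \<noteq> 0" "cmod z < r" "right_invertible X (shift T z)"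
proof -
  obtain e where e: "e > 0" "\<And>z. z \<noteq> 0 \<Longrightarrow> cmod z < e \<Longrightarrow> right_Browder X (shift T z)"
    by (rule right_Browder_punctured_of_decomposition[OF assms(1,2)]) (rule that)
  define a where "a = min e r / 2"
  have a: "a > 0" "a < e" "a < r" using e(1) assms(3) by (auto simp: a_def)
  have "right_Browder X (shift T (of_real a))" using e(2)[of "of_real a"] a by simp
  then obtain d where d: "d > 0" "\<And>z. z \<noteq> 0 \<Longrightarrow> cmod z < d \<Longrightarrow> right_invertible X (shift (shift T (of_real a)) z)"
    by (rule right_Browder_punctured[OF X bounded_ops_shift[OF sX T]]) (rule that)
  define b where "b = min d (r - a) / 2"
  have b: "b > 0" "b < d" "b < r - a" using d(1) a by (auto simp: b_def)
  have "right_invertible X (shift T (of_real (a + b)))"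
    using d(2)[of "of_real b"] b by (simp add: shift_shift)
  then show ?thesis using that[of "of_real (a + b)"] a b by (simp del: of_real_add)
qed

lemma not_right_invertible_spreads:
  assumes "Saphar M T" "\<not> right_invertible M T"
  obtains e where "e > 0" "\<And>z. cmod z < e \<Longrightarrow> \<not> X \<subseteq> closure (shift T z ` X)"
    "\<And>z. cmod z < e \<Longrightarrow> descent X (shift T z) = \<infinity>"
proof -
  have "T ` M \<noteq> M" using assms Saphar_onto_iff[OF M T_M] by simp
  obtain e where e: "e > 0" "\<And>z. cmod z < e \<Longrightarrow> \<not> M \<subseteq> closure (shift T z ` M)"
    "\<And>z. cmod z < e \<Longrightarrow> descent M (shift T z) = \<infinity>"
    by (rule Saphar_not_onto_near[OF M T_M assms(1) \<open>T ` M \<noteq> M\<close>]) (rule that)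
  have "\<not> X \<subseteq> closure (shift T z ` X)" if "cmod z < e" for z
    using reducing.dense_range_M[OF reducing_shift] e(2)[OF that] by blast
  moreover have "descent X (shift T z) = \<infinity>" if "cmod z < e" for z
    using reducing.descent_finite_M[OF reducing_shift, of z] e(3)[OF that] by (cases "descent X (shift T z)") auto
  ultimately show ?thesis using that[OF e(1)] by blast
qed

end

lemma projector_reducing:
  fixes T :: "'a::complex_banach \<Rightarrow> 'a"
  assumes P: "projector P" and T: "T \<in> bounded_ops UNIV" and PT: "\<And>x. P (T x) = T (P x)"
  shows "reducing UNIV (range P) (null_space UNIV P) T"
proof -
  have PB: "P \<in> bounded_ops UNIV" and PP: "\<And>x. P (P x) = P x"
    using P by (auto simp: projector_def fun_eq_iff)
  have P0: "P 0 = 0" using bounded_ops_zero[OF PB] by simp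
  have dif: "P (x - y) = P x - P y" for x y using bounded_ops_diff[OF PB] by simp
  have "projection_onto UNIV (range P) P" using PB PP by (auto simp: projection_onto_def)
  then have R: "closed_csubspace (range P)" by (rule projection_onto_closed[OF closed_csubspace_UNIV])
  have N: "closed_csubspace (null_space UNIV P)" by (rule closed_csubspace_null_space[OF closed_csubspace_UNIV PB])
  have "range P + null_space UNIV P = UNIV"
  proof (intro equalityI subsetI UNIV_I)
    fix x
    have "P x + (x - P x) \<in> range P + null_space UNIV P"
      by (intro set_plus_intro) (auto simp: null_space_def dif PP)
    then show "x \<in> range P + null_space UNIV P" by simp
  qed
  moreover have "range P \<inter> null_space UNIV P = {0}"
  proof
    show "range P \<inter> null_space UNIV P \<subseteq> {0}" using PP by (auto simp: null_space_def)
    show "{0} \<subseteq> range P \<inter> null_space UNIV P" using P0 by (auto simp: null_space_def intro: range_eqI[of 0 P 0])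
  qed
  ultimately have "direct_sum UNIV (range P) (null_space UNIV P)" by (simp add: direct_sum_def)
  moreover have "T ` range P \<subseteq> range P" by (auto simp: PT[symmetric])
  moreover have "T ` null_space UNIV P \<subseteq> null_space UNIV P"
    using bounded_ops_zero[OF T] by (auto simp: null_space_def PT)
  ultimately show ?thesis using R N T by (simp add: reducing_def)
qed

text \<open>
  A finite-dimensional summand \<open>N1\<close> of \<open>X1\<close> can be moved over to \<open>X2\<close>; finite dimension keeps the sum
  closed.
\<close>

lemma reducing_refine:
  assumes red1: "reducing X X1 X2 T" and red2: "reducing X1 M N1 T" and fd: "finite_dim N1"
  shows "reducing X M (X2 + N1) T" "reducing (X2 + N1) X2 N1 T"
proof -
  interpret r1: reducing X X1 X2 T by (rule red1)
  interpret r2: reducing X1 M N1 T by (rule red2)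
  obtain G where G: "finite G" "cspan G = N1" using finite_dim_basis[OF fd r2.sN] by metis
  have N: "closed_csubspace (X2 + N1)"
    using closed_span_Un_finite[OF r1.N G(1)] span_Un_eq_sum[OF r1.sN, of G] G(2) by simp
  have s1: "X1 + X2 = X" "X1 \<inter> X2 = {0}" and s2: "M + N1 = X1" "M \<inter> N1 = {0}"
    using r1.direct r2.direct by (auto simp: direct_sum_def)
  have TN: "T ` (X2 + N1) \<subseteq> X2 + N1"
  proof
    fix y assume "y \<in> T ` (X2 + N1)"
    then obtain a b where ab: "a \<in> X2" "b \<in> N1" "y = T (a + b)" by (auto simp: set_plus_def)
    have "a \<in> X" "b \<in> X" using ab(1,2) r1.NX r2.NX r1.MX by auto
    then have "y = T a + T b" using ab(3) bounded_ops_add[OF r1.T] by simp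
    then show "y \<in> X2 + N1" using ab(1,2) r1.TN r2.TN by (auto intro: set_plus_intro)
  qed
  have NX: "X2 + N1 \<subseteq> X"
    using r1.NX r2.NX r1.MX r1.sX by (auto simp: set_plus_def subset_iff intro!: complex_vector.subspace_add)
  have "M + (X2 + N1) = X" using s1 s2 by (simp add: ac_simps) (metis add.assoc add.commute)
  moreover have "m = 0" if m: "m \<in> M" "m \<in> X2 + N1" for m
  proof -
    obtain a b where ab: "a \<in> X2" "b \<in> N1" "m = a + b" using m(2) by (auto simp: set_plus_def)
    have "m - b \<in> X1" using m(1) ab(2) r2.MX r2.NX r1.sM by (auto intro: complex_vector.subspace_diff)
    then have "a \<in> X1 \<inter> X2" using ab by simp
    then have "a = 0" using s1(2) by simp
    then have "m \<in> M \<inter> N1" using m(1) ab by simp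
    then show "m = 0" using s2(2) by simp
  qed
  then have "M \<inter> (X2 + N1) = {0}"
    using complex_vector.subspace_0[OF r2.sM] N by (auto simp: closed_csubspace_def complex_vector.subspace_0)
  ultimately have "direct_sum X M (X2 + N1)" by (simp add: direct_sum_def)
  then show "reducing X M (X2 + N1) T"
    using r1.X r2.M N r1.T r2.TM TN by (simp add: reducing_def)
  have "X2 \<inter> N1 = {0}"
    using s1(2) r2.NX complex_vector.subspace_0[OF r1.sN] complex_vector.subspace_0[OF r2.sN] by blast
  then have "direct_sum (X2 + N1) X2 N1" by (simp add: direct_sum_def)
  then show "reducing (X2 + N1) X2 N1 T"
    using N r1.N r2.N bounded_ops_subset[OF r1.T NX TN] r1.TN r2.TN by (simp add: reducing_def)
qed

section \<open>Characterizations by idempotents and by Browder operators\<close>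

text \<open>
  This condition is the pivot: each of the other conditions is shown to be equivalent to it.
\<close>

definition right_Riesz_decomposable :: "('a::complex_banach \<Rightarrow> 'a) \<Rightarrow> bool"
  where "right_Riesz_decomposable A \<longleftrightarrow>
    (\<exists>M N. reducing UNIV M N A \<and> right_invertible M A \<and> Riesz N A)"

lemma Red_iff_reducing:
  "A \<in> bounded_ops UNIV \<Longrightarrow> (M, N) \<in> Red UNIV A \<longleftrightarrow> reducing UNIV M N A"
  by (auto simp: Red_def reducing_def)

lemma decomposable_iff_Red:
  assumes "A \<in> bounded_ops UNIV"
  shows "(\<exists>(M, N)\<in>Red UNIV A. right_invertible M A \<and> Riesz N A) \<longleftrightarrow> right_Riesz_decomposable A"
  unfolding right_Riesz_decomposable_def using Red_iff_reducing[OF assms] by (auto simp: Bex_def)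

lemma admits_GSRD_iff:
  assumes "A \<in> bounded_ops UNIV"
  shows "admits_GSRD UNIV A \<longleftrightarrow> (\<exists>M N. reducing UNIV M N A \<and> Saphar M A \<and> Riesz N A)"
  unfolding admits_GSRD_def using Red_iff_reducing[OF assms] by (auto simp: Bex_def)

lemma decomposable_imp_GSRD:
  assumes A: "A \<in> bounded_ops UNIV" and "right_Riesz_decomposable A"
  shows "admits_GSRD UNIV A"
proof -
  obtain M N where red: "reducing UNIV M N A" and "right_invertible M A" and N: "Riesz N A"
    using assms by (auto simp: right_Riesz_decomposable_def)
  then have "Saphar M A" using Saphar_onto_iff[OF reducing.M[OF red] reducing.T_M[OF red]] by simp
  then show ?thesis using admits_GSRD_iff[OF A] red N by blast
qed

text \<open>
  If \<open>S\<close> is a right inverse of \<open>A\<close> on \<open>M\<close>, then \<open>B = S Q\<close> satisfies \<open>A B = Q\<close> and \<open>Q B = B = B Q\<close>.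
\<close>

lemma decomposable_imp_generalized_inverse:
  assumes A: "A \<in> bounded_ops UNIV" and "right_Riesz_decomposable A"
  obtains B Q where "B \<in> bounded_ops UNIV" "projector Q" "\<And>x. A (B x) = Q x" "\<And>x. Q (B x) = B x"
    "\<And>x. B (Q x) = B x" "\<And>x. A (Q x) = Q (A x)" "Riesz UNIV (\<lambda>x. A (x - Q x))"
proof -
  obtain M N where red: "reducing UNIV M N A" and inv: "right_invertible M A" and Rz: "Riesz N A"
    using assms by (auto simp: right_Riesz_decomposable_def)
  interpret reducing UNIV M N A by (rule red)
  obtain S where S: "S \<in> bounded_ops M" "\<And>x. x \<in> M \<Longrightarrow> A (S x) = x"
    using inv by (auto simp: right_invertible_def)
  have QM: "Q x \<in> M" for x using Q_mem by simp
  have SM: "S (Q x) \<in> M" for x using bounded_ops_mem[OF S(1) QM] .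
  show ?thesis
  proof (rule that)
    show "(\<lambda>x. S (Q x)) \<in> bounded_ops UNIV"
      using bounded_ops_glue[OF S(1) bounded_ops_const_zero[OF sN]] by simp
    show "projector Q" using Q_bounded Q_id[OF QM] by (simp add: projector_def fun_eq_iff)
    show "A (S (Q x)) = Q x" "Q (S (Q x)) = S (Q x)" "S (Q (Q x)) = S (Q x)" "A (Q x) = Q (A x)" for x
      using S(2)[OF QM] Q_id[OF SM] Q_id[OF QM] T_Q by simp_all
    show "Riesz UNIV (\<lambda>x. A (x - Q x))" using Riesz_N_iff[of "\<lambda>x. A (x - Q x)"] Rz by simp
  qed
qed

text \<open>
  On the range of \<open>Q = A B\<close> the operator \<open>Q B\<close> is a right inverse of \<open>A\<close>, and on the null space of \<open>Q\<close> the
  operators \<open>A\<close> and \<open>A (I - Q)\<close> agree.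
\<close>

lemma decomposable_of_projector:
  assumes A: "A \<in> bounded_ops UNIV" and Q: "projector Q" and AQ: "\<And>x. A (Q x) = Q (A x)"
    and B: "B \<in> bounded_ops UNIV" and AB: "\<And>x. A (B x) = Q x"
    and R: "Riesz UNIV D" and D: "\<And>x. D x = A (x - Q x)"
  shows "right_Riesz_decomposable A"
proof -
  have QB: "Q \<in> bounded_ops UNIV" and QQ: "\<And>x. Q (Q x) = Q x"
    using Q by (auto simp: projector_def fun_eq_iff)
  interpret r: reducing UNIV "range Q" "null_space UNIV Q" A
    by (rule projector_reducing[OF Q A]) (simp add: AQ)
  have rQ: "r.Q x = Q x" for x
  proof -
    have "Q x + (x - Q x) = x" by simp
    moreover have "x - Q x \<in> null_space UNIV Q"
      using bounded_ops_diff[OF QB, of x "Q x"] QQ by (simp add: null_space_def)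
    ultimately show ?thesis using r.Q_add[of "Q x" "x - Q x"] by simp
  qed
  have "right_invertible (range Q) A"
    unfolding right_invertible_def
  proof (intro bexI ballI)
    show "(\<lambda>x. Q (B x)) \<in> bounded_ops (range Q)"
      by (rule bounded_ops_subset[OF bounded_ops_compose[OF QB B]]) auto
    show "A (Q (B x)) = x" if "x \<in> range Q" for x using that AQ AB QQ by auto
  qed
  moreover have "Riesz (null_space UNIV Q) A" using r.Riesz_N_iff[of D] R D rQ by simp
  ultimately show ?thesis using r.reducing_axioms unfolding right_Riesz_decomposable_def by blast
qed

text \<open>
  The equations for \<open>B\<close> make \<open>A B\<close> a projector that commutes with \<open>A\<close>: \<open>A B A B = A A B B = A B\<close> and
  \<open>A (A B) = (A B) A\<close>.
\<close>

lemma generalized_Drazin_Riesz_iff: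
  assumes A: "A \<in> bounded_ops UNIV"
  shows "(\<exists>B\<in>bounded_ops UNIV. A \<circ> B \<circ> A = A \<circ> A \<circ> B \<and> A \<circ> B \<circ> B = B
       \<and> Riesz UNIV (\<lambda>x. A x - (A \<circ> B \<circ> A) x)) \<longleftrightarrow> right_Riesz_decomposable A" (is "?l \<longleftrightarrow> ?r")
    and "(\<exists>C\<in>bounded_ops UNIV. A \<circ> C \<circ> A = A \<circ> A \<circ> C \<and> A \<circ> C \<circ> C = C \<and> C = C \<circ> A \<circ> C
       \<and> Riesz UNIV (\<lambda>x. A x - (A \<circ> C \<circ> A) x)) \<longleftrightarrow> right_Riesz_decomposable A" (is "?l' \<longleftrightarrow> ?r")
proof -
  have dif: "A (x - y) = A x - A y" for x y using bounded_ops_diff[OF A] by simp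
  have 1: "?r" if l: "?l"
  proof -
    obtain B where B: "B \<in> bounded_ops UNIV" and eq: "A \<circ> B \<circ> A = A \<circ> A \<circ> B" "A \<circ> B \<circ> B = B"
      and R: "Riesz UNIV (\<lambda>x. A x - (A \<circ> B \<circ> A) x)" using l by blast
    have c: "A (B (A x)) = A (A (B x))" "A (B (B x)) = B x" for x
      using fun_cong[OF eq(1), of x] fun_cong[OF eq(2), of x] by simp_all
    show ?thesis
    proof (rule decomposable_of_projector[OF A _ _ B _ R])
      show "projector (\<lambda>x. A (B x))"
        using bounded_ops_compose[OF A B] c by (simp add: projector_def fun_eq_iff)
      show "A x - (A \<circ> B \<circ> A) x = A (x - A (B x))" for x using c by (simp add: dif)
    qed (use c in auto)
  qed
  have 2: "?l'" if r: "?r"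
  proof -
    obtain B Q where B: "B \<in> bounded_ops UNIV" "\<And>x. A (B x) = Q x" "\<And>x. Q (B x) = B x"
      "\<And>x. B (Q x) = B x" "\<And>x. A (Q x) = Q (A x)" "Riesz UNIV (\<lambda>x. A (x - Q x))"
      by (rule decomposable_imp_generalized_inverse[OF A r]) (rule that)
    have "(\<lambda>x. A x - (A \<circ> B \<circ> A) x) = (\<lambda>x. A (x - Q x))"
      using B by (simp add: fun_eq_iff dif)
    then show ?thesis using B by (intro bexI[of _ B]) (simp_all add: fun_eq_iff)
  qed
  have 3: "?l" if "?l'" using that by blast
  show "?l \<longleftrightarrow> ?r" "?l' \<longleftrightarrow> ?r" using 1 2 3 by blast+
qed

lemma right_Riesz_quasipolar_iff:
  assumes A: "A \<in> bounded_ops UNIV"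
  shows "right_Riesz_quasipolar A \<longleftrightarrow> right_Riesz_decomposable A"
proof
  assume "right_Riesz_quasipolar A"
  then obtain Q T where Q: "projector Q" "A \<circ> Q = Q \<circ> A" "Riesz UNIV (A \<circ> (\<lambda>x. x - Q x))"
    "T \<in> bounded_ops UNIV" "Q = A \<circ> T" by (auto simp: right_Riesz_quasipolar_def)
  show "right_Riesz_decomposable A"
    by (rule decomposable_of_projector[OF A Q(1) _ Q(4) _ Q(3)]) (use Q(2,5) in \<open>simp_all add: fun_eq_iff\<close>)
next
  assume "right_Riesz_decomposable A"
  then obtain B Q where B: "B \<in> bounded_ops UNIV" "projector Q" "\<And>x. A (B x) = Q x"
      "\<And>x. A (Q x) = Q (A x)" "Riesz UNIV (\<lambda>x. A (x - Q x))"
    by (rule decomposable_imp_generalized_inverse[OF A]) (rule that)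
  then show "right_Riesz_quasipolar A"
    unfolding right_Riesz_quasipolar_def
    by (intro exI[of _ Q] conjI bexI[of _ B]) (simp_all add: fun_eq_iff comp_def)
qed

text \<open>
  With \<open>P = I - Q\<close> the operators \<open>A + P\<close> and \<open>A (I - P) + P\<close> are both \<open>A\<close> on \<open>M\<close>; on \<open>N\<close> they are \<open>A + I\<close>,
  which is right Browder by the theory of Riesz operators, and the identity.
\<close>

lemma decomposable_imp_Browder_perturbation:
  assumes A: "A \<in> bounded_ops UNIV" and "right_Riesz_decomposable A"
  obtains P where "projector P" "A \<circ> P = P \<circ> A" "Riesz UNIV (A \<circ> P)"
    "right_Browder UNIV (\<lambda>x. A x + P x)" "right_Browder UNIV (\<lambda>x. A (x - P x) + P x)"
proof -
  obtain M N where red: "reducing UNIV M N A" and inv: "right_invertible M A" and Rz: "Riesz N A"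
    using assms by (auto simp: right_Riesz_decomposable_def)
  interpret reducing UNIV M N A by (rule red)
  define P where "P x = x - Q x" for x
  have PB: "P \<in> bounded_ops UNIV" unfolding P_def by (intro bounded_ops_minus bounded_ops_id Q_bounded) simp
  have PM: "P x = 0" if "x \<in> M" for x using Q_id[OF that] by (simp add: P_def)
  have PN: "P x = x" if "x \<in> N" for x using Q(3)[OF that] by (simp add: P_def)
  have Pmem: "P x \<in> N" for x using Q(2) by (simp add: P_def)
  have AP: "A (P x) = P (A x)" for x
    using bounded_ops_diff[OF T sX, of x "Q x"] T_Q by (simp add: P_def)
  have A0: "A 0 = 0" using bounded_ops_zero[OF A] by simp
  have BM: "right_Browder M A" by (rule right_invertible_imp_right_Browder[OF M T_M inv])
  show ?thesis
  proof (rule that)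
    show "projector P" using PB PN[OF Pmem] by (simp add: projector_def fun_eq_iff)
    show "A \<circ> P = P \<circ> A" using AP by (simp add: fun_eq_iff)
    show "Riesz UNIV (A \<circ> P)" using Riesz_N_iff[of "A \<circ> P"] Rz by (simp add: P_def)
    let ?S = "\<lambda>x. A x + P x"
    have S: "?S \<in> bounded_ops UNIV" by (intro bounded_ops_plus A PB) simp
    have r: "reducing UNIV M N ?S"
      using PM PN TM TN sN by (intro reducing_of S) (auto intro: complex_vector.subspace_add)
    have "right_Browder M ?S"
      using right_Browder_cong[OF T_M, of ?S] BM PM by simp
    moreover have "right_Browder N ?S"
      using right_Browder_cong[OF bounded_ops_shift[OF sN T_N], of "-1" ?S]
        Riesz_imp_right_Browder[OF N T_N Rz, of "-1"] PN by (simp add: shift_def)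
    ultimately show "right_Browder UNIV ?S" by (rule reducing.right_Browder_X[OF r])
    let ?V = "\<lambda>x. A (x - P x) + P x"
    have V: "?V \<in> bounded_ops UNIV"
      by (intro bounded_ops_plus bounded_ops_compose[OF A] bounded_ops_minus bounded_ops_id PB) simp_all
    have VN: "?V x = x" if "x \<in> N" for x using PN[OF that] A0 by simp
    have r: "reducing UNIV M N ?V"
      using PM VN TM by (intro reducing_of V) auto
    have "right_Browder M ?V" using right_Browder_cong[OF T_M, of ?V] BM PM by simp
    moreover have "right_invertible N (\<lambda>x. x)"
      unfolding right_invertible_def by (intro bexI[of _ "\<lambda>x. x"] bounded_ops_id) simp
    then have "right_Browder N (\<lambda>x. x)" by (rule right_invertible_imp_right_Browder[OF N bounded_ops_id])
    then have "right_Browder N ?V" using right_Browder_cong[OF bounded_ops_id[of N], of ?V] VN by simp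
    ultimately show "right_Browder UNIV ?V" by (rule reducing.right_Browder_X[OF r])
  qed
qed

text \<open>
  On the null space of \<open>P\<close> the operator \<open>A\<close> equals \<open>C\<close>, which splits there into a right invertible and a
  finite-dimensional part.  The latter, together with the range of \<open>P\<close>, on which \<open>A\<close> equals \<open>D\<close>, forms
  the Riesz part of \<open>A\<close>.
\<close>

lemma Browder_Riesz_splitting_imp_decomposable:
  assumes A: "A \<in> bounded_ops UNIV" and C: "C \<in> bounded_ops UNIV" and D: "D \<in> bounded_ops UNIV"
    and P: "projector P" and B: "right_Browder UNIV C" and Rz: "Riesz UNIV D"
    and PC: "P \<circ> C = C \<circ> P" and PD: "P \<circ> D = D \<circ> P" and AE: "A = (\<lambda>x. C (x - P x) + D (P x))"
  shows "right_Riesz_decomposable A"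
proof -
  have PB: "P \<in> bounded_ops UNIV" and PP: "\<And>x. P (P x) = P x" using P by (auto simp: projector_def fun_eq_iff)
  have zero: "C 0 = 0" "D 0 = 0" using bounded_ops_zero[OF C] bounded_ops_zero[OF D] by simp_all
  let ?X2 = "range P" and ?X1 = "null_space UNIV P"
  have AC: "A x = C x" if "x \<in> ?X1" for x using that zero by (simp add: AE null_space_def)
  have AD: "A x = D x" if "x \<in> ?X2" for x using that zero PP by (auto simp: AE)
  interpret rC: reducing UNIV ?X1 ?X2 C
    by (rule reducing.swap[OF projector_reducing[OF P C]]) (use PC in \<open>simp add: fun_eq_iff\<close>)
  interpret rD: reducing UNIV ?X1 ?X2 D
    by (rule reducing.swap[OF projector_reducing[OF P D]]) (use PD in \<open>simp add: fun_eq_iff\<close>)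
  have rA: "reducing UNIV ?X1 ?X2 A"
  proof (rule rC.reducing_of[OF A])
    show "A x \<in> ?X1" if "x \<in> ?X1" for x using AC[OF that] rC.TM that by auto
    show "A x \<in> ?X2" if "x \<in> ?X2" for x using AD[OF that] rD.TN that by auto
  qed
  have "right_Browder ?X1 C" by (rule rC.right_Browder_M[OF B])
  then have "right_Browder ?X1 A" using right_Browder_cong[OF rC.T_M] AC by metis
  then obtain M N where red: "reducing ?X1 M N A" and inv: "right_invertible M A" and fd: "finite_dim N"
    by (rule right_Browder_decomposition[OF reducing.M[OF rA] reducing.T_M[OF rA]]) (rule that)
  note r = reducing_refine[OF rA red fd]
  have "Riesz ?X2 D" by (rule reducing.Riesz_M[OF rD.swap Rz])
  then have "Riesz ?X2 A" using Riesz_cong[of ?X2 A D] AD by blast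
  moreover have "Riesz N A" by (rule finite_dim_imp_Riesz[OF reducing.N[OF red] reducing.T_N[OF red] fd])
  ultimately have "Riesz (?X2 + N) A" by (rule reducing.Riesz_X[OF r(2)])
  then show ?thesis using r(1) inv unfolding right_Riesz_decomposable_def by blast
qed

section \<open>The single-valued extension property of the dual operator\<close>

text \<open>
  If \<open>(A' - w) f w = 0\<close>, then \<open>f w\<close> vanishes on the range of \<open>A - w I\<close>, so \<open>f w = 0\<close> whenever \<open>A - w I\<close> is
  onto.  Such \<open>w\<close> accumulate at \<open>0\<close>, and the identity theorem for the scalar functions \<open>w \<mapsto> f w x\<close>
  concludes.
\<close>

lemma dual_SVEP_of_decomposition:
  fixes A :: "'a::complex_banach \<Rightarrow> 'a"
  assumes A: "A \<in> bounded_ops UNIV" and dec: "right_Riesz_decomposable A"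
  shows "SVEP dual_space (dual_op A) 0"
  unfolding SVEP_def
proof (intro allI impI ballI)
  fix r :: real and f :: "complex \<Rightarrow> 'a \<Rightarrow>\<^sub>L complex" and z :: complex
  assume r: "0 < r" and "f ` ball 0 r \<subseteq> dual_space \<and> vector_holomorphic_on f (ball 0 r) \<and>
      (\<forall>z\<in>ball 0 r. shift (dual_op A) z (f z) = 0)" and z: "z \<in> ball 0 r"
  then have fd: "\<And>z. z \<in> ball 0 r \<Longrightarrow> f z \<in> dual_space"
    and hol: "\<And>z. z \<in> ball 0 r \<Longrightarrow> \<exists>f'. (f has_derivative (\<lambda>h. h *\<^sub>C f')) (at z within ball 0 r)"
    and ker: "\<And>z. z \<in> ball 0 r \<Longrightarrow> shift (dual_op A) z (f z) = 0"
    by (auto simp: vector_holomorphic_on_def)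
  obtain M N where red: "reducing UNIV M N A" and inv: "right_invertible M A" and Rz: "Riesz N A"
    using dec by (auto simp: right_Riesz_decomposable_def)
  define U where "U = {w \<in> ball 0 r. right_invertible UNIV (shift A w)}"
  have "blinfun_apply (f z) x = 0" for x
  proof (rule analytic_continuation[where S = "ball 0 r" and U = U and \<xi> = 0
        and f = "\<lambda>w. blinfun_apply (f w) x" and w = z])
    show "(\<lambda>w. blinfun_apply (f w) x) holomorphic_on ball 0 r"
      unfolding holomorphic_on_def field_differentiable_def
    proof
      fix w :: complex assume w: "w \<in> ball 0 r"
      obtain f' where "(f has_derivative (\<lambda>h. h *\<^sub>C f')) (at w within ball 0 r)" using hol[OF w] by blast
      then have "((\<lambda>w. blinfun_apply (f w) x) has_derivative (\<lambda>h. blinfun_apply (h *\<^sub>C f') x))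
          (at w within ball 0 r)"
        by (rule bounded_linear.has_derivative[OF blinfun.bounded_linear_left])
      then have "((\<lambda>w. blinfun_apply (f w) x) has_field_derivative blinfun_apply f' x) (at w within ball 0 r)"
        by (simp add: has_field_derivative_def scaleC_complex_def mult_commute_abs)
      then show "\<exists>D. ((\<lambda>w. blinfun_apply (f w) x) has_field_derivative D) (at w within ball 0 r)" by blast
    qed
    show "0 islimpt U"
      unfolding islimpt_approachable
    proof (intro allI impI)
      fix e :: real assume "e > 0"
      then have "min e r > 0" using r by simp
      then obtain w where w: "w \<noteq> 0" "cmod w < min e r" "right_invertible UNIV (shift A w)"
        by (rule reducing.right_invertible_near_of_decomposition[OF red inv Rz]) (rule that)
      then show "\<exists>w\<in>U. w \<noteq> 0 \<and> dist w 0 < e" by (intro bexI[of _ w]) (auto simp: U_def)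
    qed
    show "blinfun_apply (f w) x = 0" if "w \<in> U" for w
    proof -
      have w: "w \<in> ball 0 r" "right_invertible UNIV (shift A w)" using that by (auto simp: U_def)
      obtain y where y: "shift A w y = x" using w(2) by (auto simp: right_invertible_def)
      have "blinfun_apply (shift (dual_op A) w (f w)) y = 0" using ker[OF w(1)] by simp
      then show ?thesis
        using fd[OF w(1)] y[symmetric]
        by (simp add: shift_def blinfun.diff_left blinfun.diff_right dual_op_apply[OF A] dual_space_def scaleC_complex_def)
    qed
  qed (use r z in \<open>auto simp: U_def\<close>)
  then show "f z = 0" by (intro blinfun_eqI) simp
qed

lemma has_derivative_of_quadratic_bound:
  fixes f :: "complex \<Rightarrow> 'b::complex_normed_vector"
  assumes "\<And>y. y \<in> S \<Longrightarrow> norm (f y - f x - (y - x) *\<^sub>C f') \<le> C * cmod (y - x) ^ 2"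
  shows "(f has_derivative (\<lambda>h. h *\<^sub>C f')) (at x within S)"
proof (rule has_derivativeI_sandwich[where e = 1 and H = "\<lambda>y. C * cmod (y - x)"])
  show "bounded_linear (\<lambda>h. h *\<^sub>C f')"
    by (rule bounded_linear_intro[where K = "norm f'"])
      (simp_all add: scaleC_add_left scaleR_scaleC norm_scaleC scaleC_complex_def)
  show "norm ((f y - f x) - (y - x) *\<^sub>C f') / norm (y - x) \<le> C * cmod (y - x)"
    if "y \<in> S" "y \<noteq> x" for y
    using assms[OF that(1)] that(2) by (simp add: pos_divide_le_eq power2_eq_square mult.assoc)
  show "((\<lambda>y. C * cmod (y - x)) \<longlongrightarrow> 0) (at x within S)"
    by (rule tendsto_eq_intros | simp)+
qed simp

text \<open>
  With the operators of the lemma on the resolvent of Saphar operators and a functional \<open>\<phi>\<close> that does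
  not vanish at \<open>F w\<close>, the functionals \<open>f z = \<phi> \<circ> F \<circ> R z \<circ> Q\<close> depend analytically on \<open>z\<close> and vanish on the
  range of \<open>A - z I\<close>, but \<open>f 0\<close> is not zero.  The resolvent identity
  \<open>R y - R z = (y - z) R\<^sub>y S R\<^sub>z\<close>, applied twice, gives the derivative \<open>\<phi> \<circ> F \<circ> R z S R z \<circ> Q\<close> with a quadratic
  error bound.
\<close>

lemma not_dual_SVEP:
  fixes A :: "'a::complex_banach \<Rightarrow> 'a"
  assumes red: "reducing UNIV M N A" and Sa: "Saphar M A" and ni: "\<not> right_invertible M A"
  shows "\<not> SVEP dual_space (dual_op A) 0"
proof
  assume svep: "SVEP dual_space (dual_op A) 0"
  interpret reducing UNIV M N A by (rule red)
  have "A ` M \<noteq> M" using Sa ni Saphar_onto_iff[OF M T_M] by simp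
  obtain e F S R w where e: "e > 0" and F: "F \<in> bounded_ops M" and S: "S \<in> bounded_ops M"
    and w: "w \<in> M" "F w \<noteq> 0"
    and R: "\<And>z. cmod z < e \<Longrightarrow> R z \<in> bounded_ops M"
    and Rn: "\<And>z y. cmod z < e \<Longrightarrow> y \<in> M \<Longrightarrow> norm (R z y) \<le> 2 * norm y"
    and R1: "\<And>z y. cmod z < e \<Longrightarrow> y \<in> M \<Longrightarrow> R z y = y + z *\<^sub>C S (R z y)"
    and R2: "\<And>z y. cmod z < e \<Longrightarrow> y \<in> M \<Longrightarrow> R z y = y + z *\<^sub>C R z (S y)"
    and FR: "\<And>z x. cmod z < e \<Longrightarrow> x \<in> M \<Longrightarrow> F (R z (shift A z x)) = 0"
    by (rule Saphar_resolvent[OF M T_M Sa \<open>A ` M \<noteq> M\<close>]) (rule that)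
  obtain \<phi> :: "'a \<Rightarrow> complex" where \<phi>: "bounded_linear \<phi>" "\<And>c x. \<phi> (c *\<^sub>C x) = c * \<phi> x" "\<phi> (F w) \<noteq> 0"
    using separating_functional[OF w(2)] by blast
  define functional where "functional G = Blinfun (\<lambda>x. \<phi> (F (G (Q x))))" for G :: "'a \<Rightarrow> 'a"
  have QM: "Q x \<in> M" for x using Q_mem by simp
  have app: "blinfun_apply (functional G) x = \<phi> (F (G (Q x)))" and dual: "functional G \<in> dual_space"
    if G: "G \<in> bounded_ops M" for G x
  proof -
    have "(\<lambda>x. F (G (Q x))) \<in> bounded_ops UNIV"
      using bounded_ops_glue[OF bounded_ops_compose[OF F G] bounded_ops_const_zero[OF sN]] by simp
    then have 1: "bounded_linear (\<lambda>x. F (G (Q x)))" and 2: "\<And>c x. F (G (Q (c *\<^sub>C x))) = c *\<^sub>C F (G (Q x))"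
      by (simp_all add: bounded_ops_UNIV_iff)
    have "bounded_linear (\<lambda>x. \<phi> (F (G (Q x))))" by (rule bounded_linear_compose[OF \<phi>(1) 1])
    then have ap: "blinfun_apply (functional G) x = \<phi> (F (G (Q x)))" for x
      by (simp add: functional_def bounded_linear_Blinfun_apply)
    show "blinfun_apply (functional G) x = \<phi> (F (G (Q x)))" by (rule ap)
    show "functional G \<in> dual_space" by (simp add: dual_space_def ap 2 \<phi>(2))
  qed
  define f where "f z = functional (R z)" for z
  have RM: "R z x \<in> M" if "cmod z < e" "x \<in> M" for z x using bounded_ops_mem[OF R] that by blast
  have SM: "S x \<in> M" if "x \<in> M" for x using bounded_ops_mem[OF S that] .
  have \<phi>_diff: "\<phi> (x - y) = \<phi> x - \<phi> y" for x y using linear_diff[OF bounded_linear.linear[OF \<phi>(1)]] .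
  have resolvent: "R y x - R z x = (y - z) *\<^sub>C R y (S (R z x))"
    if yz: "cmod y < e" "cmod z < e" and x: "x \<in> M" for y z x
  proof -
    define u where "u = R z x"
    have u: "u \<in> M" unfolding u_def by (rule RM[OF yz(2) x])
    have "x = u - z *\<^sub>C S u" unfolding u_def using R1[OF yz(2) x] by (simp add: eq_diff_eq)
    then have "R y x = R y u - z *\<^sub>C R y (S u)"
      using bounded_ops_diff[OF R[OF yz(1)] sM u, of "z *\<^sub>C S u"] bounded_ops_scale[OF R[OF yz(1)] SM[OF u]]
        complex_vector.subspace_scale[OF sM SM[OF u]] by simp
    also have "R y u = u + y *\<^sub>C R y (S u)" by (rule R2[OF yz(1) u])
    finally show ?thesis by (simp add: u_def[symmetric] complex_vector.scale_left_diff_distrib)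
  qed
  obtain KF where KF: "KF > 0" "\<And>x. x \<in> M \<Longrightarrow> norm (F x) \<le> KF * norm x" by (rule bounded_ops_bound[OF F]) (rule that)
  obtain KS where KS: "KS > 0" "\<And>x. x \<in> M \<Longrightarrow> norm (S x) \<le> KS * norm x" by (rule bounded_ops_bound[OF S]) (rule that)
  obtain KQ where KQ: "KQ > 0" "\<And>x. x \<in> UNIV \<Longrightarrow> norm (Q x) \<le> KQ * norm x"
    by (rule bounded_ops_bound[OF Q_bounded]) (rule that)
  obtain K\<phi> where K\<phi>: "K\<phi> > 0" "\<And>x. norm (\<phi> x) \<le> norm x * K\<phi>"
    using bounded_linear.pos_bounded[OF \<phi>(1)] by blast
  define K where "K = K\<phi> * (KF * (2 * (KS * (2 * (KS * (2 * KQ))))))"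
  have hol: "(f has_derivative (\<lambda>h. h *\<^sub>C functional (\<lambda>x. R z (S (R z x))))) (at z within ball 0 e)"
    if "z \<in> ball 0 e" for z :: complex
  proof (rule has_derivative_of_quadratic_bound[where C = K])
    fix y :: complex assume "y \<in> ball 0 e"
    then have yz: "cmod y < e" "cmod z < e" using that by auto
    have D: "(\<lambda>x. R z (S (R z x))) \<in> bounded_ops M"
      by (rule bounded_ops_compose[OF R[OF yz(2)] bounded_ops_compose[OF S R[OF yz(2)]]])
    show "norm (f y - f z - (y - z) *\<^sub>C functional (\<lambda>x. R z (S (R z x)))) \<le> K * cmod (y - z) ^ 2"
    proof (rule norm_blinfun_bound)
      show "0 \<le> K * cmod (y - z) ^ 2" using KF KS KQ K\<phi> by (simp add: K_def)
      fix x
      define q where "q = Q x"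
      define v where "v = S (R z q)"
      define t where "t = R y (S (R z v))"
      have q: "q \<in> M" unfolding q_def by (rule QM)
      have v: "v \<in> M" unfolding v_def by (intro SM RM yz q)
      have t: "t \<in> M" unfolding t_def by (intro SM RM yz v)
      have mem: "R y q \<in> M" "R z q \<in> M" "R y v \<in> M" "R z v \<in> M" by (intro RM yz q v)+
      have "R y q - R z q - (y - z) *\<^sub>C R z v = (y - z) *\<^sub>C (R y v - R z v)"
        unfolding resolvent[OF yz q] v_def[symmetric] by (simp add: complex_vector.scale_right_diff_distrib)
      also have "R y v - R z v = (y - z) *\<^sub>C t" unfolding t_def by (rule resolvent[OF yz v])
      finally have eq: "R y q - R z q - (y - z) *\<^sub>C R z v = (y - z)\<^sup>2 *\<^sub>C t"
        by (simp add: power2_eq_square)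
      have "blinfun_apply (f y - f z - (y - z) *\<^sub>C functional (\<lambda>x. R z (S (R z x)))) x
          = \<phi> (F (R y q)) - \<phi> (F (R z q)) - (y - z) * \<phi> (F (R z v))"
        by (simp add: f_def blinfun.diff_left app R yz app[OF D] q_def v_def scaleC_complex_def)
      also have "\<dots> = \<phi> (F (R y q - R z q - (y - z) *\<^sub>C R z v))"
        using mem sM by (simp add: bounded_ops_diff[OF F] bounded_ops_scale[OF F] \<phi>_diff \<phi>(2)
            complex_vector.subspace_diff complex_vector.subspace_scale)
      also have "\<dots> = (y - z)\<^sup>2 * \<phi> (F t)" unfolding eq by (simp add: bounded_ops_scale[OF F t] \<phi>(2))
      finally have val: "norm (blinfun_apply (f y - f z - (y - z) *\<^sub>C functional (\<lambda>x. R z (S (R z x)))) x)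
          = cmod (y - z) ^ 2 * norm (\<phi> (F t))" by (simp add: norm_mult norm_power)
      have "norm (\<phi> (F t)) \<le> K\<phi> * norm (F t)" using K\<phi>(2)[of "F t"] by (simp add: mult.commute)
      also have "\<dots> \<le> K\<phi> * (KF * norm t)" using K\<phi>(1) KF(2)[OF t] by simp
      also have "\<dots> \<le> K\<phi> * (KF * (2 * norm (S (R z v))))"
        unfolding t_def using K\<phi>(1) KF(1) by (intro mult_left_mono Rn yz SM mem) auto
      also have "\<dots> \<le> K\<phi> * (KF * (2 * (KS * norm (R z v))))"
        using K\<phi>(1) KF(1) by (intro mult_left_mono KS(2) mem) auto
      also have "\<dots> \<le> K\<phi> * (KF * (2 * (KS * (2 * norm v))))"
        using K\<phi>(1) KF(1) KS(1) by (intro mult_left_mono Rn yz v) auto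
      also have "\<dots> \<le> K\<phi> * (KF * (2 * (KS * (2 * (KS * norm (R z q))))))"
        unfolding v_def using K\<phi>(1) KF(1) KS(1) by (intro mult_left_mono KS(2) mem) auto
      also have "\<dots> \<le> K\<phi> * (KF * (2 * (KS * (2 * (KS * (2 * norm q))))))"
        using K\<phi>(1) KF(1) KS(1) by (intro mult_left_mono Rn yz q) auto
      also have "\<dots> \<le> K\<phi> * (KF * (2 * (KS * (2 * (KS * (2 * (KQ * norm x)))))))"
        unfolding q_def using K\<phi>(1) KF(1) KS(1) by (intro mult_left_mono KQ(2)) auto
      also have "\<dots> = K * norm x" by (simp add: K_def)
      finally have "norm (\<phi> (F t)) \<le> K * norm x" .
      then have "cmod (y - z) ^ 2 * norm (\<phi> (F t)) \<le> cmod (y - z) ^ 2 * (K * norm x)"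
        by (rule mult_left_mono) simp
      then show "norm (blinfun_apply (f y - f z - (y - z) *\<^sub>C functional (\<lambda>x. R z (S (R z x)))) x)
          \<le> K * cmod (y - z) ^ 2 * norm x"
        unfolding val by (simp only: mult_ac)
    qed
  qed
  have "shift (dual_op A) z (f z) = 0" if z: "z \<in> ball 0 e" for z
  proof (rule blinfun_eqI)
    fix x
    have z': "cmod z < e" using z by simp
    have AQ: "A (Q x) \<in> M" using QM TM by blast
    have "blinfun_apply (shift (dual_op A) z (f z)) x = \<phi> (F (R z (Q (A x)))) - z * \<phi> (F (R z (Q x)))"
      by (simp add: shift_def blinfun.diff_left dual_op_apply[OF T] f_def app[OF R[OF z']] scaleC_complex_def)
    also have "\<dots> = \<phi> (F (R z (A (Q x) - z *\<^sub>C Q x)))"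
      using QM[of x] AQ sM RM[OF z'] T_Q[of x]
      by (simp add: bounded_ops_diff[OF R[OF z']] bounded_ops_scale[OF R[OF z']] bounded_ops_diff[OF F]
          bounded_ops_scale[OF F] \<phi>_diff \<phi>(2) complex_vector.subspace_scale)
    also have "\<dots> = 0"
      using FR[OF z' QM[of x]] linear_0[OF bounded_linear.linear[OF \<phi>(1)]] by (simp add: shift_def)
    finally show "blinfun_apply (shift (dual_op A) z (f z)) x = blinfun_apply 0 x" by simp
  qed
  moreover have "f ` ball 0 e \<subseteq> dual_space" using dual R by (auto simp: f_def)
  moreover have "vector_holomorphic_on f (ball 0 e)"
    using hol unfolding vector_holomorphic_on_def by blast
  ultimately have "f 0 = 0" using svep e unfolding SVEP_def by auto
  then have "blinfun_apply (f 0) w = 0" by simp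
  moreover have "R 0 w = w" using R1[of 0 w] w(1) e by simp
  ultimately show False using \<phi>(3) app[OF R[of 0]] e Q_id[OF w(1)] by (simp add: f_def)
qed

section \<open>Characterizations by spectra\<close>

lemma not_interior_iff:
  fixes S :: "complex set"
  shows "0 \<notin> interior S \<longleftrightarrow> (\<forall>e>0. \<exists>z. cmod z < e \<and> z \<notin> S)"
  unfolding mem_interior by (auto simp: subset_iff)

lemma not_islimpt_0_iff:
  fixes S :: "complex set"
  shows "\<not> 0 islimpt S \<longleftrightarrow> (\<exists>e>0. \<forall>z. z \<noteq> 0 \<and> cmod z < e \<longrightarrow> z \<notin> S)"
  unfolding islimpt_approachable by auto

lemma not_islimpt_imp_not_interior:
  fixes S :: "complex set"
  assumes "\<not> 0 islimpt S" shows "0 \<notin> interior S"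
  using assms interior_limit_point by blast

text \<open>
  Decomposability gives the strongest conditions, those for the right spectrum, for accumulation of
  the right Browder spectrum and for the dual operator.  Conversely, if the Saphar part is not right
  invertible, then a whole neighbourhood of \<open>0\<close> lies in the compression spectrum, hence in the right
  spectrum, and in the descent spectrum, hence in the right Browder spectrum; and the dual operator
  fails the single-valued extension property.
\<close>

lemma spectral_conditions_iff:
  fixes A :: "'a::complex_banach \<Rightarrow> 'a"
  assumes A: "A \<in> bounded_ops UNIV"
  shows "admits_GSRD UNIV A \<and> 0 \<notin> interior (right_spectrum UNIV A) \<longleftrightarrow> right_Riesz_decomposable A" (is ?r)
    and "admits_GSRD UNIV A \<and> SVEP dual_space (dual_op A) 0 \<longleftrightarrow> right_Riesz_decomposable A" (is ?svep)
    and "admits_GSRD UNIV A \<and> \<not> 0 islimpt right_Browder_spectrum UNIV A \<longleftrightarrow> right_Riesz_decomposable A" (is ?acc_B)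
    and "admits_GSRD UNIV A \<and> 0 \<notin> interior (right_Browder_spectrum UNIV A) \<longleftrightarrow> right_Riesz_decomposable A" (is ?int_B)
    and "admits_GSRD UNIV A \<and> \<not> 0 islimpt descent_spectrum UNIV A \<longleftrightarrow> right_Riesz_decomposable A" (is ?acc_d)
    and "admits_GSRD UNIV A \<and> 0 \<notin> interior (descent_spectrum UNIV A) \<longleftrightarrow> right_Riesz_decomposable A" (is ?int_d)
    and "admits_GSRD UNIV A \<and> 0 \<notin> interior (compression_spectrum UNIV A) \<longleftrightarrow> right_Riesz_decomposable A" (is ?cp)
proof -
  let ?D = "right_Riesz_decomposable A" and ?G = "admits_GSRD UNIV A"
  have cp_r: "compression_spectrum UNIV A \<subseteq> right_spectrum UNIV A"
  proof
    fix z assume "z \<in> compression_spectrum UNIV A"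
    then have "\<not> UNIV \<subseteq> range (shift A z)"
      using closure_subset[of "range (shift A z)"] by (auto simp: compression_spectrum_def)
    then show "z \<in> right_spectrum UNIV A"
      using right_invertible_iff[OF closed_csubspace_UNIV bounded_ops_shift[OF _ A]] by (auto simp: right_spectrum_def)
  qed
  have d_B: "descent_spectrum UNIV A \<subseteq> right_Browder_spectrum UNIV A"
    by (auto simp: descent_spectrum_def right_Browder_spectrum_def right_Browder_def)
  have fwd_G: "?G" if "?D" by (rule decomposable_imp_GSRD[OF A that])
  have fwd_r: "0 \<notin> interior (right_spectrum UNIV A)" if D: "?D"
    unfolding not_interior_iff
  proof (intro allI impI)
    fix e :: real assume e: "e > 0"
    obtain M N where red: "reducing UNIV M N A" and inv: "right_invertible M A" and Rz: "Riesz N A"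
      using D by (auto simp: right_Riesz_decomposable_def)
    show "\<exists>z. cmod z < e \<and> z \<notin> right_spectrum UNIV A"
      by (rule reducing.right_invertible_near_of_decomposition[OF red inv Rz e]) (auto simp: right_spectrum_def)
  qed
  have fwd_B: "\<not> 0 islimpt right_Browder_spectrum UNIV A" if D: "?D"
  proof -
    obtain M N where red: "reducing UNIV M N A" and inv: "right_invertible M A" and Rz: "Riesz N A"
      using D by (auto simp: right_Riesz_decomposable_def)
    show ?thesis
      unfolding not_islimpt_0_iff
      by (rule reducing.right_Browder_punctured_of_decomposition[OF red inv Rz])
        (auto simp: right_Browder_spectrum_def)
  qed
  have bwd: "?D \<or> (\<exists>e>0. \<forall>z. cmod z < e \<longrightarrow> z \<in> compression_spectrum UNIV A \<and> z \<in> descent_spectrum UNIV A)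
      \<and> \<not> SVEP dual_space (dual_op A) 0" if G: "?G"
  proof -
    obtain M N where red: "reducing UNIV M N A" and Sa: "Saphar M A" and Rz: "Riesz N A"
      using G admits_GSRD_iff[OF A] by blast
    show ?thesis
    proof (cases "right_invertible M A")
      case True
      then show ?thesis using red Rz unfolding right_Riesz_decomposable_def by blast
    next
      case False
      obtain e where "e > 0" "\<And>z. cmod z < e \<Longrightarrow> \<not> UNIV \<subseteq> closure (range (shift A z))"
        "\<And>z. cmod z < e \<Longrightarrow> descent UNIV (shift A z) = \<infinity>"
        by (rule reducing.not_right_invertible_spreads[OF red Sa False]) (rule that)
      then show ?thesis
        using not_dual_SVEP[OF red Sa False] unfolding compression_spectrum_def descent_spectrum_def by blast
    qed
  qed
  have bwd_d: "?D" if "?G" "0 \<notin> interior (descent_spectrum UNIV A)"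
    using bwd[OF that(1)] that(2) unfolding not_interior_iff by blast
  have bwd_cp: "?D" if "?G" "0 \<notin> interior (compression_spectrum UNIV A)"
    using bwd[OF that(1)] that(2) unfolding not_interior_iff by blast
  note int = interior_mono[OF cp_r] interior_mono[OF d_B]
  note acc = islimpt_subset[OF _ d_B, of 0]
  note li = not_islimpt_imp_not_interior[of "right_Browder_spectrum UNIV A"]
    not_islimpt_imp_not_interior[of "descent_spectrum UNIV A"]
  show ?r using fwd_G fwd_r bwd_cp int(1) by blast
  show ?svep using fwd_G dual_SVEP_of_decomposition[OF A] bwd by blast
  show ?acc_B using fwd_G fwd_B bwd_d int(2) li by blast
  show ?int_B using fwd_G fwd_B bwd_d int(2) li by blast
  show ?acc_d using fwd_G fwd_B bwd_d acc li by blast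
  show ?int_d using fwd_G fwd_B bwd_d int(2) li by blast
  show ?cp using fwd_G fwd_r bwd_cp int(1) by blast
qed

text \<open>
  Each of the first two conditions is a special case of the third, with \<open>D = A P\<close> and with \<open>C\<close> the
  respective right Browder operator.
\<close>

lemma Browder_conditions_iff:
  fixes A :: "'a::complex_banach \<Rightarrow> 'a"
  assumes A: "A \<in> bounded_ops UNIV"
  shows "(\<exists>P. projector P \<and> A \<circ> P = P \<circ> A \<and> right_Browder UNIV (\<lambda>x. A x + P x) \<and> Riesz UNIV (A \<circ> P))
      \<longleftrightarrow> right_Riesz_decomposable A" (is "?l1 \<longleftrightarrow> ?D")
    and "(\<exists>P. projector P \<and> A \<circ> P = P \<circ> A \<and> right_Browder UNIV (\<lambda>x. A (x - P x) + P x) \<and> Riesz UNIV (A \<circ> P))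
      \<longleftrightarrow> right_Riesz_decomposable A" (is "?l2 \<longleftrightarrow> ?D")
    and "(\<exists>C\<in>bounded_ops UNIV. \<exists>D\<in>bounded_ops UNIV. \<exists>P\<in>bounded_ops UNIV.
       right_Browder UNIV C \<and> Riesz UNIV D
       \<and> projector P \<and> P \<circ> C = C \<circ> P \<and> P \<circ> D = D \<circ> P
       \<and> A = (\<lambda>x. C (x - P x) + D (P x))) \<longleftrightarrow> right_Riesz_decomposable A" (is "?l3 \<longleftrightarrow> ?D")
proof -
  have fwd: "?l1 \<and> ?l2" if D: "?D"
    by (rule decomposable_imp_Browder_perturbation[OF A D]) blast
  have l3_D: "?D" if l: "?l3"
  proof -
    obtain C D P where "C \<in> bounded_ops UNIV" "D \<in> bounded_ops UNIV" "right_Browder UNIV C" "Riesz UNIV D"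
      "projector P" "P \<circ> C = C \<circ> P" "P \<circ> D = D \<circ> P" "A = (\<lambda>x. C (x - P x) + D (P x))" using l by blast
    then show ?thesis using Browder_Riesz_splitting_imp_decomposable[OF A] by blast
  qed
  have dif: "A (x - y) = A x - A y" for x y using bounded_ops_diff[OF A] by simp
  have AP: "A \<circ> P \<in> bounded_ops UNIV" if "P \<in> bounded_ops UNIV" for P
    using bounded_ops_compose[OF A that] by (simp add: comp_def)
  have l1_l3: "?l3" if l: "?l1"
  proof -
    obtain P where P: "projector P" "A \<circ> P = P \<circ> A" "right_Browder UNIV (\<lambda>x. A x + P x)" "Riesz UNIV (A \<circ> P)"
      using l by blast
    have PB: "P \<in> bounded_ops UNIV" and PP: "P (P x) = P x" for x
      using P(1) by (auto simp: projector_def fun_eq_iff)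
    have c: "A (P x) = P (A x)" for x using fun_cong[OF P(2), of x] by simp
    have padd: "P (x + y) = P x + P y" and pdif: "P (x - y) = P x - P y" for x y
      using bounded_ops_add[OF PB] bounded_ops_diff[OF PB] by simp_all
    show ?thesis
      by (rule bexI[of _ "\<lambda>x. A x + P x"], rule bexI[of _ "A \<circ> P"], rule bexI[of _ P])
        (use P PB AP[OF PB] bounded_ops_plus[OF _ A PB] in \<open>simp_all add: fun_eq_iff c PP padd pdif dif\<close>)
  qed
  have l2_l3: "?l3" if l: "?l2"
  proof -
    obtain P where P: "projector P" "A \<circ> P = P \<circ> A" "right_Browder UNIV (\<lambda>x. A (x - P x) + P x)" "Riesz UNIV (A \<circ> P)"
      using l by blast
    have PB: "P \<in> bounded_ops UNIV" and PP: "P (P x) = P x" for x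
      using P(1) by (auto simp: projector_def fun_eq_iff)
    have c: "A (P x) = P (A x)" for x using fun_cong[OF P(2), of x] by simp
    have padd: "P (x + y) = P x + P y" and pdif: "P (x - y) = P x - P y" for x y
      using bounded_ops_add[OF PB] bounded_ops_diff[OF PB] by simp_all
    have CB: "(\<lambda>x. A (x - P x) + P x) \<in> bounded_ops UNIV"
      by (intro bounded_ops_plus bounded_ops_compose[OF A] bounded_ops_minus bounded_ops_id PB) simp_all
    show ?thesis
      by (rule bexI[of _ "\<lambda>x. A (x - P x) + P x"], rule bexI[of _ "A \<circ> P"], rule bexI[of _ P])
        (use P PB AP[OF PB] CB in \<open>simp_all add: fun_eq_iff c PP padd pdif dif\<close>)
  qed
  show "?l1 \<longleftrightarrow> ?D" "?l2 \<longleftrightarrow> ?D" "?l3 \<longleftrightarrow> ?D" using fwd l3_D l1_l3 l2_l3 by blast+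
qed

theorem theorem4p6:
  fixes A :: "'a::complex_banach \<Rightarrow> 'a"
  assumes "cdim (UNIV :: 'a set) = \<infinity>"
    and "A \<in> bounded_ops UNIV"
  shows "all_equivalent
    [\<comment> \<open>(i)\<close>
     \<exists>B\<in>bounded_ops UNIV. A \<circ> B \<circ> A = A \<circ> A \<circ> B \<and> A \<circ> B \<circ> B = B
       \<and> Riesz UNIV (\<lambda>x. A x - (A \<circ> B \<circ> A) x),
     \<comment> \<open>(ii)\<close>
     \<exists>C\<in>bounded_ops UNIV. A \<circ> C \<circ> A = A \<circ> A \<circ> C \<and> A \<circ> C \<circ> C = C \<and> C = C \<circ> A \<circ> C
       \<and> Riesz UNIV (\<lambda>x. A x - (A \<circ> C \<circ> A) x),
     \<comment> \<open>(iii)\<close>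
     \<exists>(M, N)\<in>Red UNIV A. right_invertible M A \<and> Riesz N A,
     \<comment> \<open>(iv)\<close>
     \<exists>P. projector P \<and> A \<circ> P = P \<circ> A
       \<and> right_Browder UNIV (\<lambda>x. A x + P x) \<and> Riesz UNIV (A \<circ> P),
     \<comment> \<open>(v)\<close>
     \<exists>P. projector P \<and> A \<circ> P = P \<circ> A
       \<and> right_Browder UNIV (\<lambda>x. A (x - P x) + P x) \<and> Riesz UNIV (A \<circ> P),
     \<comment> \<open>(vi)\<close>
     \<exists>C\<in>bounded_ops UNIV. \<exists>D\<in>bounded_ops UNIV. \<exists>P\<in>bounded_ops UNIV.
       right_Browder UNIV C \<and> Riesz UNIV D
       \<and> projector P \<and> P \<circ> C = C \<circ> P \<and> P \<circ> D = D \<circ> P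
       \<and> A = (\<lambda>x. C (x - P x) + D (P x)),
     \<comment> \<open>(vii)\<close>
     right_Riesz_quasipolar A,
     \<comment> \<open>(viii)\<close>
     admits_GSRD UNIV A \<and> 0 \<notin> interior (right_spectrum UNIV A),
     \<comment> \<open>(ix)\<close>
     admits_GSRD UNIV A \<and> SVEP dual_space (dual_op A) 0,
     \<comment> \<open>(x)\<close>
     admits_GSRD UNIV A \<and> \<not> 0 islimpt right_Browder_spectrum UNIV A,
     \<comment> \<open>(xi)\<close>
     admits_GSRD UNIV A \<and> 0 \<notin> interior (right_Browder_spectrum UNIV A),
     \<comment> \<open>(xii)\<close>
     admits_GSRD UNIV A \<and> \<not> 0 islimpt descent_spectrum UNIV A,
     \<comment> \<open>(xiii)\<close>
     admits_GSRD UNIV A \<and> 0 \<notin> interior (descent_spectrum UNIV A),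
     \<comment> \<open>(xiv)\<close>
     admits_GSRD UNIV A \<and> 0 \<notin> interior (compression_spectrum UNIV A)]"
  unfolding generalized_Drazin_Riesz_iff[OF assms(2)] decomposable_iff_Red[OF assms(2)]
    Browder_conditions_iff[OF assms(2)] right_Riesz_quasipolar_iff[OF assms(2)]
    spectral_conditions_iff[OF assms(2)]
  by (simp add: all_equivalent_def)

end
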